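(* Let $\mathbb K$ be a restrained definably complete expansion of an ordered field, and let $A, A' \subseteq \mathbb K^n$ be $\mathcal D_\Sigma$ sets. Then: (1) $\dim(\overline{A}) = \dim(A)$, where $\overline A$ is the topological closure of $A$; (2) if $f: A \to \mathbb K^n$ is definable and continuous, then $\dim(f(A)) \le \dim(A)$; (3) $\dim(A\cup A') = \max(\dim(A),\dim(A'))$; (4) if $B\subseteq\mathbb K^{n+m}$ is a $\mathcal D_\Sigma$ set, $C$ is the projection of $B$ onto the first $n$ coordinates, $\dim(C)=p$, and $\dim(B_{\bar a}) = q$ for every $\bar a\in C$, where $B_{\bar a}=\{\bar c\in\mathbb K^m:(\bar a,\bar c)\in B\}$, then $\dim(B) = p+q$.
   Context: $\mathbb K$ is an expansion of an ordered field, with the order topology on $\mathbb K$ and product topology on $\mathbb K^n$; "definable" means definable in $\mathbb K$ with parameters. $\mathbb K$ is definably complete if every definable subset of $\mathbb K$ has a least upper bound in $\mathbb K\cup\{\pm\infty\}$. $\mathbb K$ is restrained if it is definably complete and for every definable discrete $D\subseteq\mathbb K^k$ and every definable $g:D\to\mathbb K$, $g(D)$ is nowhere dense in $\mathbb K$. A definable $X\subseteq\mathbb K^n$ is a $\mathcal D_\Sigma$ set if $X$ is the projection onto the first $n$ coordinates of some definable closed $Y\subseteq\mathbb K^{n+1}$. For $X\subseteq\mathbb K^n$, $\dim(X)$ is the maximum $e$ such that there is a coordinate subspace $L$ of linear dimension $e$ with the orthogonal projection of $X$ onto $L$ having nonempty interior in $L$. *)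

theory Defs
  imports "HOL-Analysis.Analysis" "HOL-Library.Extended" "HOL-Library.Lub_Glb"
begin

text \<open>
  The ordered field is the whole type \<^typ>\<open>'a\<close> of sort
  \<open>{linordered_field, linorder_topology}\<close>, so that its topology is the order topology. An
  expansion adds function symbols \<^typ>\<open>'f\<close> and relation symbols \<^typ>\<open>'r\<close> to the language of
  ordered fields. Interpretations are only ever applied to argument lists of the right length.
\<close>

record ('f, 'r, 'a) expansion =
  fun_arity :: "'f \<Rightarrow> nat"
  rel_arity :: "'r \<Rightarrow> nat"
  fun_interp :: "'f \<Rightarrow> 'a list \<Rightarrow> 'a"
  rel_interp :: "'r \<Rightarrow> 'a list \<Rightarrow> bool"

datatype 'f trm =
    TVar nat
  | TZero
  | TOne
  | TMinus "'f trm"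
  | TPlus "'f trm" "'f trm"
  | TTimes "'f trm" "'f trm"
  | TFun 'f "'f trm list"

datatype ('f, 'r) fml =
    FEq "'f trm" "'f trm"
  | FLess "'f trm" "'f trm"
  | FRel 'r "'f trm list"
  | FNot "('f, 'r) fml"
  | FAnd "('f, 'r) fml" "('f, 'r) fml"
  | FEx nat "('f, 'r) fml"

primrec wf_trm :: "('f, 'r, 'a) expansion \<Rightarrow> 'f trm \<Rightarrow> bool" where
  "wf_trm K (TVar i) \<longleftrightarrow> True"
| "wf_trm K TZero \<longleftrightarrow> True"
| "wf_trm K TOne \<longleftrightarrow> True"
| "wf_trm K (TMinus s) \<longleftrightarrow> wf_trm K s"
| "wf_trm K (TPlus s t) \<longleftrightarrow> wf_trm K s \<and> wf_trm K t"
| "wf_trm K (TTimes s t) \<longleftrightarrow> wf_trm K s \<and> wf_trm K t"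
| "wf_trm K (TFun f ts) \<longleftrightarrow> length ts = fun_arity K f \<and> list_all (wf_trm K) ts"

primrec wf_fml :: "('f, 'r, 'a) expansion \<Rightarrow> ('f, 'r) fml \<Rightarrow> bool" where
  "wf_fml K (FEq s t) \<longleftrightarrow> wf_trm K s \<and> wf_trm K t"
| "wf_fml K (FLess s t) \<longleftrightarrow> wf_trm K s \<and> wf_trm K t"
| "wf_fml K (FRel r ts) \<longleftrightarrow> length ts = rel_arity K r \<and> list_all (wf_trm K) ts"
| "wf_fml K (FNot \<phi>) \<longleftrightarrow> wf_fml K \<phi>"
| "wf_fml K (FAnd \<phi> \<psi>) \<longleftrightarrow> wf_fml K \<phi> \<and> wf_fml K \<psi>"
| "wf_fml K (FEx i \<phi>) \<longleftrightarrow> wf_fml K \<phi>"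

primrec eval_trm ::
  "('f, 'r, 'a::linordered_field) expansion \<Rightarrow> (nat \<Rightarrow> 'a) \<Rightarrow> 'f trm \<Rightarrow> 'a" where
  "eval_trm K e (TVar i) = e i"
| "eval_trm K e TZero = 0"
| "eval_trm K e TOne = 1"
| "eval_trm K e (TMinus s) = - eval_trm K e s"
| "eval_trm K e (TPlus s t) = eval_trm K e s + eval_trm K e t"
| "eval_trm K e (TTimes s t) = eval_trm K e s * eval_trm K e t"
| "eval_trm K e (TFun f ts) = fun_interp K f (map (eval_trm K e) ts)"

primrec sat ::
  "('f, 'r, 'a::linordered_field) expansion \<Rightarrow> (nat \<Rightarrow> 'a) \<Rightarrow> ('f, 'r) fml \<Rightarrow> bool" where
  "sat K e (FEq s t) \<longleftrightarrow> eval_trm K e s = eval_trm K e t"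
| "sat K e (FLess s t) \<longleftrightarrow> eval_trm K e s < eval_trm K e t"
| "sat K e (FRel r ts) \<longleftrightarrow> rel_interp K r (map (eval_trm K e) ts)"
| "sat K e (FNot \<phi>) \<longleftrightarrow> \<not> sat K e \<phi>"
| "sat K e (FAnd \<phi> \<psi>) \<longleftrightarrow> sat K e \<phi> \<and> sat K e \<psi>"
| "sat K e (FEx i \<phi>) \<longleftrightarrow> (\<exists>a. sat K (e(i := a)) \<phi>)"

text \<open>
  A point of the $n$-th power of the field is a function on \<^term>\<open>{..<n}\<close>, extensional outside
  of it; these are the points of the library's product topology.
\<close>

abbreviation pow_space :: "nat \<Rightarrow> (nat \<Rightarrow> 'a) set" where
  "pow_space n \<equiv> (\<Pi>\<^sub>E i\<in>{..<n}. UNIV)"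

abbreviation pow_top :: "nat \<Rightarrow> (nat \<Rightarrow> 'a::topological_space) topology" where
  "pow_top n \<equiv> product_topology (\<lambda>_. euclidean) {..<n}"

definition singleton_point :: "'a \<Rightarrow> nat \<Rightarrow> 'a" where
  "singleton_point a = (\<lambda>i\<in>{..<1}. a)"

definition concat_point :: "nat \<Rightarrow> nat \<Rightarrow> (nat \<Rightarrow> 'a) \<Rightarrow> (nat \<Rightarrow> 'a) \<Rightarrow> nat \<Rightarrow> 'a" where
  "concat_point n m a c = (\<lambda>i\<in>{..<n + m}. if i < n then a i else c (i - n))"

definition proj_first :: "nat \<Rightarrow> (nat \<Rightarrow> 'a) \<Rightarrow> nat \<Rightarrow> 'a" where
  "proj_first n x = restrict x {..<n}"

definition fiber :: "nat \<Rightarrow> nat \<Rightarrow> (nat \<Rightarrow> 'a) set \<Rightarrow> (nat \<Rightarrow> 'a) \<Rightarrow> (nat \<Rightarrow> 'a) set" where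
  "fiber n m B a = {c \<in> pow_space m. concat_point n m a c \<in> B}"

text \<open>
  In a formula defining a subset of the $n$-th power, the variables below \<open>n\<close> are the coordinates
  and the remaining free variables are assigned the parameters \<open>p\<close>.
\<close>

definition definable ::
  "('f, 'r, 'a::linordered_field) expansion \<Rightarrow> nat \<Rightarrow> (nat \<Rightarrow> 'a) set \<Rightarrow> bool" where
  "definable K n X \<longleftrightarrow>
     (\<exists>\<phi> p. wf_fml K \<phi> \<and> X = {x \<in> pow_space n. sat K (override_on p x {..<n}) \<phi>})"

definition definable_map ::
  "('f, 'r, 'a::linordered_field) expansion \<Rightarrow> nat \<Rightarrow> nat \<Rightarrow> (nat \<Rightarrow> 'a) set
     \<Rightarrow> ((nat \<Rightarrow> 'a) \<Rightarrow> (nat \<Rightarrow> 'a)) \<Rightarrow> bool" where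
  "definable_map K n m X f \<longleftrightarrow>
     X \<subseteq> pow_space n \<and> f ` X \<subseteq> pow_space m \<and>
     definable K (n + m) ((\<lambda>x. concat_point n m x (f x)) ` X)"

definition definably_complete :: "('f, 'r, 'a::linordered_field) expansion \<Rightarrow> bool" where
  "definably_complete K \<longleftrightarrow>
     (\<forall>X. definable K 1 (singleton_point ` X) \<longrightarrow> (\<exists>s. isLub UNIV (Fin ` X) s))"

definition nowhere_dense :: "'a::topological_space set \<Rightarrow> bool" where
  "nowhere_dense X \<longleftrightarrow> interior (closure X) = {}"

definition restrained ::
  "('f, 'r, 'a::{linordered_field, linorder_topology}) expansion \<Rightarrow> bool" where
  "restrained K \<longleftrightarrow>
     definably_complete K \<and>
     (\<forall>k D (g :: (nat \<Rightarrow> 'a) \<Rightarrow> 'a).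
        definable K k D \<and> subtopology (pow_top k) D = discrete_topology D \<and>
        definable_map K k 1 D (\<lambda>x. singleton_point (g x))
        \<longrightarrow> nowhere_dense (g ` D))"

definition D_Sigma ::
  "('f, 'r, 'a::{linordered_field, linorder_topology}) expansion \<Rightarrow> nat \<Rightarrow> (nat \<Rightarrow> 'a) set \<Rightarrow> bool"
  where
  "D_Sigma K n X \<longleftrightarrow>
     definable K n X \<and>
     (\<exists>Y. definable K (n + 1) Y \<and> closedin (pow_top (n + 1)) Y \<and> X = proj_first n ` Y)"

text \<open>
  The coordinate subspace spanned by the standard basis vectors with indices in \<open>S\<close>; its linear
  dimension is \<^term>\<open>card S\<close>.
\<close>

definition coord_subspace :: "nat \<Rightarrow> nat set \<Rightarrow> (nat \<Rightarrow> 'a::zero) set" where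
  "coord_subspace n S = {x \<in> pow_space n. \<forall>i\<in>{..<n} - S. x i = 0}"

definition coord_proj :: "nat \<Rightarrow> nat set \<Rightarrow> (nat \<Rightarrow> 'a::zero) \<Rightarrow> nat \<Rightarrow> 'a" where
  "coord_proj n S x = (\<lambda>i\<in>{..<n}. if i \<in> S then x i else 0)"

text \<open>
  For \<open>X \<noteq> {}\<close> the set below contains \<open>0\<close> (take \<open>S = {}\<close>) and is bounded by \<open>n\<close>. For \<open>X = {}\<close> it
  is empty, and the dimension is $-\infty$ by convention. The value \<^term>\<open>Pinf\<close> is never attained.
\<close>

definition dim_set :: "nat \<Rightarrow> (nat \<Rightarrow> 'a::{zero, topological_space}) set \<Rightarrow> nat extended" where
  "dim_set n X =
     (if X = {} then Minf
      else Fin (Max {card S | S. S \<subseteq> {..<n} \<and>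
             subtopology (pow_top n) (coord_subspace n S) interior_of (coord_proj n S ` X) \<noteq> {}}))"

end

theory Submission
  imports Defs
begin

text \<open>
  Predicates on assignments \<open>e :: nat \<Rightarrow> 'a\<close> replace subsets of powers of the field, and the
  dimension is governed by two quantifiers: existence of a value of a variable, and existence of an
  interval of values. On increasing unions of closed definable families these quantifiers satisfy
  commutation rules, which combine into one formula: a set in the variables \<open>N \<union> M\<close> has dimension at
  least \<open>k\<close> iff \<open>k = i + j\<close> such that the assignments of \<open>N\<close> whose fiber has dimension at least \<open>j\<close>
  have dimension at least \<open>i\<close>. Applied to a set and its fibers it gives the fiber formula, and applied
  to a graph in both orders it bounds the dimension of an image.

  The rules rest on a one-dimensional Baire theorem: if no member of an increasing closed family
  contained an interval while its union is dense in one, strict local minima of the entry time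
  would give a discrete definable set with a somewhere dense projection, against restrainedness.
  The only rule that is not a Kuratowski-Ulam type statement exchanges the two quantifiers: if every
  value of \<open>y\<close> in an interval has a witness \<open>x\<close>, then the least witness is a lower semicontinuous
  function of \<open>y\<close>, hence by Baire continuous on an interval, and there constant or onto an interval.
\<close>

section \<open>Definable predicates and terms\<close>

primrec rename_trm :: "(nat \<Rightarrow> nat) \<Rightarrow> 'f trm \<Rightarrow> 'f trm" where
  "rename_trm r (TVar i) = TVar (r i)"
| "rename_trm r TZero = TZero"
| "rename_trm r TOne = TOne"
| "rename_trm r (TMinus s) = TMinus (rename_trm r s)"
| "rename_trm r (TPlus s t) = TPlus (rename_trm r s) (rename_trm r t)"
| "rename_trm r (TTimes s t) = TTimes (rename_trm r s) (rename_trm r t)"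
| "rename_trm r (TFun f ts) = TFun f (map (rename_trm r) ts)"

primrec rename_fml :: "(nat \<Rightarrow> nat) \<Rightarrow> ('f, 'r) fml \<Rightarrow> ('f, 'r) fml" where
  "rename_fml r (FEq s t) = FEq (rename_trm r s) (rename_trm r t)"
| "rename_fml r (FLess s t) = FLess (rename_trm r s) (rename_trm r t)"
| "rename_fml r (FRel R ts) = FRel R (map (rename_trm r) ts)"
| "rename_fml r (FNot \<phi>) = FNot (rename_fml r \<phi>)"
| "rename_fml r (FAnd \<phi> \<psi>) = FAnd (rename_fml r \<phi>) (rename_fml r \<psi>)"
| "rename_fml r (FEx i \<phi>) = FEx (r i) (rename_fml r \<phi>)"

lemma wf_rename_trm: "wf_trm K t \<Longrightarrow> wf_trm K (rename_trm r t)"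
  by (induction t) (auto simp: list_all_iff)

lemma wf_rename_fml: "wf_fml K \<phi> \<Longrightarrow> wf_fml K (rename_fml r \<phi>)"
  by (induction \<phi>) (auto simp: list_all_iff wf_rename_trm)

lemma eval_rename_trm: "eval_trm K e (rename_trm r t) = eval_trm K (e \<circ> r) t"
  by (induction t) (auto simp: comp_def cong: map_cong)

lemma sat_rename_fml:
  assumes "inj r"
  shows "sat K e (rename_fml r \<phi>) \<longleftrightarrow> sat K (e \<circ> r) \<phi>"
proof (induction \<phi> arbitrary: e)
  case (FEx i \<phi>)
  have "(e(r i := a)) \<circ> r = (e \<circ> r)(i := a)" for a
    using assms by (auto simp: fun_eq_iff inj_eq)
  thus ?case unfolding rename_fml.simps sat.simps FEx.IH by simp
qed (simp_all add: eval_rename_trm comp_def)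

locale definable_predicates =
  fixes K :: "('f, 'r, 'a::{linordered_field, linorder_topology}) expansion"
begin

definition definable_pred :: "((nat \<Rightarrow> 'a) \<Rightarrow> bool) \<Rightarrow> bool" where
  "definable_pred P \<longleftrightarrow>
     (\<exists>\<phi> p N. wf_fml K \<phi> \<and> (\<forall>e. P e \<longleftrightarrow> sat K (override_on p e {..<N}) \<phi>))"

text \<open>
  In a graph, variable \<open>0\<close> holds the value and the arguments are shifted up by one, as they are
  under a quantifier.
\<close>

definition definable_term :: "((nat \<Rightarrow> 'a) \<Rightarrow> 'a) \<Rightarrow> bool" where
  "definable_term T \<longleftrightarrow> definable_pred (\<lambda>e. e 0 = T (\<lambda>i. e (Suc i)))"

abbreviation definable_unary :: "('a \<Rightarrow> bool) \<Rightarrow> bool" where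
  "definable_unary X \<equiv> definable_pred (\<lambda>e. X (e 0))"

abbreviation definable_binary :: "('a \<Rightarrow> 'a \<Rightarrow> bool) \<Rightarrow> bool" where
  "definable_binary X \<equiv> definable_pred (\<lambda>e. X (e 0) (e 1))"

lemma definable_pred_finite_support:
  assumes "definable_pred P"
  obtains N where "\<And>e e'. (\<And>i. i < N \<Longrightarrow> e i = e' i) \<Longrightarrow> P e \<longleftrightarrow> P e'"
proof -
  obtain \<phi> p N where \<phi>: "wf_fml K \<phi>" and P: "\<And>e. P e \<longleftrightarrow> sat K (override_on p e {..<N}) \<phi>"
    using assms unfolding definable_pred_def by blast
  have "P e \<longleftrightarrow> P e'" if "\<And>i. i < N \<Longrightarrow> e i = e' i" for e e'
  proof -
    have "override_on p e {..<N} = override_on p e' {..<N}"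
      using that by (auto simp: override_on_def)
    thus ?thesis by (simp add: P)
  qed
  thus thesis by (rule that)
qed

lemma definable_pred_renameI:
  assumes "wf_fml K \<phi>" "inj r" "\<And>e. P e \<longleftrightarrow> sat K (override_on p e {..<N} \<circ> r) \<phi>"
  shows "definable_pred P"
  unfolding definable_pred_def
  using assms wf_rename_fml sat_rename_fml by (intro exI[of _ "rename_fml r \<phi>"]) blast

lemma definable_pred_not: "definable_pred P \<Longrightarrow> definable_pred (\<lambda>e. \<not> P e)"
  unfolding definable_pred_def by (metis sat.simps(4) wf_fml.simps(4))

lemma definable_pred_conj:
  assumes "definable_pred P" "definable_pred Q"
  shows "definable_pred (\<lambda>e. P e \<and> Q e)"
proof -
  obtain \<phi> p N where \<phi>: "wf_fml K \<phi>" "\<And>e. P e \<longleftrightarrow> sat K (override_on p e {..<N}) \<phi>"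
    using assms(1) unfolding definable_pred_def by blast
  obtain \<psi> q M where \<psi>: "wf_fml K \<psi>" "\<And>e. Q e \<longleftrightarrow> sat K (override_on q e {..<M}) \<psi>"
    using assms(2) unfolding definable_pred_def by blast
  define L where "L = max N M"
  \<comment> \<open>The parameters of the two formulas are interleaved behind the common variables.\<close>
  define r where "r = (\<lambda>i. if i < N then i else L + 2 * (i - N))"
  define s where "s = (\<lambda>i. if i < M then i else L + 2 * (i - M) + 1)"
  define pq where "pq = (\<lambda>j. if even (j - L) then p (N + (j - L) div 2) else q (M + (j - L) div 2))"
  have inj: "inj r" "inj s"
    by (auto simp: inj_def r_def s_def L_def split: if_splits)
  have p: "override_on pq e {..<L} \<circ> r = override_on p e {..<N}" for e
    by (auto simp: fun_eq_iff override_on_def r_def pq_def L_def)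
  have q: "override_on pq e {..<L} \<circ> s = override_on q e {..<M}" for e
    by (auto simp: fun_eq_iff override_on_def s_def pq_def L_def)
  have "P e \<and> Q e \<longleftrightarrow> sat K (override_on pq e {..<L}) (FAnd (rename_fml r \<phi>) (rename_fml s \<psi>))" for e
    by (simp add: sat_rename_fml inj p q \<phi>(2) \<psi>(2))
  moreover have "wf_fml K (FAnd (rename_fml r \<phi>) (rename_fml s \<psi>))"
    using \<phi>(1) \<psi>(1) by (simp add: wf_rename_fml)
  ultimately show ?thesis unfolding definable_pred_def by blast
qed

lemma definable_pred_ex_upd:
  assumes "definable_pred P"
  shows "definable_pred (\<lambda>e. \<exists>a. P (e(v := a)))"
proof -
  obtain \<phi> p N where \<phi>: "wf_fml K \<phi>" "\<And>e. P e \<longleftrightarrow> sat K (override_on p e {..<N}) \<phi>"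
    using assms unfolding definable_pred_def by blast
  define L where "L = N + v + 1"
  define r where "r = (\<lambda>i. if i < N then i else i + (v + 1))"
  define q where "q = (\<lambda>j. p (j - (v + 1)))"
  have "inj r" by (auto simp: inj_def r_def split: if_splits)
  moreover have "override_on q e {..<L} \<circ> r = override_on p e {..<N}" for e
    by (auto simp: fun_eq_iff override_on_def r_def q_def L_def)
  ultimately have P: "P e \<longleftrightarrow> sat K (override_on q e {..<L}) (rename_fml r \<phi>)" for e
    by (simp add: sat_rename_fml \<phi>(2))
  have "(override_on q e {..<L})(v := a) = override_on q (e(v := a)) {..<L}" for e a
    by (auto simp: fun_eq_iff override_on_def L_def)
  hence "(\<exists>a. P (e(v := a))) \<longleftrightarrow> sat K (override_on q e {..<L}) (FEx v (rename_fml r \<phi>))" for e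
    by (simp add: P)
  moreover have "wf_fml K (FEx v (rename_fml r \<phi>))"
    using \<phi>(1) by (simp add: wf_rename_fml)
  ultimately show ?thesis unfolding definable_pred_def by blast
qed

lemma definable_pred_ex_override:
  assumes "definable_pred P" "finite S"
  shows "definable_pred (\<lambda>e. \<exists>z. P (override_on e z S))"
  using assms(2)
proof (induction S rule: finite_induct)
  case empty
  thus ?case using assms by simp
next
  case (insert v S)
  have "(\<exists>z. P (override_on e z (insert v S))) \<longleftrightarrow> (\<exists>a z. P (override_on (e(v := a)) z S))" for e
  proof -
    have "override_on e z (insert v S) = override_on (e(v := z v)) z S" for z
      by (auto simp: override_on_def fun_eq_iff)
    moreover have "override_on (e(v := a)) z S = override_on e (z(v := a)) (insert v S)" for a z
      using insert by (auto simp: override_on_def fun_eq_iff)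
    ultimately show ?thesis by metis
  qed
  thus ?case using definable_pred_ex_upd[OF insert.IH, of v] by presburger
qed

lemma definable_pred_eq_var: "definable_pred (\<lambda>e. e i = e j)"
  unfolding definable_pred_def
  by (rule exI[of _ "FEq (TVar i) (TVar j)"], rule exI, rule exI[of _ "i + j + 1"])
     (simp add: override_on_def)

lemma definable_pred_less_var: "definable_pred (\<lambda>e. e i < e j)"
  unfolding definable_pred_def
  by (rule exI[of _ "FLess (TVar i) (TVar j)"], rule exI, rule exI[of _ "i + j + 1"])
     (simp add: override_on_def)

lemma definable_pred_const: "definable_pred (\<lambda>e. c)"
  unfolding definable_pred_def
  by (cases c) (rule exI[of _ "FEq TZero TZero"], simp,
      rule exI[of _ "FNot (FEq TZero TZero)"], simp)

lemma definable_pred_ball_finite: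
  "finite S \<Longrightarrow> (\<And>i. i \<in> S \<Longrightarrow> definable_pred (P i)) \<Longrightarrow> definable_pred (\<lambda>e. \<forall>i\<in>S. P i e)"
  by (induction S rule: finite_induct) (simp_all add: definable_pred_const definable_pred_conj)

lemma definable_pred_rename_inj:
  assumes "definable_pred P" "inj \<rho>"
  shows "definable_pred (\<lambda>e. P (\<lambda>i. e (\<rho> i)))"
proof -
  obtain \<phi> p N where \<phi>: "wf_fml K \<phi>" "\<And>e. P e \<longleftrightarrow> sat K (override_on p e {..<N}) \<phi>"
    using assms(1) unfolding definable_pred_def by blast
  obtain M where M: "\<And>i. i < N \<Longrightarrow> \<rho> i < M"
    using finite_nat_set_iff_bounded[of "\<rho> ` {..<N}"] by auto
  define r where "r = (\<lambda>i. if i < N then \<rho> i else M + i)"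
  show ?thesis
  proof (rule definable_pred_renameI[OF \<phi>(1)])
    show "inj r"
      unfolding r_def inj_def using assms(2) by (metis M add_left_cancel injD not_add_less1)
    have "override_on p (\<lambda>i. e (\<rho> i)) {..<N} = override_on (\<lambda>j. p (j - M)) e {..<M} \<circ> r" for e
      by (auto simp: fun_eq_iff override_on_def r_def dest: M)
    thus "P (\<lambda>i. e (\<rho> i)) \<longleftrightarrow> sat K (override_on (\<lambda>j. p (j - M)) e {..<M} \<circ> r) \<phi>" for e
      by (simp add: \<phi>(2))
  qed
qed

lemma definable_pred_unshift:
  assumes "definable_pred (\<lambda>e. P (\<lambda>i. e (M + i)))"
  shows "definable_pred P"
proof -
  obtain \<phi> p N where \<phi>: "wf_fml K \<phi>"
    "\<And>e. P (\<lambda>i. e (M + i)) \<longleftrightarrow> sat K (override_on p e {..<N}) \<phi>"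
    using assms unfolding definable_pred_def by blast
  define r where "r = (\<lambda>i. if M \<le> i \<and> i < N then i - M else N + i)"
  define q where "q = (\<lambda>j. override_on p (\<lambda>_. 0) {..<N} (j - N))"
  show ?thesis
  proof (rule definable_pred_renameI[OF \<phi>(1)])
    show "inj r" by (auto simp: inj_def r_def split: if_splits)
    fix e :: "nat \<Rightarrow> 'a"
    have "P e \<longleftrightarrow> sat K (override_on p (\<lambda>i. if M \<le> i then e (i - M) else 0) {..<N}) \<phi>"
      using \<phi>(2)[of "\<lambda>i. if M \<le> i then e (i - M) else 0"] by simp
    also have "override_on p (\<lambda>i. if M \<le> i then e (i - M) else 0) {..<N} = override_on q e {..<N} \<circ> r"
      by (auto simp: fun_eq_iff override_on_def r_def q_def)
    finally show "P e \<longleftrightarrow> sat K (override_on q e {..<N} \<circ> r) \<phi>" .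
  qed
qed

lemma definable_pred_subst:
  assumes "definable_pred P" and T: "\<And>i. definable_term (\<lambda>e. T e i)"
  shows "definable_pred (\<lambda>e. P (T e))"
proof -
  obtain N where N: "\<And>e e'. (\<And>i. i < N \<Longrightarrow> e i = e' i) \<Longrightarrow> P e \<longleftrightarrow> P e'"
    using definable_pred_finite_support[OF assms(1)] by blast
  have "definable_pred (\<lambda>e. e i = T (\<lambda>j. e (N + j)) i)" if "i < N" for i
  proof -
    have "inj (\<lambda>k. case k of 0 \<Rightarrow> i | Suc j \<Rightarrow> N + j)"
      using that by (auto simp: inj_def split: nat.splits)
    from definable_pred_rename_inj[OF T[of i, unfolded definable_term_def] this] show ?thesis
      by simp
  qed
  hence "definable_pred (\<lambda>e. (\<forall>i\<in>{..<N}. e i = T (\<lambda>j. e (N + j)) i) \<and> P e)"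
    using assms(1) by (intro definable_pred_conj definable_pred_ball_finite) auto
  hence "definable_pred (\<lambda>e. \<exists>z. (\<forall>i\<in>{..<N}. override_on e z {..<N} i =
      T (\<lambda>j. override_on e z {..<N} (N + j)) i) \<and> P (override_on e z {..<N}))"
    by (rule definable_pred_ex_override) simp
  moreover have "(\<exists>z. (\<forall>i\<in>{..<N}. override_on e z {..<N} i = T (\<lambda>j. override_on e z {..<N} (N + j)) i) \<and>
      P (override_on e z {..<N})) \<longleftrightarrow> P (T (\<lambda>j. e (N + j)))" (is "(\<exists>z. ?solves z \<and> _) \<longleftrightarrow> _") for e
  proof -
    have "P (override_on e z {..<N}) \<longleftrightarrow> P (T (\<lambda>j. e (N + j)))" if "?solves z" for z
      using that by (intro N) (simp add: override_on_def)
    moreover have "?solves (T (\<lambda>j. e (N + j)))"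
      by (simp add: override_on_def)
    ultimately show ?thesis by blast
  qed
  ultimately have "definable_pred (\<lambda>e. P (T (\<lambda>j. e (N + j))))" by simp
  thus ?thesis by (rule definable_pred_unshift)
qed

lemma definable_term_var: "definable_term (\<lambda>e. e i)"
  unfolding definable_term_def by (rule definable_pred_eq_var)

lemma definable_pred_rename: "definable_pred P \<Longrightarrow> definable_pred (\<lambda>e. P (\<lambda>i. e (\<rho> i)))"
  by (rule definable_pred_subst[OF _ definable_term_var])

lemma definable_term_const: "definable_term (\<lambda>e. c)"
  unfolding definable_term_def definable_pred_def
  by (rule exI[of _ "FEq (TVar 0) (TVar 1)"], rule exI[of _ "\<lambda>_. c"], rule exI[of _ 1])
     (simp add: override_on_def)

lemma definable_term_shift: "definable_term T \<Longrightarrow> definable_term (\<lambda>e. T (\<lambda>i. e (Suc i)))"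
  unfolding definable_term_def
  using definable_pred_rename[of "\<lambda>e. e 0 = T (\<lambda>i. e (Suc i))" "\<lambda>k. case k of 0 \<Rightarrow> 0 | Suc j \<Rightarrow> Suc (Suc j)"]
  by simp

lemma definable_pred_subst3:
  assumes "definable_pred (\<lambda>e. P (e 0) (e 1) (e 2))"
    and "definable_term T" "definable_term S" "definable_term U"
  shows "definable_pred (\<lambda>e. P (T e) (S e) (U e))"
proof -
  have "definable_term (\<lambda>e. (if i = 0 then T else if i = (1::nat) then S else U) e)" for i
    using assms by simp
  from definable_pred_subst[OF assms(1), of "\<lambda>e i. (if i = 0 then T else if i = (1::nat) then S else U) e", OF this]
  show ?thesis by simp
qed

lemma definable_pred_subst2:
  "definable_binary R \<Longrightarrow> definable_term T \<Longrightarrow> definable_term S \<Longrightarrow> definable_pred (\<lambda>e. R (T e) (S e))"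
  by (rule definable_pred_subst3[of "\<lambda>a b c. R a b"])

lemma definable_pred_subst1:
  "definable_unary R \<Longrightarrow> definable_term T \<Longrightarrow> definable_pred (\<lambda>e. R (T e))"
  by (rule definable_pred_subst3[of "\<lambda>a b c. R a"])

lemma definable_pred_subst_Suc:
  assumes "definable_pred (\<lambda>e. Q (e 0) (\<lambda>i. e (Suc i)))" "definable_term T" "\<And>i. definable_term (\<lambda>e. U e i)"
  shows "definable_pred (\<lambda>e. Q (T e) (U e))"
proof -
  have "definable_term (\<lambda>e. case k of 0 \<Rightarrow> T e | Suc i \<Rightarrow> U e i)" for k
    using assms by (cases k) simp_all
  from definable_pred_subst[OF assms(1), of "\<lambda>e k. case k of 0 \<Rightarrow> T e | Suc i \<Rightarrow> U e i", OF this]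
  show ?thesis by simp
qed

lemma definable_term_subst2:
  assumes "definable_pred (\<lambda>e. e 0 = f (e 1) (e 2))" "definable_term T" "definable_term S"
  shows "definable_term (\<lambda>e. f (T e) (S e))"
  unfolding definable_term_def
  using definable_pred_subst3[OF assms(1) definable_term_var[of 0]
      definable_term_shift[OF assms(2)] definable_term_shift[OF assms(3)]] .

lemma definable_term_subst1:
  assumes "definable_term (\<lambda>e. f (e 0))" "definable_term T"
  shows "definable_term (\<lambda>e. f (T e))"
  using definable_term_subst2[of "\<lambda>x _. f x" T T] assms by (simp add: definable_term_def)

lemma definable_pred_less:
  "definable_term T \<Longrightarrow> definable_term S \<Longrightarrow> definable_pred (\<lambda>e. T e < S e)"
  using definable_pred_subst3[of "\<lambda>a b c. a < b", OF definable_pred_less_var] by blast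

lemma definable_pred_eq:
  "definable_term T \<Longrightarrow> definable_term S \<Longrightarrow> definable_pred (\<lambda>e. T e = S e)"
  using definable_pred_subst3[of "\<lambda>a b c. a = b", OF definable_pred_eq_var] by blast

lemma definable_pred_le:
  "definable_term T \<Longrightarrow> definable_term S \<Longrightarrow> definable_pred (\<lambda>e. T e \<le> S e)"
  unfolding not_less[symmetric] by (intro definable_pred_not definable_pred_less)

lemma definable_pred_disj:
  "definable_pred P \<Longrightarrow> definable_pred Q \<Longrightarrow> definable_pred (\<lambda>e. P e \<or> Q e)"
  using definable_pred_not[OF definable_pred_conj[OF definable_pred_not[of P] definable_pred_not[of Q]]]
  by simp

lemma definable_pred_imp:
  "definable_pred P \<Longrightarrow> definable_pred Q \<Longrightarrow> definable_pred (\<lambda>e. P e \<longrightarrow> Q e)"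
  unfolding imp_conv_disj by (intro definable_pred_disj definable_pred_not)

lemma definable_term_add:
  "definable_term T \<Longrightarrow> definable_term S \<Longrightarrow> definable_term (\<lambda>e. T e + S e)"
proof (rule definable_term_subst2[of "(+)"])
  show "definable_pred (\<lambda>e. e 0 = e 1 + e 2)"
    unfolding definable_pred_def
    by (rule exI[of _ "FEq (TVar 0) (TPlus (TVar 1) (TVar 2))"], rule exI, rule exI[of _ 3])
       (simp add: override_on_def)
qed

lemma definable_term_mult:
  "definable_term T \<Longrightarrow> definable_term S \<Longrightarrow> definable_term (\<lambda>e. T e * S e)"
proof (rule definable_term_subst2[of "(*)"])
  show "definable_pred (\<lambda>e. e 0 = e 1 * e 2)"
    unfolding definable_pred_def
    by (rule exI[of _ "FEq (TVar 0) (TTimes (TVar 1) (TVar 2))"], rule exI, rule exI[of _ 3])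
       (simp add: override_on_def)
qed

lemma definable_term_diff:
  "definable_term T \<Longrightarrow> definable_term S \<Longrightarrow> definable_term (\<lambda>e. T e - S e)"
  using definable_term_add[OF _ definable_term_mult[OF definable_term_const[of "-1"]], of T S] by simp

lemma definable_term_uminus: "definable_term T \<Longrightarrow> definable_term (\<lambda>e. - T e)"
  using definable_term_diff[OF definable_term_const[of 0]] by simp

lemma definable_term_divide:
  "definable_term T \<Longrightarrow> definable_term S \<Longrightarrow> definable_term (\<lambda>e. T e / S e)"
proof (rule definable_term_subst2[of "(/)"])
  have "definable_pred (\<lambda>e. (e 2 = 0 \<and> e 0 = 0) \<or> (\<not> e 2 = 0 \<and> e 0 * e 2 = e 1))"
    by (intro definable_pred_disj definable_pred_conj definable_pred_not definable_pred_eq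
        definable_term_var definable_term_const definable_term_mult)
  moreover have "((z = 0 \<and> x = 0) \<or> (\<not> z = 0 \<and> x * z = y)) \<longleftrightarrow> x = y / z" for x y z :: 'a
    by (cases "z = 0") (auto simp: field_simps)
  ultimately show "definable_pred (\<lambda>e. e 0 = e 1 / e 2)" by simp
qed

lemma definable_term_upd:
  "(i = j \<Longrightarrow> definable_term T) \<Longrightarrow> (i \<noteq> j \<Longrightarrow> definable_term (\<lambda>e. F e i))
    \<Longrightarrow> definable_term (\<lambda>e. ((F e)(j := T e)) i)"
  by (cases "i = j") auto

lemma definable_term_override:
  "(i \<in> S \<Longrightarrow> definable_term (\<lambda>e. G e i)) \<Longrightarrow> (i \<notin> S \<Longrightarrow> definable_term (\<lambda>e. F e i))
    \<Longrightarrow> definable_term (\<lambda>e. override_on (F e) (G e) S i)"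
  by (cases "i \<in> S") auto

lemma definable_term_if:
  "(c \<Longrightarrow> definable_term T) \<Longrightarrow> (\<not> c \<Longrightarrow> definable_term S)
    \<Longrightarrow> definable_term (\<lambda>e. if c then T e else S e)"
  by (cases c) auto

lemma definable_pred_ex:
  assumes "definable_pred (\<lambda>e. P (e 0) (\<lambda>i. e (Suc i)))"
  shows "definable_pred (\<lambda>e. \<exists>a. P a e)"
  using definable_pred_rename[OF definable_pred_ex_upd[OF assms, of 0], of "\<lambda>i. i - 1"] by simp

lemma definable_pred_all:
  assumes "definable_pred (\<lambda>e. P (e 0) (\<lambda>i. e (Suc i)))"
  shows "definable_pred (\<lambda>e. \<forall>a. P a e)"
  using definable_pred_not[OF definable_pred_ex[of "\<lambda>a e. \<not> P a e", OF definable_pred_not[OF assms]]]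
  by simp

text \<open>
  A quantified point takes the even variables and the outer assignment the odd ones. Only finitely
  many of the even ones matter, which makes this a first-order quantifier.
\<close>

lemma definable_pred_ex_point:
  assumes "definable_pred (\<lambda>e. P (\<lambda>i. e (2 * i)) (\<lambda>i. e (2 * i + 1)))"
  shows "definable_pred (\<lambda>e. \<exists>x. P x e)"
proof -
  let ?Q = "\<lambda>e. P (\<lambda>i. e (2 * i)) (\<lambda>i. e (2 * i + 1))"
  obtain N where N: "\<And>e e'. (\<And>i. i < N \<Longrightarrow> e i = e' i) \<Longrightarrow> ?Q e \<longleftrightarrow> ?Q e'"
    using definable_pred_finite_support[OF assms] by blast
  let ?E = "{i. i < N \<and> even i}"
  have "definable_pred (\<lambda>e. \<exists>z. ?Q (override_on e z ?E))"
    by (rule definable_pred_ex_override[OF assms]) simp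
  from definable_pred_rename[OF this, of "\<lambda>j. j div 2"]
  have "definable_pred (\<lambda>e. \<exists>z. ?Q (override_on (\<lambda>j. e (j div 2)) z ?E))" .
  moreover have "(\<exists>z. ?Q (override_on (\<lambda>j. e (j div 2)) z ?E)) \<longleftrightarrow> (\<exists>x. P x e)" for e
  proof
    assume "\<exists>z. ?Q (override_on (\<lambda>j. e (j div 2)) z ?E)"
    then obtain z where "?Q (override_on (\<lambda>j. e (j div 2)) z ?E)" by blast
    moreover have "(\<lambda>i. override_on (\<lambda>j. e (j div 2)) z ?E (2 * i + 1)) = e"
      by (auto simp: override_on_def)
    ultimately show "\<exists>x. P x e" by auto
  next
    assume "\<exists>x. P x e"
    then obtain x where x: "P x e" by blast
    let ?z = "\<lambda>j. if even j then x (j div 2) else e (j div 2)"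
    have "?Q ?z" using x by simp
    moreover have "?Q ?z \<longleftrightarrow> ?Q (override_on (\<lambda>j. e (j div 2)) ?z ?E)"
      by (rule N) (auto simp: override_on_def)
    ultimately show "\<exists>z. ?Q (override_on (\<lambda>j. e (j div 2)) z ?E)" by blast
  qed
  ultimately show ?thesis by simp
qed

lemma definable_pred_all_point:
  assumes "definable_pred (\<lambda>e. P (\<lambda>i. e (2 * i)) (\<lambda>i. e (2 * i + 1)))"
  shows "definable_pred (\<lambda>e. \<forall>x. P x e)"
  using definable_pred_not[OF definable_pred_ex_point[of "\<lambda>a e. \<not> P a e", OF definable_pred_not[OF assms]]]
  by simp

lemmas definable_intros = definable_pred_ex definable_pred_all definable_pred_conj
  definable_pred_disj definable_pred_imp definable_pred_not
  definable_pred_less definable_pred_le definable_pred_eq definable_term_var definable_term_add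
  definable_term_diff definable_term_uminus definable_term_divide definable_term_upd definable_term_override
  definable_term_if definable_term_const definable_pred_const

lemma definable_of_definable_pred:
  assumes "definable_pred P"
  shows "definable K n {x \<in> pow_space n. P x}"
proof -
  obtain \<phi> p N where \<phi>: "wf_fml K \<phi>" "\<And>e. P e \<longleftrightarrow> sat K (override_on p e {..<N}) \<phi>"
    using assms unfolding definable_pred_def by blast
  define r where "r = (\<lambda>i. if i < N then i else i + n)"
  define q where "q = (\<lambda>j. if j < N then undefined else p (j - n))"
  have "inj r" by (auto simp: inj_def r_def split: if_splits)
  moreover have "override_on q x {..<n} \<circ> r = override_on p x {..<N}" if "x \<in> pow_space n" for x
    using that by (auto simp: fun_eq_iff override_on_def r_def q_def PiE_def extensional_def)
  ultimately have "P x \<longleftrightarrow> sat K (override_on q x {..<n}) (rename_fml r \<phi>)" if "x \<in> pow_space n" for x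
    using that by (simp add: \<phi>(2) sat_rename_fml)
  thus ?thesis
    unfolding definable_def using \<phi>(1) wf_rename_fml by blast
qed

lemma definable_pred_of_definable:
  assumes "definable K n X"
  shows "definable_pred (\<lambda>e. restrict e {..<n} \<in> X)"
proof -
  obtain \<phi> p where \<phi>: "wf_fml K \<phi>" "X = {x \<in> pow_space n. sat K (override_on p x {..<n}) \<phi>}"
    using assms unfolding definable_def by blast
  have "override_on p (restrict e {..<n}) {..<n} = override_on p e {..<n}" for e
    by (auto simp: override_on_def fun_eq_iff)
  hence "restrict e {..<n} \<in> X \<longleftrightarrow> sat K (override_on p e {..<n}) \<phi>" for e
    by (simp add: \<phi>(2))
  thus ?thesis unfolding definable_pred_def using \<phi>(1) by blast
qed

end

section \<open>One-dimensional topology\<close>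

lemma open_contains_interval:
  fixes x :: "'a::{linorder_topology, no_bot, no_top}"
  assumes "open S" "x \<in> S"
  obtains a b where "a < x" "x < b" "{a<..<b} \<subseteq> S"
proof -
  obtain u v where "u < x" "x < v" using lt_ex gt_ex by blast
  obtain b where b: "b > x" "{x..<b} \<subseteq> S" using open_right[OF assms \<open>x < v\<close>] by blast
  obtain a where a: "a < x" "{a<..x} \<subseteq> S" using open_left[OF assms \<open>u < x\<close>] by blast
  have "{a<..<b} \<subseteq> {a<..x} \<union> {x..<b}" by auto
  thus thesis using that a b by blast
qed

lemma closure_meets_open: "x \<in> closure S \<Longrightarrow> open U \<Longrightarrow> x \<in> U \<Longrightarrow> \<exists>y\<in>S. y \<in> U"
  using open_Int_closure_eq_empty by blast

lemma mem_closure_Collect_iff: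
  fixes x :: "'a::{linorder_topology, no_bot, no_top}"
  shows "x \<in> closure {y. X y} \<longleftrightarrow> (\<forall>a b. a < x \<and> x < b \<longrightarrow> (\<exists>y. a < y \<and> y < b \<and> X y))"
proof (intro iffI allI impI)
  fix a b assume "x \<in> closure {y. X y}" "a < x \<and> x < b"
  thus "\<exists>y. a < y \<and> y < b \<and> X y"
    using closure_meets_open[of x "{y. X y}" "{a<..<b}"] by auto
next
  assume meets: "\<forall>a b. a < x \<and> x < b \<longrightarrow> (\<exists>y. a < y \<and> y < b \<and> X y)"
  show "x \<in> closure {y. X y}"
  proof (rule ccontr)
    assume "x \<notin> closure {y. X y}"
    hence "open (- closure {y. X y})" "x \<in> - closure {y. X y}" by auto
    then obtain a b where ab: "a < x" "x < b" "{a<..<b} \<subseteq> - closure {y. X y}"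
      by (rule open_contains_interval)
    then obtain y where "a < y" "y < b" "X y" using meets by blast
    thus False using ab(3) closure_subset[of "{y. X y}"] by auto
  qed
qed

definition dense_between :: "('a::linorder_topology \<Rightarrow> bool) \<Rightarrow> 'a \<Rightarrow> 'a \<Rightarrow> bool" where
  "dense_between X c d \<longleftrightarrow> {c<..<d} \<subseteq> closure {x. X x}"

lemma dense_between_iff:
  fixes c d :: "'a::{linorder_topology, unbounded_dense_linorder}"
  shows "dense_between X c d \<longleftrightarrow> (\<forall>a b. c \<le> a \<and> a < b \<and> b \<le> d \<longrightarrow> (\<exists>x. a < x \<and> x < b \<and> X x))"
    (is "_ \<longleftrightarrow> ?meets")
proof
  assume dn: "dense_between X c d"
  show ?meets
  proof (intro allI impI)
    fix a b assume ab: "c \<le> a \<and> a < b \<and> b \<le> d"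
    then obtain x where x: "a < x" "x < b" using dense by blast
    hence "x \<in> {c<..<d}" using ab by auto
    hence "x \<in> closure {x. X x}" using dn unfolding dense_between_def by blast
    thus "\<exists>x. a < x \<and> x < b \<and> X x" using x by (simp add: mem_closure_Collect_iff)
  qed
next
  assume meets: ?meets
  show "dense_between X c d"
    unfolding dense_between_def
  proof
    fix x assume x: "x \<in> {c<..<d}"
    show "x \<in> closure {x. X x}"
      unfolding mem_closure_Collect_iff
    proof (intro allI impI)
      fix a b assume "a < x \<and> x < b"
      hence "max c a < x" "x < min d b" using x by auto
      hence "max c a < min d b" by (rule less_trans)
      then obtain y where "max c a < y" "y < min d b" "X y"
        using meets[rule_format, of "max c a" "min d b"] by auto
      thus "\<exists>y. a < y \<and> y < b \<and> X y" by auto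
    qed
  qed
qed

lemma dense_betweenD:
  fixes c d :: "'a::{linorder_topology, unbounded_dense_linorder}"
  assumes "dense_between X c d" "c \<le> a" "a < b" "b \<le> d"
  obtains x where "a < x" "x < b" "X x"
  using assms unfolding dense_between_iff by blast

lemma not_dense_betweenE:
  fixes c d :: "'a::{linorder_topology, unbounded_dense_linorder}"
  assumes "\<not> dense_between X c d"
  obtains a b where "c \<le> a" "a < b" "b \<le> d" "\<And>x. a < x \<Longrightarrow> x < b \<Longrightarrow> \<not> X x"
  using assms unfolding dense_between_iff by blast

lemma dense_between_mono:
  fixes c d :: "'a::{linorder_topology, unbounded_dense_linorder}"
  assumes "dense_between X c d" "c \<le> c'" "d' \<le> d" and "\<And>x. c' < x \<Longrightarrow> x < d' \<Longrightarrow> X x \<Longrightarrow> Y x"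
  shows "dense_between Y c' d'"
  unfolding dense_between_iff
proof (intro allI impI)
  fix a b assume ab: "c' \<le> a \<and> a < b \<and> b \<le> d'"
  hence "c \<le> a" "a < b" "b \<le> d" using assms(2,3) by auto
  then obtain x where "a < x" "x < b" "X x" by (rule dense_betweenD[OF assms(1)])
  thus "\<exists>x. a < x \<and> x < b \<and> Y x" using ab assms(4)[of x] by auto
qed

lemma dense_between_all:
  "(\<And>x. c < x \<Longrightarrow> x < d \<Longrightarrow> X x) \<Longrightarrow> dense_between X c d"
  using closure_subset[of "{x. X x}"] by (auto simp: dense_between_def)

lemma closed_dense_between:
  "closed {x. X x} \<Longrightarrow> dense_between X c d \<Longrightarrow> c < x \<Longrightarrow> x < d \<Longrightarrow> X x"
  by (auto simp: dense_between_def)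

lemma dense_between_not_nowhere_dense:
  fixes c d :: "'a::{linorder_topology, dense_linorder}"
  assumes "dense_between (\<lambda>y. y \<in> S) c d" "c < d"
  shows "\<not> nowhere_dense S"
proof -
  have "{c<..<d} \<subseteq> interior (closure S)"
    using assms(1) by (intro interior_maximal) (auto simp: dense_between_def)
  moreover obtain x where "c < x" "x < d" using dense[OF assms(2)] by blast
  ultimately show ?thesis unfolding nowhere_dense_def by auto
qed

definition is_sup :: "('a::linorder \<Rightarrow> bool) \<Rightarrow> 'a \<Rightarrow> bool" where
  "is_sup X s \<longleftrightarrow> (\<forall>x. X x \<longrightarrow> x \<le> s) \<and> (\<forall>b<s. \<exists>x>b. X x)"

lemma is_supD: "is_sup X s \<Longrightarrow> X x \<Longrightarrow> x \<le> s" "is_sup X s \<Longrightarrow> b < s \<Longrightarrow> \<exists>x>b. X x"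
  unfolding is_sup_def by blast+

definition is_inf :: "('a::linorder \<Rightarrow> bool) \<Rightarrow> 'a \<Rightarrow> bool" where
  "is_inf X s \<longleftrightarrow> (\<forall>x. X x \<longrightarrow> s \<le> x) \<and> (\<forall>b>s. \<exists>x<b. X x)"

lemma is_infD: "is_inf X s \<Longrightarrow> X x \<Longrightarrow> s \<le> x" "is_inf X s \<Longrightarrow> s < b \<Longrightarrow> \<exists>x<b. X x"
  unfolding is_inf_def by blast+

lemma is_sup_unique: "is_sup X s \<Longrightarrow> is_sup X s' \<Longrightarrow> s = s'"
  unfolding is_sup_def by (meson linorder_neqE not_le)

definition is_least :: "('a::order \<Rightarrow> bool) \<Rightarrow> 'a \<Rightarrow> bool" where
  "is_least X m \<longleftrightarrow> X m \<and> (\<forall>x. X x \<longrightarrow> m \<le> x)"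

lemma mono_predD: "mono X \<Longrightarrow> X s y \<Longrightarrow> s \<le> t \<Longrightarrow> X t y"
  by (blast dest: monoD)

lemma sup_of_least_mem_closure:
  fixes X :: "'t::linorder \<Rightarrow> 'a::{linorder_topology, no_bot, no_top} \<Rightarrow> bool"
  assumes mono: "mono X" and s: "is_sup (\<lambda>m. \<exists>t. is_least (\<lambda>y. a \<le> y \<and> y \<le> b \<and> X t y) m) s"
    and m: "is_least (\<lambda>y. a \<le> y \<and> y \<le> b \<and> X t y) m"
  shows "s \<in> closure {y. X t y}"
  unfolding mem_closure_Collect_iff
proof (intro allI impI)
  fix u v assume uv: "u < s \<and> s < v"
  then obtain m' t' where m': "is_least (\<lambda>y. a \<le> y \<and> y \<le> b \<and> X t' y) m'" "u < m'"
    using is_supD(2)[OF s] by blast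
  have m_le_s: "m \<le> s" "m' \<le> s" using is_supD(1)[OF s] m m'(1) by blast+
  have mem: "a \<le> m" "m \<le> b" "X t m" "X t' m'" using m m'(1) unfolding is_least_def by blast+
  show "\<exists>y. u < y \<and> y < v \<and> X t y"
  proof (cases "t' \<le> t")
    case True
    hence "X t m'" using mono_predD[OF mono mem(4)] by blast
    thus ?thesis using m_le_s(2) m'(2) uv by (meson le_less_trans)
  next
    case False
    hence "X t' m" using mono_predD[OF mono mem(3)] by simp
    hence "m' \<le> m" using m'(1) mem(1,2) unfolding is_least_def by blast
    thus ?thesis using m_le_s(1) m'(2) uv mem(3) by (meson le_less_trans less_le_trans)
  qed
qed

locale definably_complete_expansion = definable_predicates K
  for K :: "('f, 'r, 'a::{linordered_field, linorder_topology}) expansion" +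
  assumes definably_complete: "definably_complete K"
begin

lemma definable_has_sup:
  assumes X: "definable_unary X" and "X x0" and ub: "\<And>x. X x \<Longrightarrow> x \<le> b"
  obtains s where "is_sup X s"
proof -
  have "singleton_point ` Collect X = {x \<in> pow_space 1. X (x 0)}"
  proof (intro equalityI subsetI)
    fix x assume x: "x \<in> {x \<in> pow_space 1. X (x 0)}"
    hence "x = singleton_point (x 0)"
      unfolding singleton_point_def by (intro extensionalityI[of _ "{..<1}"]) (auto simp: PiE_def)
    thus "x \<in> singleton_point ` Collect X" using x by auto
  qed (auto simp: singleton_point_def split: if_splits)
  hence "definable K 1 (singleton_point ` Collect X)"
    using definable_of_definable_pred[OF X, of 1] by simp
  then obtain s where s: "isLub UNIV (Fin ` Collect X) s"
    using definably_complete unfolding definably_complete_def by blast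
  have ge: "Fin x \<le> s" if "X x" for x
    using isLubD2[OF s] that by blast
  have least: "s \<le> Fin c" if "\<And>x. X x \<Longrightarrow> x \<le> c" for c
    using isLub_le_isUb[OF s] that by (auto simp: isUb_def setle_def)
  obtain r where r: "s = Fin r"
    using ge[OF \<open>X x0\<close>] least[of b] ub by (cases s) auto
  have "is_sup X r"
    unfolding is_sup_def using ge least r by (auto simp: not_le[symmetric])
  thus thesis by (rule that)
qed

text \<open>The infimum is the supremum of the lower bounds.\<close>

lemma definable_has_inf:
  assumes X: "definable_unary X" and "X x0" and lb: "\<And>x. X x \<Longrightarrow> b \<le> x"
  obtains s where "is_inf X s"
proof -
  have "definable_unary (\<lambda>c. \<forall>x. X x \<longrightarrow> c \<le> x)"
    by (intro definable_pred_subst1[OF X] definable_intros)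
  moreover have "\<forall>x. X x \<longrightarrow> b \<le> x" using lb by blast
  moreover have "c \<le> x0" if "\<forall>x. X x \<longrightarrow> c \<le> x" for c using that \<open>X x0\<close> by blast
  ultimately obtain s where s: "is_sup (\<lambda>c. \<forall>x. X x \<longrightarrow> c \<le> x) s"
    by (rule definable_has_sup)
  have "s \<le> x" if "X x" for x using is_supD(2)[OF s] that by (meson not_le)
  moreover have "\<exists>x<b. X x" if "s < b" for b using is_supD(1)[OF s] that by (meson not_le)
  ultimately show thesis using that[of s] unfolding is_inf_def by blast
qed

lemma closed_has_greatest:
  assumes X: "definable_unary X" and "X x0" and ub: "\<And>x. X x \<Longrightarrow> x \<le> b"
    and closed: "closed {x. X x}"
  obtains s where "X s" "\<forall>x. X x \<longrightarrow> x \<le> s"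
proof -
  obtain s where s: "is_sup X s" by (rule definable_has_sup[OF X \<open>X x0\<close> ub])
  have "s \<in> closure {x. X x}"
    unfolding mem_closure_Collect_iff using is_supD[OF s] by (meson le_less_trans)
  thus thesis using that[of s] is_supD(1)[OF s] closed by auto
qed

lemma closed_has_least:
  assumes X: "definable_unary X" and "X x0" and lb: "\<And>x. X x \<Longrightarrow> b \<le> x"
    and closed: "closed {x. X x}"
  obtains m where "is_least X m"
proof -
  obtain s where s: "is_inf X s" by (rule definable_has_inf[OF X \<open>X x0\<close> lb])
  have "s \<in> closure {x. X x}"
    unfolding mem_closure_Collect_iff using is_infD[OF s] by (meson less_le_trans)
  thus thesis using that[of s] is_infD(1)[OF s] closed by (simp add: is_least_def)
qed

lemma definably_compact_Icc:
  assumes X: "definable_binary X" and mono: "mono X" and closed: "\<And>t. closed {y. X t y}"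
    and "a \<le> b"
  obtains y where "a \<le> y" "y \<le> b" "\<forall>t y'. a \<le> y' \<and> y' \<le> b \<and> X t y' \<longrightarrow> X t y"
proof (cases "\<exists>t y. a \<le> y \<and> y \<le> b \<and> X t y")
  case False
  thus thesis using that[of a] \<open>a \<le> b\<close> by blast
next
  case True
  define M where "M = (\<lambda>t. is_least (\<lambda>y. a \<le> y \<and> y \<le> b \<and> X t y))"
  have ex_M: "\<exists>m. M t m" if "a \<le> y" "y \<le> b" "X t y" for t y
  proof -
    have "definable_unary (\<lambda>y. a \<le> y \<and> y \<le> b \<and> X t y)"
      by (intro definable_pred_subst2[OF X] definable_intros)
    moreover have "closed {y. a \<le> y \<and> y \<le> b \<and> X t y}"
      by (intro closed_Collect_conj closed closed_Collect_le continuous_intros)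
    ultimately show ?thesis
      unfolding M_def using closed_has_least[of "\<lambda>y. a \<le> y \<and> y \<le> b \<and> X t y" y a] that by blast
  qed
  have M_bounds: "a \<le> m" "m \<le> b" if "M t m" for t m using that by (auto simp: M_def is_least_def)
  have "definable_unary (\<lambda>m. \<exists>t. M t m)"
    unfolding M_def is_least_def by (intro definable_pred_subst2[OF X] definable_intros)
  moreover obtain t0 m0 where "M t0 m0" using True ex_M by blast
  moreover have "m \<le> b" if "\<exists>t. M t m" for m using that M_bounds by blast
  ultimately obtain s where s: "is_sup (\<lambda>m. \<exists>t. M t m) s"
    using definable_has_sup[of "\<lambda>m. \<exists>t. M t m" m0 b] by blast
  show thesis
  proof (rule that[of s])
    show "a \<le> s" using is_supD(1)[OF s] M_bounds(1) \<open>M t0 m0\<close> by (meson order_trans)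
    show "s \<le> b" using is_supD(2)[OF s] M_bounds(2) by (meson not_le)
    show "\<forall>t y'. a \<le> y' \<and> y' \<le> b \<and> X t y' \<longrightarrow> X t s"
    proof (intro allI impI)
      fix t y' assume "a \<le> y' \<and> y' \<le> b \<and> X t y'"
      then obtain m where "M t m" using ex_M by blast
      from sup_of_least_mem_closure[OF mono s[unfolded M_def] this[unfolded M_def]]
      show "X t s" using closed[of t] by simp
    qed
  qed
qed

lemma definably_connected_Icc:
  assumes A: "definable_unary A" "closed {y. A y}" and B: "definable_unary B" "closed {y. B y}"
    and cover: "\<And>y. a \<le> y \<Longrightarrow> y \<le> b \<Longrightarrow> A y \<or> B y" and "a \<le> b" "A a" "B b"
  obtains y where "a \<le> y" "y \<le> b" "A y" "B y"
proof -
  have "definable_unary (\<lambda>y. a \<le> y \<and> B y)" by (intro definable_pred_subst1[OF B(1)] definable_intros)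
  moreover have "a \<le> b \<and> B b" using assms by blast
  moreover have "a \<le> y" if "a \<le> y \<and> B y" for y using that by blast
  moreover have "closed {y. a \<le> y \<and> B y}"
    by (intro closed_Collect_conj closed_Collect_le continuous_intros B(2))
  ultimately obtain s where s: "is_least (\<lambda>y. a \<le> y \<and> B y) s"
    by (rule closed_has_least)
  hence sB: "a \<le> s" "B s" "s \<le> b" using \<open>a \<le> b\<close> \<open>B b\<close> by (auto simp: is_least_def)
  have A_below: "A y" if "a \<le> y" "y < s" for y
  proof -
    have "\<not> B y" using s that unfolding is_least_def by (meson not_le)
    thus ?thesis using cover[of y] that sB(3) by simp
  qed
  have "A s"
  proof (cases "a = s")
    case False
    hence "s \<in> closure {a<..<s}" using sB(1) by simp
    also have "\<dots> \<subseteq> closure {y. A y}" using A_below by (intro closure_mono) auto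
    finally show ?thesis using A(2) by simp
  qed (use \<open>A a\<close> in simp)
  thus thesis using that sB by blast
qed

end

lemma mono_closure:
  assumes "mono X"
  shows "mono (\<lambda>t y. y \<in> closure {y. X t y})"
proof (intro monoI predicate1I)
  fix s t y assume "s \<le> t" and y: "y \<in> closure {y. X s y}"
  hence "{y. X s y} \<subseteq> {y. X t y}" using mono_predD[OF assms] by blast
  thus "y \<in> closure {y. X t y}" using y closure_mono by blast
qed

lemma closed_Collect_compose:
  assumes "closed {y. P y}" "continuous_on UNIV f"
  shows "closed {x. P (f x)}"
  using closed_vimage[OF assms] by (simp add: vimage_def)

lemma continuous_on_fun_upd:
  assumes "continuous_on S f" "continuous_on S g"
  shows "continuous_on S (\<lambda>x. (f x)(i := g x))"
proof (rule continuous_on_coordinatewise_then_product)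
  show "continuous_on S (\<lambda>x. ((f x)(i := g x)) j)" for j
    using assms continuous_on_product_then_coordinatewise[OF assms(1)] by (cases "j = i") auto
qed

lemma open_contains_cube:
  fixes e :: "'i \<Rightarrow> 'a::{linordered_field, linorder_topology}"
  assumes "open U" "e \<in> U" "finite F"
  obtains \<delta> where "\<delta> > 0"
    "\<forall>e'. (\<forall>j\<in>F. e j - \<delta> < e' j \<and> e' j < e j + \<delta>) \<and> (\<forall>j. j \<notin> F \<longrightarrow> e' j = e j) \<longrightarrow> e' \<in> U"
proof -
  obtain V where V: "\<And>j. e j \<in> V j" "\<And>j. open (V j)" "Pi\<^sub>E UNIV V \<subseteq> U"
    using product_topology_open_contains_basis[of "\<lambda>_. euclidean" UNIV U e] assms(1,2)
    by (auto simp: open_fun_def PiE_iff)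
  have "\<exists>\<delta>>0. \<forall>x. e j - \<delta> < x \<and> x < e j + \<delta> \<longrightarrow> x \<in> V j" for j
  proof -
    obtain a b where ab: "a < e j" "e j < b" "{a<..<b} \<subseteq> V j"
      using open_contains_interval[OF V(2,1)] by blast
    define \<delta> where "\<delta> = min (e j - a) (b - e j)"
    have \<delta>: "\<delta> > 0" "\<delta> \<le> e j - a" "\<delta> \<le> b - e j" using ab by (auto simp: \<delta>_def)
    have "x \<in> V j" if "e j - \<delta> < x \<and> x < e j + \<delta>" for x
    proof -
      have "a < x" "x < b" using that \<delta>(2,3) by linarith+
      thus ?thesis using ab(3) by auto
    qed
    thus ?thesis using \<delta>(1) by blast
  qed
  then obtain r where r: "\<And>j. r j > 0" "\<And>j x. e j - r j < x \<Longrightarrow> x < e j + r j \<Longrightarrow> x \<in> V j"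
    by metis
  define \<delta> where "\<delta> = Min (insert 1 (r ` F))"
  have "\<delta> > 0" unfolding \<delta>_def using assms(3) r(1) by (subst Min_gr_iff) auto
  moreover have "e' \<in> U"
    if e': "\<forall>j\<in>F. e j - \<delta> < e' j \<and> e' j < e j + \<delta>" "\<forall>j. j \<notin> F \<longrightarrow> e' j = e j" for e'
  proof -
    have "e' j \<in> V j" for j
    proof (cases "j \<in> F")
      case True
      hence "\<delta> \<le> r j" unfolding \<delta>_def using assms(3) by (intro Min_le) auto
      moreover have "e j - \<delta> < e' j" "e' j < e j + \<delta>" using e'(1) True by auto
      ultimately show ?thesis by (intro r(2)) linarith+
    qed (use e'(2) V(1) in simp)
    thus ?thesis using V(3) by auto
  qed
  ultimately show thesis using that by blast
qed

lemma closed_mem_of_near: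
  fixes e :: "nat \<Rightarrow> 'a::{linordered_field, linorder_topology}"
  assumes "closed {e. P e}"
    and support: "\<And>e e'. (\<And>j. j < N \<Longrightarrow> e j = e' j) \<Longrightarrow> P e \<longleftrightarrow> P e'"
    and near: "\<And>\<delta>. \<delta> > 0 \<Longrightarrow> \<exists>e'. P e' \<and> (\<forall>j<N. e j - \<delta> < e' j \<and> e' j < e j + \<delta>)"
  shows "P e"
proof (rule ccontr)
  assume "\<not> P e"
  hence "open {e. \<not> P e}" "e \<in> {e. \<not> P e}" using assms(1) by (auto intro: open_Collect_neg)
  then obtain \<delta> where \<delta>: "\<delta> > 0"
    "\<forall>e'. (\<forall>j\<in>{..<N}. e j - \<delta> < e' j \<and> e' j < e j + \<delta>) \<and> (\<forall>j. j \<notin> {..<N} \<longrightarrow> e' j = e j) \<longrightarrow>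
      e' \<in> {e. \<not> P e}"
    by (rule open_contains_cube[OF _ _ finite_lessThan])
  obtain e' where e': "P e'" "\<forall>j<N. e j - \<delta> < e' j \<and> e' j < e j + \<delta>" using near[OF \<delta>(1)] by blast
  have "\<not> P (override_on e e' {..<N})" using \<delta>(2) e'(2) by simp
  moreover have "P (override_on e e' {..<N}) \<longleftrightarrow> P e'" by (rule support) simp
  ultimately show False using e'(1) by blast
qed

lemma near_of_mem_closure:
  fixes e :: "nat \<Rightarrow> 'a::{linordered_field, linorder_topology}"
  assumes "e \<in> closure {e. P e}" "\<delta> > 0"
  shows "\<exists>e'. P e' \<and> (\<forall>j<N. e j - \<delta> < e' j \<and> e' j < e j + \<delta>)"
proof -
  let ?U = "{e'. \<forall>j\<in>{..<N}. e' j \<in> {e j - \<delta><..<e j + \<delta>}}"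
  have "open ?U"
    using product_topology_basis'[of "{..<N}" "\<lambda>j. {e j - \<delta><..<e j + \<delta>}" "\<lambda>j. j"] by simp
  moreover have "e \<in> ?U" using assms(2) by simp
  ultimately have "\<exists>e'\<in>{e. P e}. e' \<in> ?U" by (rule closure_meets_open[OF assms(1)])
  thus ?thesis by auto
qed

context definably_complete_expansion
begin

lemma closed_ex_between:
  assumes P: "definable_pred P" "closed {e. P e}"
  shows "closed {e. \<exists>a. \<alpha> \<le> a \<and> a \<le> \<beta> \<and> P (e(i := a))}" (is "closed ?S")
proof -
  have "e \<in> ?S" if e: "e \<in> closure ?S" for e
  proof -
    obtain N where N: "\<And>e e'. (\<And>j. j < N \<Longrightarrow> e j = e' j) \<Longrightarrow> P e \<longleftrightarrow> P e'"
      using definable_pred_finite_support[OF P(1)] by blast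
    define near where "near = (\<lambda>\<delta> a. \<exists>e'. (\<forall>j\<in>{..<N}. e j - \<delta> < e' j \<and> e' j < e j + \<delta>) \<and> P (e'(i := a)))"
    have ex_near: "\<exists>a. \<alpha> \<le> a \<and> a \<le> \<beta> \<and> near \<delta> a" if "\<delta> > 0" for \<delta>
      using near_of_mem_closure[OF e that, of N] unfolding near_def by auto
    have "mono near"
    proof (intro monoI predicate1I)
      fix \<delta> \<delta>' a assume "\<delta> \<le> \<delta>'" and near: "near \<delta> a"
      hence "e j - \<delta>' < x \<and> x < e j + \<delta>'" if "e j - \<delta> < x \<and> x < e j + \<delta>" for x j
        using that by linarith
      thus "near \<delta>' a" using near unfolding near_def by blast
    qed
    define X where "X = (\<lambda>\<delta> a. a \<in> closure {a. near \<delta> a})"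
    have "definable_binary X"
      unfolding X_def mem_closure_Collect_iff near_def
      by (intro definable_pred_subst[OF P(1)] definable_pred_ex_point definable_pred_ball_finite
          finite_lessThan definable_intros)
    moreover have "mono X" unfolding X_def by (rule mono_closure[OF \<open>mono near\<close>])
    moreover have "closed {a. X \<delta> a}" for \<delta> unfolding X_def by simp
    moreover have "\<alpha> \<le> \<beta>" using ex_near[of 1] by auto
    ultimately obtain y where y: "\<alpha> \<le> y" "y \<le> \<beta>"
      "\<forall>\<delta> a. \<alpha> \<le> a \<and> a \<le> \<beta> \<and> X \<delta> a \<longrightarrow> X \<delta> y"
      by (rule definably_compact_Icc)
    have "P (e(i := y))"
    proof (rule closed_mem_of_near[OF P(2) N])
      fix \<delta> :: 'a assume \<delta>: "\<delta> > 0"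
      hence "y - \<delta> < y" "y < y + \<delta>" by auto
      moreover have "X \<delta> y"
        using ex_near[OF \<delta>] y(3) closure_subset[of "{a. near \<delta> a}"] unfolding X_def by blast
      ultimately obtain a where "y - \<delta> < a" "a < y + \<delta>" "near \<delta> a"
        unfolding X_def mem_closure_Collect_iff by blast
      thus "\<exists>e'. P e' \<and> (\<forall>j<N. (e(i := y)) j - \<delta> < e' j \<and> e' j < (e(i := y)) j + \<delta>)"
        unfolding near_def by auto
    qed
    thus ?thesis using y(1,2) by auto
  qed
  thus ?thesis using closure_subset_eq by blast
qed

end

section \<open>A Baire category theorem\<close>

lemma discrete_subtopology_pow_top:
  fixes D :: "(nat \<Rightarrow> 'a::{linordered_field, linorder_topology}) set"
  assumes "D \<subseteq> pow_space k"
    and separated: "\<And>x. x \<in> D \<Longrightarrow> \<exists>\<epsilon>>0. \<forall>y\<in>D. (\<forall>i<k. \<bar>y i - x i\<bar> < \<epsilon>) \<longrightarrow> y = x"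
  shows "subtopology (pow_top k) D = discrete_topology D"
proof -
  have "openin (subtopology (pow_top k) D) {x}" if x: "x \<in> D" for x
  proof -
    obtain \<epsilon> where \<epsilon>: "\<epsilon> > 0" "\<And>y. y \<in> D \<Longrightarrow> \<forall>i<k. \<bar>y i - x i\<bar> < \<epsilon> \<Longrightarrow> y = x"
      using separated[OF x] by blast
    let ?W = "\<Pi>\<^sub>E i\<in>{..<k}. {x i - \<epsilon><..<x i + \<epsilon>}"
    have "y = x" if "y \<in> D" "y \<in> ?W" for y
      using that by (intro \<epsilon>(2)) (auto simp: PiE_iff abs_diff_less_iff)
    moreover have "x \<in> ?W" using x assms(1) \<epsilon>(1) by (auto simp: PiE_iff)
    ultimately have "{x} = ?W \<inter> D" using x by auto
    moreover have "openin (pow_top k) ?W" unfolding openin_PiE_gen by auto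
    ultimately show ?thesis unfolding openin_subtopology by blast
  qed
  moreover have "D \<subseteq> topspace (pow_top k)" using assms(1) by simp
  ultimately show ?thesis by (metis discrete_topology_unique topspace_subtopology_subset)
qed

locale restrained_expansion = definable_predicates K
  for K :: "('f, 'r, 'a::{linordered_field, linorder_topology}) expansion" +
  assumes restrained: "restrained K"
begin

sublocale definably_complete_expansion K
  by unfold_locales (use restrained in \<open>simp add: restrained_def\<close>)

lemma definable_map_coordinate:
  assumes D: "definable K k D" and "i < k"
  shows "definable_map K k 1 D (\<lambda>x. singleton_point (x i))"
proof -
  have sub: "D \<subseteq> pow_space k" using D unfolding definable_def by blast
  have "(\<lambda>x. concat_point k 1 x (singleton_point (x i))) ` D =
      {z \<in> pow_space (k + 1). restrict z {..<k} \<in> D \<and> z k = z i}" (is "?graph = ?R")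
  proof (intro equalityI subsetI)
    fix z assume "z \<in> ?graph"
    then obtain x where x: "x \<in> D" "z = concat_point k 1 x (singleton_point (x i))" by blast
    have "restrict z {..<k} = x"
      using x sub by (intro extensionalityI[of _ "{..<k}"]) (auto simp: PiE_def concat_point_def)
    thus "z \<in> ?R" using x \<open>i < k\<close> by (auto simp: concat_point_def singleton_point_def)
  next
    fix z assume z: "z \<in> ?R"
    hence "z = concat_point k 1 (restrict z {..<k}) (singleton_point (restrict z {..<k} i))"
      using \<open>i < k\<close> by (intro extensionalityI[of _ "{..<k + 1}"])
        (auto simp: PiE_def concat_point_def singleton_point_def less_Suc_eq)
    thus "z \<in> ?graph" using z by blast
  qed
  moreover have "definable_pred (\<lambda>z. restrict z {..<k} \<in> D \<and> z k = z i)"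
    by (intro definable_pred_of_definable[OF D] definable_intros)
  ultimately show ?thesis
    unfolding definable_map_def using sub definable_of_definable_pred[of _ "k + 1"]
    by (auto simp: singleton_point_def)
qed

lemma nowhere_dense_of_discrete_relation:
  assumes R: "definable_binary R"
    and separated: "\<And>y r. R y r \<Longrightarrow>
      \<exists>\<epsilon>>0. \<forall>y' r'. R y' r' \<and> \<bar>y' - y\<bar> < \<epsilon> \<and> \<bar>r' - r\<bar> < \<epsilon> \<longrightarrow> y' = y \<and> r' = r"
  shows "nowhere_dense {y. \<exists>r. R y r}"
proof -
  define D where "D = {x \<in> pow_space 2. R (x 0) (x 1)}"
  have D: "definable K 2 D" unfolding D_def by (rule definable_of_definable_pred[OF R])
  have "subtopology (pow_top 2) D = discrete_topology D"
  proof (rule discrete_subtopology_pow_top)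
    fix x assume x: "x \<in> D"
    then obtain \<epsilon> where \<epsilon>: "\<epsilon> > 0"
      "\<And>y' r'. R y' r' \<Longrightarrow> \<bar>y' - x 0\<bar> < \<epsilon> \<Longrightarrow> \<bar>r' - x 1\<bar> < \<epsilon> \<Longrightarrow> y' = x 0 \<and> r' = x 1"
      using separated[of "x 0" "x 1"] unfolding D_def by blast
    have "y = x" if "y \<in> D" "\<forall>i<2. \<bar>y i - x i\<bar> < \<epsilon>" for y
    proof (rule extensionalityI[of _ "{..<2}"])
      show "y i = x i" if "i \<in> {..<2}" for i
        using that \<epsilon>(2)[of "y 0" "y 1"] \<open>y \<in> D\<close> \<open>\<forall>i<2. \<bar>y i - x i\<bar> < \<epsilon>\<close>
        by (auto simp: D_def less_2_cases_iff)
    qed (use that x in \<open>auto simp: D_def PiE_def\<close>)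
    thus "\<exists>\<epsilon>>0. \<forall>y\<in>D. (\<forall>i<2. \<bar>y i - x i\<bar> < \<epsilon>) \<longrightarrow> y = x" using \<epsilon>(1) by blast
  qed (simp add: D_def)
  hence "nowhere_dense ((\<lambda>x. x 0) ` D)"
    using restrained D definable_map_coordinate[OF D, of 0] unfolding restrained_def by simp
  moreover have "{y. \<exists>r. R y r} = (\<lambda>x. x 0) ` D"
  proof (intro equalityI subsetI)
    fix y assume "y \<in> {y. \<exists>r. R y r}"
    then obtain r where "R y r" by blast
    hence "(\<lambda>i\<in>{..<2}. if i = 0 then y else r) \<in> D" by (simp add: D_def)
    thus "y \<in> (\<lambda>x. x 0) ` D" by (rule rev_image_eqI) simp
  qed (auto simp: D_def)
  ultimately show ?thesis by simp
qed

end

definition enters_before :: "('t \<Rightarrow> 'b \<Rightarrow> bool) \<Rightarrow> 'b \<Rightarrow> 'b \<Rightarrow> bool" where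
  "enters_before X y y' \<longleftrightarrow> (\<forall>t. X t y' \<longrightarrow> X t y)"

text \<open>
  The entry time of a point into an increasing closed family behaves like a lower semicontinuous
  function. Minima that are strict to the right are isolated from each other, and the upper bound on
  the radius serves only to make the supremum of the radii exist.
\<close>

definition entry_minimum :: "('t \<Rightarrow> 'a::linordered_field \<Rightarrow> bool) \<Rightarrow> 'a \<Rightarrow> 'a \<Rightarrow> bool" where
  "entry_minimum X y \<epsilon> \<longleftrightarrow> 0 < \<epsilon> \<and> \<epsilon> \<le> 1 \<and>
     (\<forall>y'. y - \<epsilon> < y' \<and> y' < y + \<epsilon> \<longrightarrow> enters_before X y y') \<and>
     (\<forall>y'. y < y' \<and> y' < y + \<epsilon> \<longrightarrow> \<not> enters_before X y' y)"

lemma entry_minimum_apart: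
  assumes "entry_minimum X y \<epsilon>" "entry_minimum X y' \<epsilon>'" "y < y'"
  shows "\<epsilon> \<le> y' - y \<or> \<epsilon>' \<le> y' - y"
proof (rule ccontr)
  assume "\<not> ?thesis"
  moreover have "0 < \<epsilon>'" using assms(2) by (simp add: entry_minimum_def)
  ultimately have "y' < y + \<epsilon>" "y' - \<epsilon>' < y" "y < y' + \<epsilon>'" using assms(3) by linarith+
  thus False using assms unfolding entry_minimum_def by blast
qed

lemma entry_minimum_radii_apart:
  fixes y r :: "'a::linordered_field"
  assumes r: "is_sup (entry_minimum X y) r" and r': "is_sup (entry_minimum X y') r'"
    and near: "\<bar>y' - y\<bar> < r / 2" "\<bar>r' - r\<bar> < r / 2"
  shows "y' = y"
proof (rule ccontr)
  assume "y' \<noteq> y"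
  have "\<bar>y' - y\<bar> < r" "\<bar>y' - y\<bar> < r'" using near by linarith+
  then obtain \<epsilon> \<epsilon>' where "entry_minimum X y \<epsilon>" "\<bar>y' - y\<bar> < \<epsilon>" "entry_minimum X y' \<epsilon>'" "\<bar>y' - y\<bar> < \<epsilon>'"
    using is_supD(2)[OF r] is_supD(2)[OF r'] by blast
  thus False
    using entry_minimum_apart[of X y \<epsilon> y' \<epsilon>'] entry_minimum_apart[of X y' \<epsilon>' y \<epsilon>] \<open>y' \<noteq> y\<close>
    by (cases "y < y'") auto
qed

lemma entry_minimumI:
  fixes y :: "'a::linordered_field"
  assumes "a < y" "y < b" and first: "\<And>y'. a \<le> y' \<Longrightarrow> y' \<le> b \<Longrightarrow> enters_before X y y'"
    and last: "\<And>y'. y' \<le> b \<Longrightarrow> enters_before X y' y \<Longrightarrow> y' \<le> y"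
  shows "entry_minimum X y (min 1 (min (y - a) (b - y)))" (is "entry_minimum X y ?\<epsilon>")
proof -
  have \<epsilon>: "?\<epsilon> \<le> y - a" "?\<epsilon> \<le> b - y" by auto
  show ?thesis
    unfolding entry_minimum_def
  proof (intro conjI allI impI)
    show "0 < ?\<epsilon>" "?\<epsilon> \<le> 1" using assms(1,2) by auto
    show "enters_before X y y'" if "y - ?\<epsilon> < y' \<and> y' < y + ?\<epsilon>" for y'
      using that \<epsilon> by (intro first) linarith+
    show "\<not> enters_before X y' y" if "y < y' \<and> y' < y + ?\<epsilon>" for y'
      using that \<epsilon> last[of y'] by force
  qed
qed

context restrained_expansion
begin

lemma nowhere_dense_entry_minima:
  assumes X: "definable_binary X"
  shows "nowhere_dense {y. \<exists>\<epsilon>. entry_minimum X y \<epsilon>}"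
proof -
  have minimum_definable: "definable_binary (entry_minimum X)"
    unfolding entry_minimum_def enters_before_def by (intro definable_pred_subst2[OF X] definable_intros)
  have "nowhere_dense {y. \<exists>r. is_sup (entry_minimum X y) r}"
  proof (rule nowhere_dense_of_discrete_relation)
    show "definable_binary (\<lambda>y. is_sup (entry_minimum X y))"
      unfolding is_sup_def by (intro definable_pred_subst2[OF minimum_definable] definable_intros)
    fix y r assume r: "is_sup (entry_minimum X y) r"
    obtain \<epsilon> where "entry_minimum X y \<epsilon>" using is_supD(2)[OF r, of "r - 1"] by auto
    hence "0 < r" using is_supD(1)[OF r] by (auto simp: entry_minimum_def intro: less_le_trans)
    moreover have "y' = y \<and> r' = r"
      if r': "is_sup (entry_minimum X y') r'" and near: "\<bar>y' - y\<bar> < r / 2" "\<bar>r' - r\<bar> < r / 2" for y' r'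
      using entry_minimum_radii_apart[OF r r' near] is_sup_unique r r' by blast
    ultimately show "\<exists>\<epsilon>>0. \<forall>y' r'. is_sup (entry_minimum X y') r' \<and> \<bar>y' - y\<bar> < \<epsilon> \<and> \<bar>r' - r\<bar> < \<epsilon> \<longrightarrow>
        y' = y \<and> r' = r"
      by (intro exI[of _ "r / 2"]) auto
  qed
  moreover have "\<exists>r. is_sup (entry_minimum X y) r" if "entry_minimum X y \<epsilon>" for y \<epsilon>
  proof -
    have "definable_unary (entry_minimum X y)"
      by (intro definable_pred_subst2[OF minimum_definable] definable_intros)
    moreover note that
    moreover have "\<epsilon> \<le> 1" if "entry_minimum X y \<epsilon>" for \<epsilon> using that by (simp add: entry_minimum_def)
    ultimately obtain r where "is_sup (entry_minimum X y) r" by (rule definable_has_sup)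
    thus ?thesis by blast
  qed
  hence "{y. \<exists>\<epsilon>. entry_minimum X y \<epsilon>} \<subseteq> {y. \<exists>r. is_sup (entry_minimum X y) r}" by blast
  ultimately show ?thesis
    unfolding nowhere_dense_def by (metis closure_mono interior_mono subset_empty)
qed

lemma ex_entry_minimum:
  assumes X: "definable_binary X" "mono X" "\<And>t. closed {y. X t y}"
    and y0: "a < y0" "y0 < b" "X t0 y0" and ends: "\<not> X t0 a" "\<not> X t0 b"
  shows "\<exists>y \<epsilon>. a < y \<and> y < b \<and> entry_minimum X y \<epsilon>"
proof -
  have "a \<le> b" using y0 by simp
  then obtain y1 where y1: "a \<le> y1" "y1 \<le> b"
    and "\<forall>t y. a \<le> y \<and> y \<le> b \<and> X t y \<longrightarrow> X t y1"
    by (rule definably_compact_Icc[OF X])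
  hence first: "enters_before X y1 y" if "a \<le> y" "y \<le> b" for y
    using that unfolding enters_before_def by blast
  have "X t0 y1" using first[of y0] y0 by (auto simp: enters_before_def)
  have "definable_unary (\<lambda>y. y \<le> b \<and> enters_before X y y1)"
    unfolding enters_before_def by (intro definable_pred_subst2[OF X(1)] definable_intros)
  moreover have "y1 \<le> b \<and> enters_before X y1 y1" using y1 by (simp add: enters_before_def)
  moreover have "y \<le> b" if "y \<le> b \<and> enters_before X y y1" for y using that by blast
  moreover have "closed {y. y \<le> b \<and> enters_before X y y1}"
    unfolding enters_before_def
    by (intro closed_Collect_conj closed_Collect_le closed_Collect_all closed_Collect_imp X(3)
        open_Collect_const continuous_intros)
  ultimately obtain y where "y \<le> b \<and> enters_before X y y1"
    and last: "\<forall>y'. y' \<le> b \<and> enters_before X y' y1 \<longrightarrow> y' \<le> y"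
    by (rule closed_has_greatest)
  hence y: "y \<le> b" "enters_before X y y1" by blast+
  have "X t0 y" using y(2) \<open>X t0 y1\<close> by (simp add: enters_before_def)
  hence "y < b" using y(1) ends(2) by (metis le_neq_trans)
  have "y1 \<le> y" using last y1(2) by (simp add: enters_before_def)
  moreover have "y1 \<noteq> a" using \<open>X t0 y1\<close> ends(1) by blast
  ultimately have "a < y" using y1(1) by auto
  have "entry_minimum X y (min 1 (min (y - a) (b - y)))"
  proof (rule entry_minimumI[OF \<open>a < y\<close> \<open>y < b\<close>])
    show "enters_before X y y'" if "a \<le> y'" "y' \<le> b" for y'
      using first[OF that] y(2) by (simp add: enters_before_def)
    show "y' \<le> y" if "y' \<le> b" "enters_before X y' y" for y'
      using that last y(2) by (simp add: enters_before_def)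
  qed
  thus ?thesis using \<open>a < y\<close> \<open>y < b\<close> by blast
qed

lemma closed_family_contains_interval:
  assumes X: "definable_binary X" "mono X" "\<And>t. closed {y. X t y}"
    and "c < d" and dn: "dense_between (\<lambda>y. \<exists>t. X t y) c d"
  obtains t a b where "c \<le> a" "a < b" "b \<le> d" "\<forall>y. a < y \<and> y < b \<longrightarrow> X t y"
proof (rule ccontr)
  note contains = that
  assume no_thesis: "\<not> thesis"
  have no_interval: "\<exists>y. a < y \<and> y < b \<and> \<not> X t y" if "c \<le> a" "a < b" "b \<le> d" for t a b
  proof (rule ccontr)
    assume "\<not> (\<exists>y. a < y \<and> y < b \<and> \<not> X t y)"
    hence "\<forall>y. a < y \<and> y < b \<longrightarrow> X t y" by blast
    thus False using no_thesis contains that by blast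
  qed
  have "dense_between (\<lambda>y. y \<in> {y. \<exists>\<epsilon>. entry_minimum X y \<epsilon>}) c d"
    unfolding dense_between_iff
  proof (intro allI impI)
    fix a b assume ab: "c \<le> a \<and> a < b \<and> b \<le> d"
    obtain y t where y: "a < y" "y < b" "X t y" using dense_betweenD[OF dn, of a b] ab by blast
    obtain a' where a': "a < a'" "a' < y" "\<not> X t a'" using no_interval[of a y] y ab by auto
    obtain b' where b': "y < b'" "b' < b" "\<not> X t b'" using no_interval[of y b] y ab by auto
    obtain z \<epsilon> where "a' < z" "z < b'" "entry_minimum X z \<epsilon>"
      using ex_entry_minimum[OF X, of a' y b' t] a' b' y by blast
    moreover from this have "a < z" "z < b" using a' b' by auto
    ultimately show "\<exists>z. a < z \<and> z < b \<and> z \<in> {y. \<exists>\<epsilon>. entry_minimum X y \<epsilon>}" by blast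
  qed
  thus False using dense_between_not_nowhere_dense \<open>c < d\<close> nowhere_dense_entry_minima[OF X(1)] by blast
qed

lemma baire:
  assumes X: "definable_binary X" "mono X"
    and "c < d" and dn: "dense_between (\<lambda>y. \<exists>t. X t y) c d"
  obtains t a b where "c \<le> a" "a < b" "b \<le> d" "dense_between (X t) a b"
proof -
  let ?X = "\<lambda>t y. y \<in> closure {y. X t y}"
  have "definable_binary ?X"
    unfolding mem_closure_Collect_iff by (intro definable_pred_subst2[OF X(1)] definable_intros)
  moreover have "mono ?X" by (rule mono_closure[OF X(2)])
  moreover have "closed {y. ?X t y}" for t by simp
  moreover note \<open>c < d\<close>
  moreover have "dense_between (\<lambda>y. \<exists>t. ?X t y) c d"
    by (rule dense_between_mono[OF dn]) (use closure_subset in fastforce)+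
  ultimately obtain t a b where ab: "c \<le> a" "a < b" "b \<le> d" "\<forall>y. a < y \<and> y < b \<longrightarrow> ?X t y"
    by (rule closed_family_contains_interval)
  hence "dense_between (X t) a b" by (auto simp: dense_between_def)
  thus thesis by (rule that[OF ab(1-3)])
qed

end

section \<open>Increasing unions of closed families\<close>

definition ex_at :: "nat \<Rightarrow> ((nat \<Rightarrow> 'a) \<Rightarrow> bool) \<Rightarrow> (nat \<Rightarrow> 'a) \<Rightarrow> bool" where
  "ex_at i P e \<longleftrightarrow> (\<exists>x. P (e(i := x)))"

definition interval_at :: "nat \<Rightarrow> ((nat \<Rightarrow> 'a::linorder) \<Rightarrow> bool) \<Rightarrow> (nat \<Rightarrow> 'a) \<Rightarrow> bool" where
  "interval_at i P e \<longleftrightarrow> (\<exists>a b. a < b \<and> (\<forall>x. a < x \<and> x < b \<longrightarrow> P (e(i := x))))"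

lemma interval_at_mono: "interval_at i P e \<Longrightarrow> (\<And>e. P e \<Longrightarrow> P' e) \<Longrightarrow> interval_at i P' e"
  unfolding interval_at_def by blast

lemma continuous_on_add_const:
  fixes c :: "'a::{linordered_field, linorder_topology}"
  shows "continuous_on UNIV (\<lambda>x. x + c)"
proof (rule continuous_onI_mono)
  have "surj (\<lambda>x. x + c)" by (rule surjI[of _ "\<lambda>x. x - c"]) simp
  thus "open (range (\<lambda>x. x + c))" by simp
qed simp

context definable_predicates
begin

definition D_Sigma_family :: "('a \<Rightarrow> (nat \<Rightarrow> 'a) \<Rightarrow> bool) \<Rightarrow> bool" where
  "D_Sigma_family Q \<longleftrightarrow> definable_pred (\<lambda>e. Q (e 0) (\<lambda>i. e (Suc i))) \<and> (\<forall>t. closed {e. Q t e}) \<and>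
     mono Q \<and> (\<forall>t e. Q t e \<longrightarrow> 0 < t)"

definition D_Sigma_pred :: "((nat \<Rightarrow> 'a) \<Rightarrow> bool) \<Rightarrow> bool" where
  "D_Sigma_pred P \<longleftrightarrow> (\<exists>Q. D_Sigma_family Q \<and> P = (\<lambda>e. \<exists>t. Q t e))"

lemma definable_pred_family:
  "D_Sigma_family Q \<Longrightarrow> definable_term T \<Longrightarrow> (\<And>i. definable_term (\<lambda>e. U e i))
    \<Longrightarrow> definable_pred (\<lambda>e. Q (T e) (U e))"
  unfolding D_Sigma_family_def by (blast intro: definable_pred_subst_Suc[of Q])

lemma D_Sigma_familyD:
  assumes "D_Sigma_family Q"
  shows "closed {e. Q t e}" "mono Q" "Q t e \<Longrightarrow> 0 < t"
  using assms unfolding D_Sigma_family_def by blast+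

lemma D_Sigma_family_slice:
  assumes Q: "D_Sigma_family Q"
  shows "definable_binary (\<lambda>t x. Q t (e(i := x)))" "mono (\<lambda>t x. Q t (e(i := x)))"
    "closed {x. Q t (e(i := x))}"
proof -
  show "definable_binary (\<lambda>t x. Q t (e(i := x)))"
    by (intro definable_pred_family[OF Q] definable_intros)
  show "mono (\<lambda>t x. Q t (e(i := x)))"
    using mono_predD[OF D_Sigma_familyD(2)[OF Q]] by (intro monoI predicate1I) blast
  show "closed {x. Q t (e(i := x))}"
    by (intro closed_Collect_compose[OF D_Sigma_familyD(1)[OF Q]] continuous_on_fun_upd continuous_intros)
qed

lemma D_Sigma_pred_of_closed:
  assumes "definable_pred P" "closed {e. P e}"
  shows "D_Sigma_pred P"
proof -
  have "D_Sigma_family (\<lambda>t e. 0 < t \<and> P e)"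
    unfolding D_Sigma_family_def
  proof (intro conjI allI impI)
    show "definable_pred (\<lambda>e. 0 < e 0 \<and> P (\<lambda>i. e (Suc i)))"
      by (intro definable_intros definable_pred_subst[OF assms(1)])
    show "closed {e. 0 < t \<and> P e}" for t :: 'a
      by (intro closed_Collect_conj closed_Collect_const assms)
    show "mono (\<lambda>t e. 0 < t \<and> P e)" by (intro monoI predicate1I) auto
  qed auto
  moreover have "P = (\<lambda>e. \<exists>t::'a. 0 < t \<and> P e)" using zero_less_one by blast
  ultimately show ?thesis unfolding D_Sigma_pred_def by blast
qed

lemma definable_pred_of_D_Sigma:
  assumes "D_Sigma_pred P"
  shows "definable_pred P"
proof -
  obtain Q where Q: "D_Sigma_family Q" "P = (\<lambda>e. \<exists>t. Q t e)"
    using assms unfolding D_Sigma_pred_def by blast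
  show ?thesis unfolding Q(2) by (intro definable_pred_family[OF Q(1)] definable_intros)
qed

lemma D_Sigma_pred_conj:
  assumes "D_Sigma_pred P" "D_Sigma_pred P'"
  shows "D_Sigma_pred (\<lambda>e. P e \<and> P' e)"
proof -
  obtain Q Q' where Q: "D_Sigma_family Q" "P = (\<lambda>e. \<exists>t. Q t e)"
    and Q': "D_Sigma_family Q'" "P' = (\<lambda>e. \<exists>t. Q' t e)"
    using assms unfolding D_Sigma_pred_def by blast
  note increasing = mono_predD[OF D_Sigma_familyD(2)[OF Q(1)]] mono_predD[OF D_Sigma_familyD(2)[OF Q'(1)]]
  have "D_Sigma_family (\<lambda>t e. Q t e \<and> Q' t e)"
    unfolding D_Sigma_family_def
  proof (intro conjI allI impI)
    show "definable_pred (\<lambda>e. Q (e 0) (\<lambda>i. e (Suc i)) \<and> Q' (e 0) (\<lambda>i. e (Suc i)))"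
      by (intro definable_pred_conj definable_pred_family[OF Q(1)] definable_pred_family[OF Q'(1)]
          definable_term_var)
    show "closed {e. Q t e \<and> Q' t e}" for t
      by (intro closed_Collect_conj D_Sigma_familyD(1)[OF Q(1)] D_Sigma_familyD(1)[OF Q'(1)])
    show "mono (\<lambda>t e. Q t e \<and> Q' t e)" using increasing by (intro monoI predicate1I) blast
  qed (use D_Sigma_familyD(3)[OF Q(1)] in blast)
  moreover have "P e \<and> P' e \<longleftrightarrow> (\<exists>t. Q t e \<and> Q' t e)" for e
  proof
    assume "P e \<and> P' e"
    then obtain s t where "Q s e" "Q' t e" unfolding Q(2) Q'(2) by blast
    hence "Q (max s t) e" "Q' (max s t) e" using increasing by auto
    thus "\<exists>t. Q t e \<and> Q' t e" by blast
  qed (auto simp: Q(2) Q'(2))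
  ultimately show ?thesis unfolding D_Sigma_pred_def by fast
qed

lemma D_Sigma_pred_disj:
  assumes "D_Sigma_pred P" "D_Sigma_pred P'"
  shows "D_Sigma_pred (\<lambda>e. P e \<or> P' e)"
proof -
  obtain Q Q' where Q: "D_Sigma_family Q" "P = (\<lambda>e. \<exists>t. Q t e)"
    and Q': "D_Sigma_family Q'" "P' = (\<lambda>e. \<exists>t. Q' t e)"
    using assms unfolding D_Sigma_pred_def by blast
  note increasing = mono_predD[OF D_Sigma_familyD(2)[OF Q(1)]] mono_predD[OF D_Sigma_familyD(2)[OF Q'(1)]]
  have "D_Sigma_family (\<lambda>t e. Q t e \<or> Q' t e)"
    unfolding D_Sigma_family_def
  proof (intro conjI allI impI)
    show "definable_pred (\<lambda>e. Q (e 0) (\<lambda>i. e (Suc i)) \<or> Q' (e 0) (\<lambda>i. e (Suc i)))"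
      by (intro definable_pred_disj definable_pred_family[OF Q(1)] definable_pred_family[OF Q'(1)]
          definable_term_var)
    show "closed {e. Q t e \<or> Q' t e}" for t
      by (intro closed_Collect_disj D_Sigma_familyD(1)[OF Q(1)] D_Sigma_familyD(1)[OF Q'(1)])
    show "mono (\<lambda>t e. Q t e \<or> Q' t e)" using increasing by (intro monoI predicate1I) blast
  qed (use D_Sigma_familyD(3)[OF Q(1)] D_Sigma_familyD(3)[OF Q'(1)] in blast)
  moreover have "(\<lambda>e. P e \<or> P' e) = (\<lambda>e. \<exists>t. Q t e \<or> Q' t e)"
    unfolding Q(2) Q'(2) by blast
  ultimately show ?thesis unfolding D_Sigma_pred_def by blast
qed

end

context definably_complete_expansion
begin

lemma D_Sigma_family_ex_between:
  assumes Q: "D_Sigma_family Q"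
  shows "D_Sigma_family (\<lambda>t e. \<exists>a. - t \<le> a \<and> a \<le> t \<and> Q t (e(i := a)))" (is "D_Sigma_family ?Q")
    and "ex_at i (\<lambda>e. \<exists>t. Q t e) = (\<lambda>e. \<exists>t a. - t \<le> a \<and> a \<le> t \<and> Q t (e(i := a)))"
proof -
  note increasing = mono_predD[OF D_Sigma_familyD(2)[OF Q]]
  show "D_Sigma_family ?Q"
    unfolding D_Sigma_family_def
  proof (intro conjI allI impI)
    show "definable_pred (\<lambda>e. ?Q (e 0) (\<lambda>i. e (Suc i)))"
      by (intro definable_pred_family[OF Q] definable_intros)
    show "closed {e. ?Q t e}" for t
      by (intro closed_ex_between D_Sigma_familyD(1)[OF Q] definable_pred_family[OF Q] definable_intros)
    show "mono ?Q"
    proof (intro monoI predicate1I)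
      fix s t e assume "s \<le> t" "?Q s e"
      then obtain a where a: "- s \<le> a" "a \<le> s" "Q t (e(i := a))" using increasing by blast
      hence "- t \<le> a" "a \<le> t" using \<open>s \<le> t\<close> by linarith+
      thus "?Q t e" using a(3) by blast
    qed
    show "0 < t" if "?Q t e" for t e using that D_Sigma_familyD(3)[OF Q] by blast
  qed
  show "ex_at i (\<lambda>e. \<exists>t. Q t e) = (\<lambda>e. \<exists>t. ?Q t e)"
  proof (intro ext iffI)
    fix e assume "ex_at i (\<lambda>e. \<exists>t. Q t e) e"
    then obtain a t where a: "Q t (e(i := a))" unfolding ex_at_def by blast
    have "- max t \<bar>a\<bar> \<le> a" "a \<le> max t \<bar>a\<bar>" by linarith+
    moreover have "Q (max t \<bar>a\<bar>) (e(i := a))" using increasing[OF a] by simp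
    ultimately show "\<exists>t. ?Q t e" by blast
  qed (auto simp: ex_at_def)
qed

lemma D_Sigma_pred_ex_at: "D_Sigma_pred P \<Longrightarrow> D_Sigma_pred (ex_at i P)"
  unfolding D_Sigma_pred_def using D_Sigma_family_ex_between by blast

lemma D_Sigma_family_interval_from:
  assumes Q: "D_Sigma_family Q"
  shows "D_Sigma_family (\<lambda>t e. 0 < t \<and> (\<forall>s. 0 \<le> s \<and> s \<le> 1 / t \<longrightarrow> Q t (e(i := e i + s))))"
  unfolding D_Sigma_family_def
proof (intro conjI allI impI)
  show "definable_pred (\<lambda>e. 0 < e 0 \<and> (\<forall>s. 0 \<le> s \<and> s \<le> 1 / e 0 \<longrightarrow>
      Q (e 0) ((\<lambda>i. e (Suc i))(i := e (Suc i) + s))))"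
    by (intro definable_pred_family[OF Q] definable_intros)
  have "continuous_on UNIV (\<lambda>e :: nat \<Rightarrow> 'a. e(i := e i + s))" for s
    by (intro continuous_on_fun_upd continuous_on_id continuous_on_compose2[OF continuous_on_add_const]
        continuous_on_product_coordinates subset_UNIV)
  thus "closed {e. 0 < t \<and> (\<forall>s. 0 \<le> s \<and> s \<le> 1 / t \<longrightarrow> Q t (e(i := e i + s)))}" for t
    by (intro closed_Collect_conj closed_Collect_const closed_Collect_all closed_Collect_imp
        open_Collect_const closed_Collect_compose[OF D_Sigma_familyD(1)[OF Q]])
  show "mono (\<lambda>t e. 0 < t \<and> (\<forall>s. 0 \<le> s \<and> s \<le> 1 / t \<longrightarrow> Q t (e(i := e i + s))))"
  proof (intro monoI predicate1I conjI allI impI)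
    fix t t' e s
    assume t: "t \<le> t'" "0 < t \<and> (\<forall>s. 0 \<le> s \<and> s \<le> 1 / t \<longrightarrow> Q t (e(i := e i + s)))"
      and s: "0 \<le> s \<and> s \<le> 1 / t'"
    have "1 / t' \<le> 1 / t" using t by (simp add: frac_le)
    hence "Q t (e(i := e i + s))" using t s by (meson order_trans)
    thus "Q t' (e(i := e i + s))" using mono_predD[OF D_Sigma_familyD(2)[OF Q]] t(1) by blast
  qed auto
qed auto

end

context restrained_expansion
begin

lemma family_contains_interval:
  assumes Q: "D_Sigma_family Q" and "c < d" "dense_between (\<lambda>x. \<exists>t. Q t (e(i := x))) c d"
  obtains t a b where "c \<le> a" "a < b" "b \<le> d" "\<forall>x. a < x \<and> x < b \<longrightarrow> Q t (e(i := x))"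
  by (rule closed_family_contains_interval[OF D_Sigma_family_slice[OF Q] assms(2,3)])

lemma D_Sigma_pred_contains_interval:
  assumes "D_Sigma_pred P" "c < d" "dense_between (\<lambda>x. P (e(i := x))) c d"
  obtains a b where "c \<le> a" "a < b" "b \<le> d" "\<forall>x. a < x \<and> x < b \<longrightarrow> P (e(i := x))"
proof -
  obtain Q where Q: "D_Sigma_family Q" "P = (\<lambda>e. \<exists>t. Q t e)"
    using assms(1) unfolding D_Sigma_pred_def by blast
  obtain t a b where "c \<le> a" "a < b" "b \<le> d" "\<forall>x. a < x \<and> x < b \<longrightarrow> Q t (e(i := x))"
    by (rule family_contains_interval[OF Q(1) assms(2) assms(3)[unfolded Q(2)]])
  thus thesis using that unfolding Q(2) by blast
qed

lemma interval_at_of_dense: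
  assumes "D_Sigma_pred P" "c < d" "dense_between (\<lambda>x. P (e(i := x))) c d"
  shows "interval_at i P e"
  unfolding interval_at_def by (rule D_Sigma_pred_contains_interval[OF assms]) blast

lemma interval_at_disj:
  assumes "D_Sigma_pred P" "interval_at i (\<lambda>e. P e \<or> P' e) e"
  shows "interval_at i P e \<or> interval_at i P' e"
proof -
  obtain a b where ab: "a < b" "\<And>x. a < x \<Longrightarrow> x < b \<Longrightarrow> P (e(i := x)) \<or> P' (e(i := x))"
    using assms(2) unfolding interval_at_def by blast
  show ?thesis
  proof (cases "dense_between (\<lambda>x. P (e(i := x))) a b")
    case True
    thus ?thesis using interval_at_of_dense[OF assms(1) ab(1)] by blast
  next
    case False
    then obtain c d where cd: "a \<le> c" "c < d" "d \<le> b" "\<And>x. c < x \<Longrightarrow> x < d \<Longrightarrow> \<not> P (e(i := x))"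
      by (rule not_dense_betweenE) blast
    have "P' (e(i := x))" if "c < x" "x < d" for x
      using that cd ab(2)[of x] by auto
    thus ?thesis using cd(2) unfolding interval_at_def by blast
  qed
qed

lemma interval_at_family:
  assumes Q: "D_Sigma_family Q"
  shows "interval_at i (\<lambda>e. \<exists>t. Q t e) =
    ex_at i (\<lambda>e. \<exists>t. 0 < t \<and> (\<forall>s. 0 \<le> s \<and> s \<le> 1 / t \<longrightarrow> Q t (e(i := e i + s))))"
proof (intro ext iffI)
  fix e assume "interval_at i (\<lambda>e. \<exists>t. Q t e) e"
  then obtain c d where cd: "c < d" "\<And>x. c < x \<Longrightarrow> x < d \<Longrightarrow> \<exists>t. Q t (e(i := x))"
    unfolding interval_at_def by blast
  have "dense_between (\<lambda>x. \<exists>t. Q t (e(i := x))) c d" by (rule dense_between_all[OF cd(2)])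
  then obtain t a b where "a < b" and Qt: "\<forall>x. a < x \<and> x < b \<longrightarrow> Q t (e(i := x))"
    by (rule family_contains_interval[OF Q cd(1)])
  then obtain m l where ml: "a < m" "m < l" "l < b" using dense by metis
  define T where "T = max t (1 / (l - m))"
  have "0 < 1 / (l - m)" using ml by simp
  hence T: "0 < T" "t \<le> T" "1 / (l - m) \<le> T" by (auto simp: T_def less_max_iff_disj)
  have "1 / T \<le> l - m" using T(1,3) ml by (simp add: field_simps)
  hence "Q T (e(i := m + s))" if "0 \<le> s" "s \<le> 1 / T" for s
    using that ml Qt mono_predD[OF D_Sigma_familyD(2)[OF Q] _ T(2)] by auto
  thus "ex_at i (\<lambda>e. \<exists>t. 0 < t \<and> (\<forall>s. 0 \<le> s \<and> s \<le> 1 / t \<longrightarrow> Q t (e(i := e i + s)))) e"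
    unfolding ex_at_def using T(1) by (intro exI[of _ m] exI[of _ T]) simp
next
  fix e assume "ex_at i (\<lambda>e. \<exists>t. 0 < t \<and> (\<forall>s. 0 \<le> s \<and> s \<le> 1 / t \<longrightarrow> Q t (e(i := e i + s)))) e"
  then obtain c t where t: "0 < t" "\<forall>s. 0 \<le> s \<and> s \<le> 1 / t \<longrightarrow> Q t (e(i := c + s))"
    unfolding ex_at_def by auto
  have "Q t (e(i := x))" if "c < x" "x < c + 1 / t" for x
    using that t(2)[rule_format, of "x - c"] by (simp add: algebra_simps)
  moreover have "c < c + 1 / t" using t(1) by simp
  ultimately show "interval_at i (\<lambda>e. \<exists>t. Q t e) e" unfolding interval_at_def by blast
qed

lemma D_Sigma_pred_interval_at:
  assumes "D_Sigma_pred P"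
  shows "D_Sigma_pred (interval_at i P)"
proof -
  obtain Q where Q: "D_Sigma_family Q" "P = (\<lambda>e. \<exists>t. Q t e)"
    using assms unfolding D_Sigma_pred_def by blast
  show ?thesis
    unfolding Q(2) interval_at_family[OF Q(1)]
    by (rule D_Sigma_pred_ex_at) (use D_Sigma_family_interval_from[OF Q(1)] D_Sigma_pred_def in blast)
qed

end

section \<open>Boxes\<close>

abbreviation in_box :: "'i set \<Rightarrow> ('i \<Rightarrow> 'a::order) \<Rightarrow> ('i \<Rightarrow> 'a) \<Rightarrow> ('i \<Rightarrow> 'a) \<Rightarrow> bool" where
  "in_box S a b z \<equiv> \<forall>i\<in>S. a i < z i \<and> z i < b i"

lemma in_box_nonempty:
  fixes a b :: "'i \<Rightarrow> 'a::dense_linorder"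
  assumes "\<forall>i\<in>S. a i < b i"
  obtains z where "in_box S a b z"
proof -
  have "\<forall>i\<in>S. \<exists>x. a i < x \<and> x < b i" using assms dense by blast
  thus thesis using that bchoice by metis
qed

lemma in_box_nested:
  fixes a b :: "'i \<Rightarrow> 'a::dense_linorder"
  assumes "\<forall>i\<in>S. a i < b i"
  obtains l h where "in_box S a b l" "in_box S a b h" "\<forall>i\<in>S. l i < h i"
proof -
  obtain l where l: "in_box S a b l" by (rule in_box_nonempty[OF assms])
  hence "\<forall>i\<in>S. l i < b i" by blast
  then obtain h where h: "in_box S l b h" by (rule in_box_nonempty)
  have "in_box S a b h" using l h by (meson less_trans)
  thus thesis using that l h by blast
qed

lemma all_in_box_insert_iff:
  assumes "k \<notin> S"
  shows "(\<forall>z. in_box (insert k S) (a(k := u)) (b(k := v)) z \<longrightarrow> P (override_on e z (insert k S))) \<longleftrightarrow>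
    (\<forall>z. in_box S a b z \<longrightarrow> (\<forall>x. u < x \<and> x < v \<longrightarrow> P ((override_on e z S)(k := x))))"
    (is "?lhs \<longleftrightarrow> ?rhs")
proof (intro iffI allI impI)
  fix z x assume "?lhs" and z: "in_box S a b z" and x: "u < x \<and> x < v"
  moreover have "in_box (insert k S) (a(k := u)) (b(k := v)) (z(k := x))" using z x assms by auto
  ultimately have "P (override_on e (z(k := x)) (insert k S))" by blast
  moreover have "override_on e (z(k := x)) (insert k S) = (override_on e z S)(k := x)"
    using assms by (auto simp: override_on_def fun_eq_iff)
  ultimately show "P ((override_on e z S)(k := x))" by simp
next
  fix z assume "?rhs" and z: "in_box (insert k S) (a(k := u)) (b(k := v)) z"
  moreover have "in_box S a b z" "u < z k" "z k < v" using z assms by (auto split: if_splits)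
  ultimately have "P ((override_on e z S)(k := z k))" by blast
  thus "P (override_on e z (insert k S))" by (simp only: override_on_insert)
qed

definition box_on :: "nat set \<Rightarrow> ((nat \<Rightarrow> 'a::linorder) \<Rightarrow> bool) \<Rightarrow> (nat \<Rightarrow> 'a) \<Rightarrow> bool" where
  "box_on S P e \<longleftrightarrow> (\<exists>a b. (\<forall>i\<in>S. a i < b i) \<and> (\<forall>z. in_box S a b z \<longrightarrow> P (override_on e z S)))"

definition ex_on :: "nat set \<Rightarrow> ((nat \<Rightarrow> 'a) \<Rightarrow> bool) \<Rightarrow> (nat \<Rightarrow> 'a) \<Rightarrow> bool" where
  "ex_on S P e \<longleftrightarrow> (\<exists>z. P (override_on e z S))"

lemma ex_on_empty: "ex_on {} P = P"
  by (auto simp: ex_on_def fun_eq_iff)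

lemma ex_on_mono: "ex_on S P e \<Longrightarrow> (\<And>e. P e \<Longrightarrow> P' e) \<Longrightarrow> ex_on S P' e"
  unfolding ex_on_def by blast

lemma ex_on_Un: "ex_on (S \<union> T) P = ex_on S (ex_on T P)"
proof
  fix e :: "nat \<Rightarrow> 'a"
  have "override_on e z (S \<union> T) = override_on (override_on e z S) z T" for z
    by (auto simp: override_on_def)
  moreover have "override_on (override_on e z S) z' T = override_on e (override_on z z' T) (S \<union> T)" for z z'
    by (auto simp: override_on_def)
  ultimately show "ex_on (S \<union> T) P e = ex_on S (ex_on T P) e" unfolding ex_on_def by metis
qed

lemma ex_on_singleton: "ex_on {i} P = ex_at i P"
proof
  fix e :: "nat \<Rightarrow> 'a"
  have "override_on e z {i} = e(i := z i)" for z by (auto simp: override_on_def)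
  moreover have "e(i := a) = override_on e (\<lambda>_. a) {i}" for a by (auto simp: override_on_def)
  ultimately show "ex_on {i} P e = ex_at i P e" unfolding ex_on_def ex_at_def by metis
qed

lemma ex_on_insert: "ex_on (insert i S) P = ex_at i (ex_on S P)"
  using ex_on_Un[of "{i}" S P] by (simp add: ex_on_singleton)

lemma ex_on_insert_right: "ex_on (insert i S) P = ex_on S (ex_at i P)"
  using ex_on_Un[of S "{i}" P] by (simp add: ex_on_singleton)

lemma box_on_empty: "box_on {} P = P"
  by (auto simp: box_on_def fun_eq_iff)

lemma box_on_mono: "box_on S P e \<Longrightarrow> (\<And>e. P e \<Longrightarrow> P' e) \<Longrightarrow> box_on S P' e"
  unfolding box_on_def by blast

lemma box_on_nonempty:
  fixes P :: "(nat \<Rightarrow> 'a::dense_linorder) \<Rightarrow> bool"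
  assumes "box_on S P e"
  obtains z where "P (override_on e z S)"
proof -
  obtain a b where ab: "\<forall>i\<in>S. a i < b i" "\<forall>z. in_box S a b z \<longrightarrow> P (override_on e z S)"
    using assms unfolding box_on_def by blast
  obtain z where "in_box S a b z" by (rule in_box_nonempty[OF ab(1)])
  thus thesis using that ab(2) by blast
qed

lemma box_on_insert_iff:
  assumes "i \<notin> S"
  shows "box_on (insert i S) P e \<longleftrightarrow>
    (\<exists>a b. a < b \<and> box_on S (\<lambda>e. \<forall>x. a < x \<and> x < b \<longrightarrow> P (e(i := x))) e)"
proof
  assume "box_on (insert i S) P e"
  then obtain a b where ab: "\<forall>j\<in>insert i S. a j < b j"
    "\<forall>z. in_box (insert i S) (a(i := a i)) (b(i := b i)) z \<longrightarrow> P (override_on e z (insert i S))"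
    unfolding box_on_def fun_upd_triv by blast
  hence "box_on S (\<lambda>e. \<forall>x. a i < x \<and> x < b i \<longrightarrow> P (e(i := x))) e"
    unfolding all_in_box_insert_iff[OF assms] box_on_def by blast
  thus "\<exists>a b. a < b \<and> box_on S (\<lambda>e. \<forall>x. a < x \<and> x < b \<longrightarrow> P (e(i := x))) e"
    using ab(1) by blast
next
  assume "\<exists>a b. a < b \<and> box_on S (\<lambda>e. \<forall>x. a < x \<and> x < b \<longrightarrow> P (e(i := x))) e"
  then obtain u v a b where uv: "u < v" and ab: "\<forall>j\<in>S. a j < b j"
    "\<forall>z. in_box S a b z \<longrightarrow> (\<forall>x. u < x \<and> x < v \<longrightarrow> P ((override_on e z S)(i := x)))"
    unfolding box_on_def by blast
  have "\<forall>j\<in>insert i S. (a(i := u)) j < (b(i := v)) j" using uv ab(1) by simp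
  thus "box_on (insert i S) P e"
    using ab(2) unfolding all_in_box_insert_iff[OF assms, symmetric] box_on_def by blast
qed

lemma interval_at_box_on_of_insert:
  assumes "box_on (insert i S) P e" "i \<notin> S"
  shows "interval_at i (box_on S P) e"
proof -
  obtain a b where ab: "a < b" "box_on S (\<lambda>e. \<forall>x. a < x \<and> x < b \<longrightarrow> P (e(i := x))) e"
    using assms by (auto simp: box_on_insert_iff)
  have "override_on (e(i := x)) z S = (override_on e z S)(i := x)" for x z
    using assms(2) by (auto simp: override_on_def fun_eq_iff)
  hence "box_on S P (e(i := x))" if "a < x" "x < b" for x
    using ab(2) that unfolding box_on_def by simp blast
  thus ?thesis using ab(1) unfolding interval_at_def by blast
qed

lemma box_on_singleton: "box_on {i} P = interval_at i P"
proof
  show "box_on {i} P e = interval_at i P e" for e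
    using box_on_insert_iff[of i "{}" P e] by (simp add: box_on_empty interval_at_def)
qed

lemma box_on_ex_on_commute:
  assumes "ex_on J (box_on S P) e" "J \<inter> S = {}"
  shows "box_on S (ex_on J P) e"
proof -
  obtain x a b where "\<forall>i\<in>S. a i < b i"
    "\<forall>z. in_box S a b z \<longrightarrow> P (override_on (override_on e x J) z S)"
    using assms(1) unfolding ex_on_def box_on_def by blast
  moreover have "override_on (override_on e x J) z S = override_on (override_on e z S) x J" for z
    using assms(2) by (auto simp: override_on_def fun_eq_iff)
  ultimately show ?thesis unfolding box_on_def ex_on_def by metis
qed

context definably_complete_expansion
begin

lemma D_Sigma_pred_ex_on: "finite S \<Longrightarrow> D_Sigma_pred P \<Longrightarrow> D_Sigma_pred (ex_on S P)"
  by (induction S rule: finite_induct) (simp_all add: ex_on_empty ex_on_insert D_Sigma_pred_ex_at)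

end

context restrained_expansion
begin

lemma uniform_selection:
  assumes R: "definable_binary R" and "\<delta> > 0" "c < d"
    and dn: "dense_between (\<lambda>y. \<exists>u. \<alpha> \<le> u \<and> u \<le> \<beta> \<and> R u y) c d"
  obtains w c' d' where "c \<le> c'" "c' < d'" "d' \<le> d"
    "dense_between (\<lambda>y. \<exists>u. w \<le> u \<and> u \<le> w + \<delta> \<and> R u y) c' d'"
proof -
  define X where "X = (\<lambda>s. dense_between (\<lambda>y. \<exists>u. \<alpha> \<le> u \<and> u \<le> s \<and> R u y) c d)"
  have "definable_unary X"
    unfolding X_def dense_between_iff by (intro definable_pred_subst2[OF R] definable_intros)
  moreover have "X \<beta>" using dn by (simp add: X_def conj_ac)
  moreover have "\<alpha> \<le> s" if "X s" for s
    by (rule dense_betweenD[OF that[unfolded X_def] order_refl \<open>c < d\<close> order_refl]) auto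
  ultimately obtain s where s: "is_inf X s" by (rule definable_has_inf)
  have "\<not> X (s - \<delta> / 2)" using is_infD(1)[OF s, of "s - \<delta> / 2"] \<open>\<delta> > 0\<close> by auto
  then obtain c' d' where c'd': "c \<le> c'" "c' < d'" "d' \<le> d"
    "\<And>y. c' < y \<Longrightarrow> y < d' \<Longrightarrow> \<not> (\<exists>u. \<alpha> \<le> u \<and> u \<le> s - \<delta> / 2 \<and> R u y)"
    unfolding X_def by (rule not_dense_betweenE) blast
  obtain s' where s': "X s'" "s' < s + \<delta> / 2" using is_infD(2)[OF s, of "s + \<delta> / 2"] \<open>\<delta> > 0\<close> by auto
  have "dense_between (\<lambda>y. \<exists>u. s - \<delta> / 2 \<le> u \<and> u \<le> s - \<delta> / 2 + \<delta> \<and> R u y) c' d'"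
  proof (rule dense_between_mono[OF s'(1)[unfolded X_def] c'd'(1,3)])
    fix y assume "c' < y" "y < d'" "\<exists>u. \<alpha> \<le> u \<and> u \<le> s' \<and> R u y"
    then obtain u where u: "\<alpha> \<le> u" "u \<le> s'" "R u y" "\<not> u \<le> s - \<delta> / 2" using c'd'(4) by blast
    hence "s - \<delta> / 2 \<le> u" "u \<le> s - \<delta> / 2 + \<delta>" using s'(2) by linarith+
    thus "\<exists>u. s - \<delta> / 2 \<le> u \<and> u \<le> s - \<delta> / 2 + \<delta> \<and> R u y" using u(3) by blast
  qed
  thus thesis by (rule that[OF c'd'(1-3)])
qed

lemma uniform_length:
  assumes H: "definable_pred (\<lambda>e. H (e 0) (e 1) (e 2))"
    and shrink: "\<And>a b a' b' y. H a b y \<Longrightarrow> a \<le> a' \<Longrightarrow> b' \<le> b \<Longrightarrow> H a' b' y"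
    and "c < d" and dn: "dense_between (\<lambda>y. \<exists>a b. a < b \<and> H a b y) c d"
  obtains t c' d' where "0 < t" "c \<le> c'" "c' < d'" "d' \<le> d"
    "dense_between (\<lambda>y. \<exists>x. - t \<le> x \<and> x \<le> t \<and> H x (x + 1 / t) y) c' d'"
proof -
  define W where "W = (\<lambda>t y. 0 < t \<and> (\<exists>x. - t \<le> x \<and> x \<le> t \<and> H x (x + 1 / t) y))"
  have "definable_binary W"
    unfolding W_def by (intro definable_pred_subst3[OF H] definable_intros)
  moreover have "mono W"
  proof (intro monoI predicate1I)
    fix s t y assume "s \<le> t" "W s y"
    then obtain x where x: "0 < s" "- s \<le> x" "x \<le> s" "H x (x + 1 / s) y" unfolding W_def by blast
    have "1 / t \<le> 1 / s" using x(1) \<open>s \<le> t\<close> by (simp add: frac_le)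
    hence "H x (x + 1 / t) y" by (intro shrink[OF x(4)]) simp_all
    moreover have "0 < t" "- t \<le> x" "x \<le> t" using x \<open>s \<le> t\<close> by linarith+
    ultimately show "W t y" unfolding W_def by blast
  qed
  moreover note \<open>c < d\<close>
  moreover have "dense_between (\<lambda>y. \<exists>t. W t y) c d"
  proof (rule dense_between_mono[OF dn order_refl order_refl])
    fix y assume "\<exists>a b. a < b \<and> H a b y"
    then obtain a b where ab: "a < b" "H a b y" by blast
    define t where "t = max \<bar>a\<bar> (1 / (b - a))"
    have "0 < 1 / (b - a)" using ab(1) by simp
    hence t: "0 < t" "1 / (b - a) \<le> t" "- t \<le> a" "a \<le> t" by (auto simp: t_def less_max_iff_disj)
    have "a + 1 / t \<le> b" using t(1,2) ab(1) by (simp add: field_simps)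
    hence "H a (a + 1 / t) y" by (rule shrink[OF ab(2) order_refl])
    thus "\<exists>t. W t y" unfolding W_def using t by blast
  qed
  ultimately obtain t c' d' where c'd': "c \<le> c'" "c' < d'" "d' \<le> d" and Wt: "dense_between (W t) c' d'"
    by (rule baire)
  have "0 < t" by (rule dense_betweenD[OF Wt order_refl c'd'(2) order_refl]) (simp add: W_def)
  moreover have "dense_between (\<lambda>y. \<exists>x. - t \<le> x \<and> x \<le> t \<and> H x (x + 1 / t) y) c' d'"
    by (rule dense_between_mono[OF Wt order_refl order_refl]) (simp add: W_def)
  ultimately show thesis using that c'd' by blast
qed

lemma uniform_interval:
  assumes H: "definable_pred (\<lambda>e. H (e 0) (e 1) (e 2))"
    and shrink: "\<And>a b a' b' y. H a b y \<Longrightarrow> a \<le> a' \<Longrightarrow> b' \<le> b \<Longrightarrow> H a' b' y"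
    and "c < d" and dn: "dense_between (\<lambda>y. \<exists>a b. a < b \<and> H a b y) c d"
  obtains a b c' d' where "a < b" "c \<le> c'" "c' < d'" "d' \<le> d" "dense_between (H a b) c' d'"
proof -
  obtain t c1 d1 where "0 < t" and c1d1: "c \<le> c1" "c1 < d1" "d1 \<le> d"
    and length_t: "dense_between (\<lambda>y. \<exists>x. - t \<le> x \<and> x \<le> t \<and> H x (x + 1 / t) y) c1 d1"
    by (rule uniform_length[of H, OF H _ \<open>c < d\<close> dn]) (rule shrink)
  define \<delta> where "\<delta> = 1 / t / 2"
  have \<delta>: "\<delta> > 0" "1 / t = \<delta> + \<delta>" using \<open>0 < t\<close> by (auto simp: \<delta>_def)
  have "definable_binary (\<lambda>x. H x (x + 1 / t))" by (intro definable_pred_subst3[OF H] definable_intros)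
  then obtain w c2 d2 where c2d2: "c1 \<le> c2" "c2 < d2" "d2 \<le> d1"
    and near_w: "dense_between (\<lambda>y. \<exists>x. w \<le> x \<and> x \<le> w + \<delta> \<and> H x (x + 1 / t) y) c2 d2"
    using \<delta>(1) c1d1(2) length_t by (rule uniform_selection)
  have "dense_between (H (w + \<delta>) (w + \<delta> + \<delta>)) c2 d2"
    by (rule dense_between_mono[OF near_w order_refl order_refl]) (auto intro: shrink simp: \<delta>(2))
  moreover have "c \<le> c2" "d2 \<le> d" using c1d1 c2d2 by linarith+
  ultimately show thesis using that[of "w + \<delta>" "w + \<delta> + \<delta>" c2 d2] \<delta>(1) c2d2(2) by simp
qed

lemma uniform_box:
  assumes "finite S" "definable_pred P" "c < d" "dense_between (\<lambda>y. box_on S P (e(i := y))) c d"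
  shows "\<exists>a b c' d'. (\<forall>j\<in>S. a j < b j) \<and> c \<le> c' \<and> c' < d' \<and> d' \<le> d \<and>
    dense_between (\<lambda>y. \<forall>z. in_box S a b z \<longrightarrow> P (override_on (e(i := y)) z S)) c' d'"
  using assms
proof (induction S arbitrary: P c d rule: finite_induct)
  case empty
  thus ?case by (auto simp: box_on_empty)
next
  case (insert k S)
  note P = \<open>definable_pred P\<close>
  define P' where "P' = (\<lambda>a b e. \<forall>x. a < x \<and> x < b \<longrightarrow> P (e(k := x)))"
  have "definable_pred (\<lambda>u. box_on S (P' (u 0) (u 1)) (e(i := u 2)))"
    unfolding box_on_def P'_def
    by (intro definable_pred_subst[OF P] definable_pred_ex_point definable_pred_all_point
        definable_pred_ball_finite insert.hyps(1) definable_intros)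
  moreover have "box_on S (P' a' b') (e(i := y))"
    if "box_on S (P' a b) (e(i := y))" "a \<le> a'" "b' \<le> b" for a b a' b' y
    using that(1) by (rule box_on_mono) (use that(2,3) in \<open>auto simp: P'_def\<close>)
  moreover note \<open>c < d\<close>
  moreover have "dense_between (\<lambda>y. \<exists>a b. a < b \<and> box_on S (P' a b) (e(i := y))) c d"
    using insert.prems(3) unfolding box_on_insert_iff[OF insert.hyps(2)] P'_def .
  ultimately obtain u v c1 d1 where uv: "u < v" and c1d1: "c \<le> c1" "c1 < d1" "d1 \<le> d"
    and dense_uv: "dense_between (\<lambda>y. box_on S (P' u v) (e(i := y))) c1 d1"
    by (rule uniform_interval)
  have "definable_pred (P' u v)"
    unfolding P'_def by (intro definable_pred_subst[OF P] definable_intros)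
  from insert.IH[OF this c1d1(2) dense_uv] obtain a b c2 d2 where
    ab: "\<forall>j\<in>S. a j < b j" and c2d2: "c1 \<le> c2" "c2 < d2" "d2 \<le> d1" and
    dense_ab: "dense_between (\<lambda>y. \<forall>z. in_box S a b z \<longrightarrow> P' u v (override_on (e(i := y)) z S)) c2 d2"
    by blast
  have "dense_between (\<lambda>y. \<forall>z. in_box (insert k S) (a(k := u)) (b(k := v)) z \<longrightarrow>
      P (override_on (e(i := y)) z (insert k S))) c2 d2"
    using dense_ab unfolding P'_def all_in_box_insert_iff[OF insert.hyps(2)] .
  moreover have "\<forall>j\<in>insert k S. (a(k := u)) j < (b(k := v)) j" using ab uv by simp
  moreover have "c \<le> c2" "d2 \<le> d" using c1d1 c2d2 by linarith+
  ultimately show ?case using c2d2(2) by blast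
qed

lemma box_on_insert_family:
  assumes Q: "D_Sigma_family Q" and S: "finite S" "i \<notin> S"
    and "interval_at i (\<lambda>e. \<exists>t. box_on S (Q t) e) e"
  shows "\<exists>t. box_on (insert i S) (Q t) e"
proof -
  obtain c d where cd: "c < d" "\<And>y. c < y \<Longrightarrow> y < d \<Longrightarrow> \<exists>t. box_on S (Q t) (e(i := y))"
    using assms(4) unfolding interval_at_def by blast
  have "definable_binary (\<lambda>t y. box_on S (Q t) (e(i := y)))"
    unfolding box_on_def
    by (intro definable_pred_family[OF Q] definable_pred_ex_point definable_pred_all_point
        definable_pred_ball_finite S definable_intros)
  moreover have "mono (\<lambda>t y. box_on S (Q t) (e(i := y)))"
    using mono_predD[OF D_Sigma_familyD(2)[OF Q]]
    by (intro monoI predicate1I) (rule box_on_mono, blast+)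
  moreover note cd(1)
  moreover have "dense_between (\<lambda>y. \<exists>t. box_on S (Q t) (e(i := y))) c d"
    by (rule dense_between_all[OF cd(2)])
  ultimately obtain t c1 d1 where "c1 < d1" "dense_between (\<lambda>y. box_on S (Q t) (e(i := y))) c1 d1"
    by (rule baire)
  moreover have "definable_pred (Q t)" by (intro definable_pred_family[OF Q] definable_intros)
  ultimately obtain a b c2 d2 where ab: "\<forall>j\<in>S. a j < b j" and "c2 < d2" and
    dense_ab: "dense_between (\<lambda>y. \<forall>z. in_box S a b z \<longrightarrow> Q t (override_on (e(i := y)) z S)) c2 d2"
    using uniform_box[OF S(1)] by blast
  have override_upd: "override_on (e(i := y)) z S = (override_on e z S)(i := y)" for y z
    using S(2) by (auto simp: override_on_def fun_eq_iff)
  have "closed {y. \<forall>z. in_box S a b z \<longrightarrow> Q t (override_on (e(i := y)) z S)}"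
    unfolding override_upd
    by (intro closed_Collect_all closed_Collect_imp open_Collect_const D_Sigma_family_slice(3)[OF Q])
  hence "\<forall>z. in_box S a b z \<longrightarrow> Q t ((override_on e z S)(i := y))" if "c2 < y" "y < d2" for y
    using closed_dense_between[OF _ dense_ab] that unfolding override_upd by blast
  hence "box_on S (\<lambda>e. \<forall>y. c2 < y \<and> y < d2 \<longrightarrow> Q t (e(i := y))) e"
    unfolding box_on_def using ab by blast
  thus ?thesis using \<open>c2 < d2\<close> box_on_insert_iff[OF S(2)] by blast
qed

lemma box_on_family:
  assumes Q: "D_Sigma_family Q" and "finite S" "box_on S (\<lambda>e. \<exists>t. Q t e) e"
  shows "\<exists>t. box_on S (Q t) e"
  using assms(2,3)
proof (induction S arbitrary: e rule: finite_induct)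
  case empty
  thus ?case by (simp add: box_on_empty)
next
  case (insert i S)
  have "interval_at i (box_on S (\<lambda>e. \<exists>t. Q t e)) e"
    by (rule interval_at_box_on_of_insert[OF insert.prems insert.hyps(2)])
  hence "interval_at i (\<lambda>e. \<exists>t. box_on S (Q t) e) e" by (rule interval_at_mono) (rule insert.IH)
  thus ?case by (rule box_on_insert_family[OF Q insert.hyps(1,2)])
qed

lemma box_on_insert:
  assumes "D_Sigma_pred P" "finite S" "i \<notin> S"
  shows "box_on (insert i S) P = interval_at i (box_on S P)"
proof (intro ext iffI)
  fix e assume inner: "interval_at i (box_on S P) e"
  obtain Q where Q: "D_Sigma_family Q" "P = (\<lambda>e. \<exists>t. Q t e)"
    using assms(1) unfolding D_Sigma_pred_def by blast
  have "interval_at i (\<lambda>e. \<exists>t. box_on S (Q t) e) e"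
    using inner by (rule interval_at_mono) (simp add: Q(2) box_on_family[OF Q(1) assms(2)])
  then obtain t where "box_on (insert i S) (Q t) e"
    using box_on_insert_family[OF Q(1) assms(2,3)] by blast
  thus "box_on (insert i S) P e" unfolding Q(2) by (rule box_on_mono) blast
qed (rule interval_at_box_on_of_insert[OF _ assms(3)])

lemma D_Sigma_pred_box_on: "finite S \<Longrightarrow> D_Sigma_pred P \<Longrightarrow> D_Sigma_pred (box_on S P)"
  by (induction S rule: finite_induct) (simp_all add: box_on_empty box_on_insert D_Sigma_pred_interval_at)

lemma box_on_Un:
  assumes "D_Sigma_pred P" "finite T" "finite S" "S \<inter> T = {}"
  shows "box_on (S \<union> T) P = box_on S (box_on T P)"
  using assms(3,4)
proof (induction S rule: finite_induct)
  case (insert i S)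
  thus ?case using assms(1,2) by (simp add: box_on_insert D_Sigma_pred_box_on)
qed (simp add: box_on_empty)

lemma box_on_disj:
  assumes "finite S" "D_Sigma_pred P" "D_Sigma_pred P'" "box_on S (\<lambda>e. P e \<or> P' e) e"
  shows "box_on S P e \<or> box_on S P' e"
  using assms(1,4)
proof (induction S arbitrary: e rule: finite_induct)
  case (insert i S)
  have "interval_at i (box_on S (\<lambda>e. P e \<or> P' e)) e"
    by (rule interval_at_box_on_of_insert[OF insert.prems insert.hyps(2)])
  hence "interval_at i (\<lambda>e. box_on S P e \<or> box_on S P' e) e" by (rule interval_at_mono) (rule insert.IH)
  hence "interval_at i (box_on S P) e \<or> interval_at i (box_on S P') e"
    by (rule interval_at_disj[OF D_Sigma_pred_box_on[OF insert.hyps(1) assms(2)]])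
  thus ?case using insert.hyps assms(2,3) by (simp add: box_on_insert)
qed (simp add: box_on_empty)

lemma D_Sigma_pred_bex:
  "finite J \<Longrightarrow> (\<And>j. j \<in> J \<Longrightarrow> D_Sigma_pred (P j)) \<Longrightarrow> D_Sigma_pred (\<lambda>e. \<exists>j\<in>J. P j e)"
  by (induction J rule: finite_induct)
     (simp_all add: D_Sigma_pred_disj D_Sigma_pred_of_closed definable_pred_const)

lemma box_on_bex:
  assumes "finite J" "\<And>j. j \<in> J \<Longrightarrow> D_Sigma_pred (P j)" "finite S" "box_on S (\<lambda>e. \<exists>j\<in>J. P j e) e"
  shows "\<exists>j\<in>J. box_on S (P j) e"
  using assms(1,2,4)
proof (induction J rule: finite_induct)
  case empty
  thus ?case by (auto elim: box_on_nonempty)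
next
  case (insert k J)
  have "box_on S (\<lambda>e. P k e \<or> (\<exists>j\<in>J. P j e)) e" using insert.prems by simp
  hence "box_on S (P k) e \<or> box_on S (\<lambda>e. \<exists>j\<in>J. P j e) e"
    using insert.prems insert.hyps by (intro box_on_disj assms(3) D_Sigma_pred_bex) auto
  thus ?case using insert by auto
qed

end

definition dense_in_box ::
  "nat set \<Rightarrow> ((nat \<Rightarrow> 'a::linorder) \<Rightarrow> bool) \<Rightarrow> (nat \<Rightarrow> 'a) \<Rightarrow> (nat \<Rightarrow> 'a) \<Rightarrow> (nat \<Rightarrow> 'a) \<Rightarrow> bool" where
  "dense_in_box S P e a b \<longleftrightarrow> (\<forall>a' b'. (\<forall>i\<in>S. a i \<le> a' i \<and> a' i < b' i \<and> b' i \<le> b i) \<longrightarrow>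
     (\<exists>z. in_box S a' b' z \<and> P (override_on e z S)))"

lemma box_on_of_not_dense_in_box:
  assumes "\<not> dense_in_box S P e a b"
  shows "box_on S (\<lambda>e. \<not> P e \<and> in_box S a b e) e"
proof -
  obtain a' b' where a'b': "\<forall>i\<in>S. a i \<le> a' i \<and> a' i < b' i \<and> b' i \<le> b i"
    "\<forall>z. in_box S a' b' z \<longrightarrow> \<not> P (override_on e z S)"
    using assms unfolding dense_in_box_def by blast
  have "in_box S a b (override_on e z S)" if "in_box S a' b' z" for z
    using that a'b'(1) by (auto intro: le_less_trans less_le_trans)
  thus ?thesis unfolding box_on_def using a'b' by blast
qed

lemma dense_between_of_dense_in_box:
  fixes P :: "(nat \<Rightarrow> 'a::{linorder_topology, unbounded_dense_linorder}) \<Rightarrow> bool"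
  assumes "dense_in_box (insert i S) P e a b" "i \<notin> S"
    and sub: "\<forall>j\<in>S. a j \<le> a' j \<and> a' j < b' j \<and> b' j \<le> b j"
  shows "dense_between (\<lambda>y. \<exists>z. in_box S a' b' z \<and> P (override_on (e(i := y)) z S)) (a i) (b i)"
  unfolding dense_between_iff
proof (intro allI impI)
  fix c d assume cd: "a i \<le> c \<and> c < d \<and> d \<le> b i"
  hence "\<forall>j\<in>insert i S. a j \<le> (a'(i := c)) j \<and> (a'(i := c)) j < (b'(i := d)) j \<and> (b'(i := d)) j \<le> b j"
    using sub by simp
  then obtain z where z: "in_box (insert i S) (a'(i := c)) (b'(i := d)) z" "P (override_on e z (insert i S))"
    using assms(1) unfolding dense_in_box_def by blast
  have "in_box S a' b' z" using z(1) assms(2) by (auto split: if_splits)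
  moreover have "P (override_on (e(i := z i)) z S)" using z(2) by (simp only: override_on_insert')
  moreover have "c < z i" "z i < d" using z(1) by auto
  ultimately show "\<exists>y. c < y \<and> y < d \<and> (\<exists>z. in_box S a' b' z \<and> P (override_on (e(i := y)) z S))"
    by blast
qed

context definably_complete_expansion
begin

lemma D_Sigma_pred_closed_box:
  assumes "finite S"
  shows "D_Sigma_pred (\<lambda>e. \<forall>j\<in>S. l j \<le> e j \<and> e j \<le> h j)"
proof (rule D_Sigma_pred_of_closed)
  show "definable_pred (\<lambda>e. \<forall>j\<in>S. l j \<le> e j \<and> e j \<le> h j)"
    by (intro definable_pred_ball_finite assms definable_intros)
  show "closed {e. \<forall>j\<in>S. l j \<le> e j \<and> e j \<le> h j}"
    unfolding Ball_def
    by (intro closed_Collect_all closed_Collect_imp open_Collect_const closed_Collect_conj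
        closed_Collect_le continuous_intros continuous_on_product_coordinates)
qed

end

context restrained_expansion
begin

lemma interval_meets_of_dense_in_box:
  assumes P: "D_Sigma_pred P" and S: "finite S" "i \<notin> S"
    and "dense_in_box (insert i S) P e a b"
    and "\<forall>j\<in>S. a j \<le> l j \<and> l j < h j \<and> h j \<le> b j" and "a i \<le> c" "c < d" "d \<le> b i"
  obtains c' d' where "c \<le> c'" "c' < d'" "d' \<le> d" "\<forall>y. c' < y \<and> y < d' \<longrightarrow>
    ex_on S (\<lambda>e. P e \<and> (\<forall>j\<in>S. l j \<le> e j \<and> e j \<le> h j)) (e(i := y))"
proof -
  let ?meets = "ex_on S (\<lambda>e. P e \<and> (\<forall>j\<in>S. l j \<le> e j \<and> e j \<le> h j))"
  have "D_Sigma_pred ?meets"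
    by (intro D_Sigma_pred_ex_on D_Sigma_pred_conj D_Sigma_pred_closed_box P S)
  moreover have "dense_between (\<lambda>y. ?meets (e(i := y))) c d"
  proof (rule dense_between_mono[OF dense_between_of_dense_in_box[OF assms(4) S(2) assms(5)]])
    show "a i \<le> c" "d \<le> b i" by fact+
    fix y assume "\<exists>z. in_box S l h z \<and> P (override_on (e(i := y)) z S)"
    then obtain z where "in_box S l h z" "P (override_on (e(i := y)) z S)" by blast
    thus "?meets (e(i := y))" unfolding ex_on_def by (intro exI[of _ z]) (simp add: less_imp_le)
  qed
  ultimately show thesis by (rule D_Sigma_pred_contains_interval[OF _ \<open>c < d\<close>]) (rule that)
qed

text \<open>
  If the fibers over an interval were not dense in the box, they would all miss a common smaller box,
  in which the predicate is nevertheless dense.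
\<close>

lemma dense_between_box_on_of_dense_in_box:
  assumes P: "D_Sigma_pred P" and S: "finite S" "i \<notin> S" and dense_P: "dense_in_box (insert i S) P e a b"
    and fiber: "\<And>y. dense_in_box S P (e(i := y)) a b \<Longrightarrow> box_on S P (e(i := y))"
  shows "dense_between (\<lambda>y. box_on S P (e(i := y))) (a i) (b i)"
proof (rule ccontr)
  assume "\<not> ?thesis"
  then obtain c d where cd: "a i \<le> c" "c < d" "d \<le> b i"
    "\<And>y. c < y \<Longrightarrow> y < d \<Longrightarrow> \<not> box_on S P (e(i := y))" by (rule not_dense_betweenE) blast
  let ?avoids = "\<lambda>e. \<not> P e \<and> in_box S a b e"
  have "definable_pred ?avoids"
    by (intro definable_intros definable_pred_of_D_Sigma P definable_pred_ball_finite S)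
  moreover have "box_on S ?avoids (e(i := y))" if "c < y" "y < d" for y
    using cd(4)[OF that] fiber box_on_of_not_dense_in_box by blast
  hence "dense_between (\<lambda>y. box_on S ?avoids (e(i := y))) c d" by (rule dense_between_all)
  ultimately obtain lo hi c1 d1 where lohi: "\<forall>j\<in>S. lo j < hi j"
    and c1d1: "c \<le> c1" "c1 < d1" "d1 \<le> d" and
    avoids: "dense_between (\<lambda>y. \<forall>z. in_box S lo hi z \<longrightarrow> ?avoids (override_on (e(i := y)) z S)) c1 d1"
    using uniform_box[OF S(1) _ cd(2), of ?avoids e i] by blast
  obtain l h where l: "in_box S lo hi l" and h: "in_box S lo hi h" and lh: "\<forall>j\<in>S. l j < h j"
    by (rule in_box_nested[OF lohi])
  obtain y0 where "\<forall>z. in_box S lo hi z \<longrightarrow> ?avoids (override_on (e(i := y0)) z S)"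
    by (rule dense_betweenD[OF avoids order_refl c1d1(2) order_refl])
  hence "?avoids (override_on (e(i := y0)) l S)" "?avoids (override_on (e(i := y0)) h S)"
    using l h by blast+
  hence inside: "\<forall>j\<in>S. a j \<le> l j \<and> l j < h j \<and> h j \<le> b j" using lh by (simp add: less_imp_le)
  have "a i \<le> c1" "d1 \<le> b i" using cd c1d1 by linarith+
  then obtain c2 d2 where c2d2: "c1 \<le> c2" "c2 < d2" "d2 \<le> d1"
    and meets: "\<forall>y. c2 < y \<and> y < d2 \<longrightarrow>
      ex_on S (\<lambda>e. P e \<and> (\<forall>j\<in>S. l j \<le> e j \<and> e j \<le> h j)) (e(i := y))"
    using interval_meets_of_dense_in_box[OF P S dense_P inside _ c1d1(2)] by blast
  obtain y where y: "c2 < y" "y < d2"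
    and missed: "\<forall>z. in_box S lo hi z \<longrightarrow> ?avoids (override_on (e(i := y)) z S)"
    by (rule dense_betweenD[OF avoids c2d2])
  obtain z where z: "P (override_on (e(i := y)) z S)" "\<forall>j\<in>S. l j \<le> z j \<and> z j \<le> h j"
    using meets y unfolding ex_on_def by auto
  have "in_box S lo hi z" using z(2) l h by (meson le_less_trans less_le_trans)
  thus False using missed z(1) by blast
qed

lemma box_on_of_dense_in_box:
  assumes P: "D_Sigma_pred P" and "finite S" "\<forall>i\<in>S. a i < b i" "dense_in_box S P e a b"
  shows "box_on S P e"
  using assms(2-)
proof (induction S arbitrary: e rule: finite_induct)
  case empty
  thus ?case by (simp add: dense_in_box_def box_on_def)
next
  case (insert i S)
  have "dense_between (\<lambda>y. box_on S P (e(i := y))) (a i) (b i)"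
    by (rule dense_between_box_on_of_dense_in_box[OF P insert.hyps insert.prems(2)])
       (use insert.IH insert.prems(1) in simp)
  hence "interval_at i (box_on S P) e"
    using insert.prems(1) by (intro interval_at_of_dense[OF D_Sigma_pred_box_on[OF insert.hyps(1) P]]) auto
  thus ?case by (simp add: box_on_insert[OF P insert.hyps])
qed

end

section \<open>Exchanging quantifiers\<close>

context definably_complete_expansion
begin

lemma definable_intermediate_value:
  assumes f: "definable_term (\<lambda>e. f (e 0))" and cont: "continuous_on {a..b} f" and "a \<le> b"
    and z: "min (f a) (f b) \<le> z" "z \<le> max (f a) (f b)"
  obtains y where "a \<le> y" "y \<le> b" "f y = z"
proof -
  let ?below = "\<lambda>y. a \<le> y \<and> y \<le> b \<and> f y \<le> z" and ?above = "\<lambda>y. a \<le> y \<and> y \<le> b \<and> z \<le> f y"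
  have "{y. ?below y} = {a..b} \<inter> f -` {..z}" "{y. ?above y} = {a..b} \<inter> f -` {z..}" by auto
  hence closed: "closed {y. ?below y}" "closed {y. ?above y}"
    using continuous_closed_preimage[OF cont] by auto
  have definable: "definable_unary ?below" "definable_unary ?above"
    by (intro definable_term_subst1[OF f] definable_intros)+
  have "\<exists>y. ?below y \<and> ?above y"
  proof (cases "f a \<le> f b")
    case True
    hence ends: "?below a" "?above b" using z \<open>a \<le> b\<close> by auto
    have cover: "?below y \<or> ?above y" if "a \<le> y" "y \<le> b" for y using that by auto
    obtain y where "?below y" "?above y"
      by (rule definably_connected_Icc[OF definable(1) closed(1) definable(2) closed(2) cover \<open>a \<le> b\<close> ends])
    thus ?thesis by blast
  next
    case False
    hence ends: "?above a" "?below b" using z \<open>a \<le> b\<close> by auto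
    have cover: "?above y \<or> ?below y" if "a \<le> y" "y \<le> b" for y using that by auto
    obtain y where "?above y" "?below y"
      by (rule definably_connected_Icc[OF definable(2) closed(2) definable(1) closed(1) cover \<open>a \<le> b\<close> ends])
    thus ?thesis by blast
  qed
  thus thesis using that by (meson order.antisym)
qed

lemma continuous_constant_or_onto_interval:
  assumes f: "definable_term (\<lambda>e. f (e 0))" and cont: "continuous_on {c<..<d} f"
  shows "(\<exists>x. \<forall>y. c < y \<and> y < d \<longrightarrow> f y = x) \<or>
    (\<exists>u v. u < v \<and> (\<forall>x. u < x \<and> x < v \<longrightarrow> (\<exists>y. c < y \<and> y < d \<and> f y = x)))"
proof (cases "\<exists>a b. c < a \<and> a < b \<and> b < d \<and> f a \<noteq> f b")
  case True
  then obtain a b where ab: "c < a" "a < b" "b < d" "f a \<noteq> f b" by blast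
  have cont_ab: "continuous_on {a..b} f" by (rule continuous_on_subset[OF cont]) (use ab in auto)
  have "\<exists>y. c < y \<and> y < d \<and> f y = x" if x: "min (f a) (f b) < x" "x < max (f a) (f b)" for x
  proof -
    obtain y where "a \<le> y" "y \<le> b" "f y = x"
      by (rule definable_intermediate_value[OF f cont_ab less_imp_le[OF ab(2)] x[THEN less_imp_le]])
    thus ?thesis using ab(1,3) by (intro exI[of _ y]) auto
  qed
  moreover have "min (f a) (f b) < max (f a) (f b)" using ab(4) by auto
  ultimately show ?thesis by blast
next
  case False
  hence "f y = f y'" if "c < y" "y < d" "c < y'" "y' < d" for y y' using that by (metis linorder_cases)
  thus ?thesis by metis
qed

lemma definable_least_function:
  assumes B: "definable_binary B"
  obtains f where "definable_term (\<lambda>e. f (e 0))" "\<forall>y m. is_least (\<lambda>x. B x y) m \<longrightarrow> f y = m"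
proof -
  define f where "f = (\<lambda>y. if \<exists>m. is_least (\<lambda>x. B x y) m then THE m. is_least (\<lambda>x. B x y) m else 0)"
  have unique: "m = m'" if "is_least (\<lambda>x. B x y) m" "is_least (\<lambda>x. B x y) m'" for y m m'
    using that unfolding is_least_def by (meson order.antisym)
  have f_eq: "f y = m" if "is_least (\<lambda>x. B x y) m" for y m
    unfolding f_def using that unique by (auto intro!: the_equality)
  have "is_least (\<lambda>x. B x y) x \<or> (\<not> (\<exists>m. is_least (\<lambda>x. B x y) m) \<and> x = 0) \<longleftrightarrow> x = f y" for x y
    using f_eq unfolding f_def by metis
  moreover have "definable_pred (\<lambda>e. is_least (\<lambda>x. B x (e 1)) (e 0) \<or>
      (\<not> (\<exists>m. is_least (\<lambda>x. B x (e 1)) m) \<and> e 0 = 0))"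
    unfolding is_least_def by (intro definable_pred_subst2[OF B] definable_intros)
  ultimately have "definable_term (\<lambda>e. f (e 0))" unfolding definable_term_def by simp
  thus thesis using that f_eq by blast
qed

end

definition oscillates :: "('a::linordered_field \<Rightarrow> 'a) \<Rightarrow> 'a \<Rightarrow> 'a \<Rightarrow> 'a \<Rightarrow> 'a \<Rightarrow> bool" where
  "oscillates f a b \<epsilon> y \<longleftrightarrow> (\<forall>u v. a \<le> u \<and> u < y \<and> y < v \<and> v \<le> b \<longrightarrow>
     (\<exists>y' y''. u < y' \<and> y' < v \<and> u < y'' \<and> y'' < v \<and> f y' + \<epsilon> \<le> f y''))"

lemma oscillates_antimono:
  assumes "oscillates f a b \<epsilon> y" "\<delta> \<le> \<epsilon>"
  shows "oscillates f a b \<delta> y"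
proof -
  have "f y' + \<delta> \<le> f y''" if "f y' + \<epsilon> \<le> f y''" for y' y'' using that assms(2) by linarith
  thus ?thesis using assms(1) unfolding oscillates_def by meson
qed

context restrained_expansion
begin

lemma lsc_small_oscillation:
  assumes f: "definable_term (\<lambda>e. f (e 0))" and lsc: "\<And>s. open {y. a < y \<and> y < b \<and> s < f y}"
    and bounds: "\<And>y. a < y \<Longrightarrow> y < b \<Longrightarrow> \<alpha> \<le> f y \<and> f y \<le> \<beta>"
    and cd: "a \<le> c" "c < d" "d \<le> b" and "\<epsilon> > 0"
  obtains c' d' where "c \<le> c'" "c' < d'" "d' \<le> d"
    "\<forall>y y'. c' < y \<and> y < d' \<and> c' < y' \<and> y' < d' \<longrightarrow> f y' < f y + \<epsilon>"
proof -
  define \<delta> where "\<delta> = \<epsilon> / 2"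
  have \<delta>: "\<delta> > 0" "\<epsilon> = \<delta> + \<delta>" using \<open>\<epsilon> > 0\<close> by (auto simp: \<delta>_def)
  have "definable_binary (\<lambda>u y. u = f y)" using f by (simp add: definable_term_def)
  moreover note \<delta>(1) cd(2)
  moreover have "dense_between (\<lambda>y. \<exists>u. \<alpha> \<le> u \<and> u \<le> \<beta> \<and> u = f y) c d"
    by (rule dense_between_all) (use bounds cd in auto)
  ultimately obtain w c1 d1 where c1d1: "c \<le> c1" "c1 < d1" "d1 \<le> d"
    and near_w: "dense_between (\<lambda>y. \<exists>u. w \<le> u \<and> u \<le> w + \<delta> \<and> u = f y) c1 d1"
    by (rule uniform_selection)
  have upper: "f y \<le> w + \<delta>" if y: "c1 < y" "y < d1" for y
  proof (rule ccontr)
    assume "\<not> f y \<le> w + \<delta>"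
    hence above: "y \<in> {y. a < y \<and> y < b \<and> w + \<delta> < f y}" using y c1d1 cd by auto
    have "y \<in> closure {y. \<exists>u. w \<le> u \<and> u \<le> w + \<delta> \<and> u = f y}"
      using near_w y by (auto simp: dense_between_def)
    from closure_meets_open[OF this lsc above] show False by force
  qed
  obtain y0 where y0: "c1 < y0" "y0 < d1" "w \<le> f y0"
    using dense_betweenD[OF near_w order_refl c1d1(2) order_refl] by blast
  let ?U = "{c1<..<d1} \<inter> {y. a < y \<and> y < b \<and> w - \<delta> < f y}"
  have "open ?U" using lsc by (intro open_Int open_greaterThanLessThan)
  moreover have "y0 \<in> ?U" using y0 c1d1 cd \<delta>(1) by auto
  ultimately obtain c' d' where c'd': "c' < y0" "y0 < d'" "{c'<..<d'} \<subseteq> ?U"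
    by (rule open_contains_interval)
  have "c1 \<le> c'" "d' \<le> d1"
    using c'd' greaterThanLessThan_subseteq_greaterThanLessThan[of c' d' c1 d1] by auto
  moreover have "f y' < f y + \<epsilon>" if "c' < y" "y < d'" "c' < y'" "y' < d'" for y y'
  proof -
    have "w - \<delta> < f y" "f y' \<le> w + \<delta>" using c'd'(3) that upper by auto
    thus ?thesis using \<delta>(2) by linarith
  qed
  ultimately show thesis using that[of c' d'] c1d1 c'd' by auto
qed

lemma lsc_not_oscillating:
  assumes f: "definable_term (\<lambda>e. f (e 0))" and lsc: "\<And>s. open {y. a < y \<and> y < b \<and> s < f y}"
    and bounds: "\<And>y. a < y \<Longrightarrow> y < b \<Longrightarrow> \<alpha> \<le> f y \<and> f y \<le> \<beta>" and "a < b"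
  obtains c d where "a \<le> c" "c < d" "d \<le> b"
    "\<forall>y \<epsilon>. c < y \<and> y < d \<and> 0 < \<epsilon> \<longrightarrow> \<not> oscillates f a b \<epsilon> y"
proof -
  define D where "D = (\<lambda>t y. 0 < t \<and> oscillates f a b (1 / t) y)"
  have "\<not> dense_between (\<lambda>y. \<exists>t. D t y) a b"
  proof
    have "definable_binary D"
      unfolding D_def oscillates_def by (intro definable_term_subst1[OF f] definable_intros)
    moreover have "mono D"
    proof (intro monoI predicate1I)
      fix s t y assume "s \<le> t" "D s y"
      moreover from this have "1 / t \<le> 1 / s" by (simp add: D_def frac_le)
      ultimately show "D t y" unfolding D_def by (meson oscillates_antimono less_le_trans)
    qed
    moreover note \<open>a < b\<close>
    moreover assume "dense_between (\<lambda>y. \<exists>t. D t y) a b"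
    ultimately obtain t c d where cd: "a \<le> c" "c < d" "d \<le> b" and Dt: "dense_between (D t) c d"
      by (rule baire)
    have "t > 0" by (rule dense_betweenD[OF Dt order_refl cd(2) order_refl]) (simp add: D_def)
    hence "1 / t > 0" by simp
    obtain c' d' where c'd': "c \<le> c'" "c' < d'" "d' \<le> d"
      "\<forall>y y'. c' < y \<and> y < d' \<and> c' < y' \<and> y' < d' \<longrightarrow> f y' < f y + 1 / t"
      by (rule lsc_small_oscillation[OF f lsc _ cd \<open>1 / t > 0\<close>]) (rule bounds)
    obtain y where "c' < y" "y < d'" "D t y" by (rule dense_betweenD[OF Dt c'd'(1-3)])
    moreover have "a \<le> c'" "d' \<le> b" using cd c'd' by linarith+
    ultimately obtain y' y'' where "c' < y'" "y' < d'" "c' < y''" "y'' < d'" "f y' + 1 / t \<le> f y''"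
      unfolding D_def oscillates_def by blast
    thus False using c'd'(4) by (meson not_le)
  qed
  then obtain c d where cd: "a \<le> c" "c < d" "d \<le> b" "\<And>y. c < y \<Longrightarrow> y < d \<Longrightarrow> \<not> (\<exists>t. D t y)"
    by (rule not_dense_betweenE) blast
  have "\<not> oscillates f a b \<epsilon> y" if "c < y" "y < d" "0 < \<epsilon>" for y \<epsilon>
  proof -
    have "\<not> D (1 / \<epsilon>) y" using cd(4) that by blast
    thus ?thesis using that(3) by (simp add: D_def)
  qed
  thus thesis using that cd(1-3) by blast
qed

lemma lsc_continuous_on_interval:
  assumes f: "definable_term (\<lambda>e. f (e 0))" and lsc: "\<And>s. open {y. a < y \<and> y < b \<and> s < f y}"
    and bounds: "\<And>y. a < y \<Longrightarrow> y < b \<Longrightarrow> \<alpha> \<le> f y \<and> f y \<le> \<beta>" and "a < b"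
  obtains c d where "a \<le> c" "c < d" "d \<le> b" "continuous_on {c<..<d} f"
proof -
  obtain c d where cd: "a \<le> c" "c < d" "d \<le> b"
    and tame: "\<forall>y \<epsilon>. c < y \<and> y < d \<and> 0 < \<epsilon> \<longrightarrow> \<not> oscillates f a b \<epsilon> y"
    by (rule lsc_not_oscillating[OF f lsc _ \<open>a < b\<close>]) (rule bounds)
  have "(f \<longlongrightarrow> f y) (at y within {c<..<d})" if y: "y \<in> {c<..<d}" for y
  proof (rule order_tendstoI)
    fix s
    have "a < y" "y < b" using y cd by auto
    thus "\<forall>\<^sub>F y' in at y within {c<..<d}. s < f y'" if "s < f y"
      unfolding eventually_at_topological using lsc[of s] that by blast
    assume "f y < s"
    hence "\<not> oscillates f a b (s - f y) y" using tame y by simp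
    then obtain u v where "u < y" "y < v"
      "\<forall>y' y''. u < y' \<and> y' < v \<and> u < y'' \<and> y'' < v \<longrightarrow> \<not> f y' + (s - f y) \<le> f y''"
      unfolding oscillates_def by auto
    hence "\<forall>y'\<in>{u<..<v}. f y' < s" "open {u<..<v}" "y \<in> {u<..<v}" by fastforce+
    thus "\<forall>\<^sub>F y' in at y within {c<..<d}. f y' < s" unfolding eventually_at_topological by blast
  qed
  thus thesis using that cd by (auto simp: continuous_on_def)
qed

text \<open>The least admissible value is a lower semicontinuous selection.\<close>

lemma definable_continuous_selection:
  assumes B: "definable_binary B" "\<And>y. closed {x. B x y}" "\<And>s. closed {y. \<exists>x\<le>s. B x y}"
    and bounds: "\<And>x y. B x y \<Longrightarrow> \<alpha> \<le> x \<and> x \<le> \<beta>"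
    and "a < b" and ex: "\<And>y. a < y \<Longrightarrow> y < b \<Longrightarrow> \<exists>x. B x y"
  obtains f c d where "definable_term (\<lambda>e. f (e 0))" "c < d" "continuous_on {c<..<d} f"
    "\<forall>y. c < y \<and> y < d \<longrightarrow> B (f y) y"
proof -
  obtain f where f: "definable_term (\<lambda>e. f (e 0))" "\<forall>y m. is_least (\<lambda>x. B x y) m \<longrightarrow> f y = m"
    by (rule definable_least_function[OF B(1)])
  have least: "is_least (\<lambda>x. B x y) (f y)" if y: "a < y" "y < b" for y
  proof -
    obtain x where "B x y" using ex[OF y] by blast
    moreover have "definable_unary (\<lambda>x. B x y)"
      by (intro definable_pred_subst2[OF B(1)] definable_intros)
    ultimately obtain m where "is_least (\<lambda>x. B x y) m"
      using closed_has_least[of "\<lambda>x. B x y" x \<alpha>] bounds B(2) by blast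
    thus ?thesis using f(2) by metis
  qed
  have Bf: "B (f y) y" if "a < y" "y < b" for y using least[OF that] by (simp add: is_least_def)
  have "open {y. a < y \<and> y < b \<and> s < f y}" for s
  proof -
    have "s < f y \<longleftrightarrow> \<not> (\<exists>x\<le>s. B x y)" if "a < y" "y < b" for y
      using least[OF that] unfolding is_least_def by (meson not_le order_trans)
    hence "{y. a < y \<and> y < b \<and> s < f y} = {a<..<b} \<inter> - {y. \<exists>x\<le>s. B x y}" by auto
    thus ?thesis using B(3)[of s] by (simp add: open_Int open_Compl)
  qed
  moreover have "\<alpha> \<le> f y \<and> f y \<le> \<beta>" if "a < y" "y < b" for y by (rule bounds[OF Bf[OF that]])
  ultimately obtain c d where cd: "a \<le> c" "c < d" "d \<le> b" "continuous_on {c<..<d} f"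
    using \<open>a < b\<close> by (rule lsc_continuous_on_interval[OF f(1)])
  have "\<forall>y. c < y \<and> y < d \<longrightarrow> B (f y) y" using Bf cd(1,3) by auto
  thus thesis by (rule that[OF f(1) cd(2,4)])
qed

lemma D_Sigma_pred_continuous_selection:
  assumes P: "D_Sigma_pred P" and "interval_at v (ex_at j P) e"
  obtains f c d where "definable_term (\<lambda>e. f (e 0))" "c < d" "continuous_on {c<..<d} f"
    "\<forall>y. c < y \<and> y < d \<longrightarrow> P (e(v := y, j := f y))"
proof -
  obtain Q where Q: "D_Sigma_family Q" "P = (\<lambda>e. \<exists>t. Q t e)"
    using P unfolding D_Sigma_pred_def by blast
  note ex_family = D_Sigma_family_ex_between[OF Q(1), of j]
  obtain a b where ab: "a < b" "\<And>y. a < y \<Longrightarrow> y < b \<Longrightarrow> ex_at j P (e(v := y))"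
    using assms(2) unfolding interval_at_def by blast
  have "dense_between (\<lambda>y. \<exists>t x. - t \<le> x \<and> x \<le> t \<and> Q t (e(v := y, j := x))) a b"
    using ab(2) unfolding Q(2) ex_family(2) by (rule dense_between_all)
  then obtain t a' b' where "a' < b'"
    and ex_B: "\<forall>y. a' < y \<and> y < b' \<longrightarrow> (\<exists>x. - t \<le> x \<and> x \<le> t \<and> Q t (e(v := y, j := x)))"
    by (rule family_contains_interval[OF ex_family(1) ab(1)])
  define B where "B = (\<lambda>x y. - t \<le> x \<and> x \<le> t \<and> Q t (e(v := y, j := x)))"
  have "definable_binary B" unfolding B_def by (intro definable_pred_family[OF Q(1)] definable_intros)
  moreover have "closed {x. B x y}" for y
    unfolding B_def
    by (intro closed_Collect_conj closed_Collect_le continuous_intros D_Sigma_family_slice(3)[OF Q(1)])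
  moreover have "closed {y. \<exists>x\<le>s. B x y}" for s
  proof -
    have "closed {e. \<exists>x. - t \<le> x \<and> x \<le> min s t \<and> Q t (e(j := x))}"
      by (intro closed_ex_between D_Sigma_familyD(1)[OF Q(1)] definable_pred_family[OF Q(1)] definable_intros)
    hence "closed {y. \<exists>x. - t \<le> x \<and> x \<le> min s t \<and> Q t (e(v := y, j := x))}"
      by (rule closed_Collect_compose) (intro continuous_on_fun_upd continuous_intros)
    moreover have "(\<exists>x\<le>s. B x y) \<longleftrightarrow> (\<exists>x. - t \<le> x \<and> x \<le> min s t \<and> Q t (e(v := y, j := x)))" for y
      unfolding B_def by auto
    ultimately show ?thesis by simp
  qed
  moreover have "- t \<le> x \<and> x \<le> t" if "B x y" for x y using that by (simp add: B_def)
  moreover note \<open>a' < b'\<close>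
  moreover have "\<exists>x. B x y" if "a' < y" "y < b'" for y using that ex_B by (simp add: B_def)
  ultimately obtain f c d where f: "definable_term (\<lambda>e. f (e 0))" "c < d" "continuous_on {c<..<d} f"
    and "\<forall>y. c < y \<and> y < d \<longrightarrow> B (f y) y"
    by (rule definable_continuous_selection)
  hence "\<forall>y. c < y \<and> y < d \<longrightarrow> P (e(v := y, j := f y))" unfolding B_def Q(2) by blast
  thus thesis by (rule that[OF f])
qed

lemma interval_at_ex_at:
  assumes "D_Sigma_pred P" and "j \<noteq> v" and "interval_at v (ex_at j P) e"
  shows "ex_at j (interval_at v P) e \<or> interval_at j (ex_at v P) e"
proof -
  obtain f c d where f: "definable_term (\<lambda>e. f (e 0))" "continuous_on {c<..<d} f" and "c < d"
    and "\<forall>y. c < y \<and> y < d \<longrightarrow> P (e(v := y, j := f y))"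
    by (rule D_Sigma_pred_continuous_selection[OF assms(1,3)])
  hence Pf: "P (e(j := f y, v := y))" if "c < y" "y < d" for y
    using that fun_upd_twist[OF \<open>j \<noteq> v\<close>] by metis
  from continuous_constant_or_onto_interval[OF f] show ?thesis
  proof (elim disjE exE conjE)
    fix x assume "\<forall>y. c < y \<and> y < d \<longrightarrow> f y = x"
    hence "interval_at v P (e(j := x))" using Pf \<open>c < d\<close> unfolding interval_at_def by metis
    thus ?thesis unfolding ex_at_def by blast
  next
    fix u w assume "u < w" "\<forall>x. u < x \<and> x < w \<longrightarrow> (\<exists>y. c < y \<and> y < d \<and> f y = x)"
    hence "interval_at j (ex_at v P) e" using Pf unfolding interval_at_def ex_at_def by metis
    thus ?thesis by blast
  qed
qed

lemma interval_at_ex_on: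
  assumes "D_Sigma_pred P" "finite J" "v \<notin> J" "interval_at v (ex_on J P) e"
  shows "ex_on J (interval_at v P) e \<or> (\<exists>j\<in>J. interval_at j (ex_on (J - {j}) (ex_at v P)) e)"
  using assms(2-)
proof (induction J arbitrary: e rule: finite_induct)
  case empty
  thus ?case by (simp add: ex_on_empty)
next
  case (insert j J)
  have jv: "j \<noteq> v" "v \<notin> J" using insert.prems by auto
  from insert.prems(2) have "interval_at v (ex_at j (ex_on J P)) e" by (simp add: ex_on_insert)
  hence "ex_at j (interval_at v (ex_on J P)) e \<or> interval_at j (ex_at v (ex_on J P)) e"
    by (rule interval_at_ex_at[OF D_Sigma_pred_ex_on[OF insert.hyps(1) assms(1)] jv(1)])
  thus ?case
  proof
    assume "interval_at j (ex_at v (ex_on J P)) e"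
    moreover have "ex_at v (ex_on J P) = ex_on J (ex_at v P)"
      by (metis ex_on_insert ex_on_insert_right)
    ultimately show ?thesis using insert.hyps by auto
  next
    assume "ex_at j (interval_at v (ex_on J P)) e"
    then obtain x where "interval_at v (ex_on J P) (e(j := x))" unfolding ex_at_def by blast
    from insert.IH[OF jv(2) this] show ?thesis
    proof
      assume "ex_on J (interval_at v P) (e(j := x))"
      thus ?thesis unfolding ex_on_insert ex_at_def by blast
    next
      assume "\<exists>k\<in>J. interval_at k (ex_on (J - {k}) (ex_at v P)) (e(j := x))"
      then obtain k where k: "k \<in> J" "ex_on {j} (box_on {k} (ex_on (J - {k}) (ex_at v P))) e"
        unfolding ex_on_singleton box_on_singleton ex_at_def[of j] by blast
      have "j \<noteq> k" using k insert.hyps by auto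
      hence "box_on {k} (ex_on {j} (ex_on (J - {k}) (ex_at v P))) e"
        by (intro box_on_ex_on_commute[OF k(2)]) simp
      moreover have "insert j J - {k} = {j} \<union> (J - {k})" using \<open>j \<noteq> k\<close> by auto
      ultimately have "interval_at k (ex_on (insert j J - {k}) (ex_at v P)) e"
        by (simp only: ex_on_Un box_on_singleton)
      thus ?thesis using k by blast
    qed
  qed
qed

end

section \<open>The dimension of a predicate\<close>

lemma ex_on_override_iff:
  assumes "S \<subseteq> V"
  shows "ex_on (V - S) P (override_on e z S) \<longleftrightarrow> (\<exists>x. (\<forall>i\<in>S. x i = z i) \<and> P (override_on e x V))"
proof
  assume "ex_on (V - S) P (override_on e z S)"
  then obtain x where "P (override_on (override_on e z S) x (V - S))" unfolding ex_on_def by blast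
  moreover have "override_on (override_on e z S) x (V - S) = override_on e (override_on x z S) V"
    using assms by (auto simp: override_on_def fun_eq_iff)
  ultimately show "\<exists>x. (\<forall>i\<in>S. x i = z i) \<and> P (override_on e x V)"
    by (intro exI[of _ "override_on x z S"]) simp
next
  assume "\<exists>x. (\<forall>i\<in>S. x i = z i) \<and> P (override_on e x V)"
  then obtain x where x: "\<forall>i\<in>S. x i = z i" "P (override_on e x V)" by blast
  have "override_on e x V = override_on (override_on e z S) x (V - S)"
    using x(1) assms by (auto simp: override_on_def fun_eq_iff)
  thus "ex_on (V - S) P (override_on e z S)" using x(2) unfolding ex_on_def by metis
qed

lemma box_on_ex_on_iff:
  assumes "S \<subseteq> V"
  shows "box_on S (ex_on (V - S) P) e \<longleftrightarrow> (\<exists>a b. (\<forall>i\<in>S. a i < b i) \<and>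
    (\<forall>z. in_box S a b z \<longrightarrow> (\<exists>x. (\<forall>i\<in>S. x i = z i) \<and> P (override_on e x V))))"
  unfolding box_on_def ex_on_override_iff[OF assms] ..

lemma box_on_subset:
  fixes P :: "(nat \<Rightarrow> 'a::dense_linorder) \<Rightarrow> bool"
  assumes "box_on S P e" "T \<subseteq> S"
  shows "box_on T (ex_on (S - T) P) e"
proof -
  obtain a b where ab: "\<forall>i\<in>S. a i < b i" "\<forall>z. in_box S a b z \<longrightarrow> P (override_on e z S)"
    using assms(1) unfolding box_on_def by blast
  obtain w where w: "in_box S a b w" by (rule in_box_nonempty[OF ab(1)])
  have "\<exists>x. (\<forall>i\<in>T. x i = z i) \<and> P (override_on e x S)" if "in_box T a b z" for z
  proof -
    have "in_box S a b (override_on w z T)" using w that by (simp add: override_on_def)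
    thus ?thesis using ab(2) by (intro exI[of _ "override_on w z T"]) simp
  qed
  thus ?thesis unfolding box_on_ex_on_iff[OF assms(2)] using ab(1) assms(2) by blast
qed

definition dim_at_least ::
  "nat set \<Rightarrow> nat \<Rightarrow> ((nat \<Rightarrow> 'a::linorder) \<Rightarrow> bool) \<Rightarrow> (nat \<Rightarrow> 'a) \<Rightarrow> bool" where
  "dim_at_least V k P e \<longleftrightarrow> (\<exists>S\<subseteq>V. card S = k \<and> box_on S (ex_on (V - S) P) e)"

lemma dim_at_leastI:
  "S \<subseteq> V \<Longrightarrow> card S = k \<Longrightarrow> box_on S (ex_on (V - S) P) e \<Longrightarrow> dim_at_least V k P e"
  unfolding dim_at_least_def by blast

lemma dim_at_least_mono:
  assumes "dim_at_least V k P e" "\<And>e. P e \<Longrightarrow> P' e"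
  shows "dim_at_least V k P' e"
proof -
  obtain S where S: "S \<subseteq> V" "card S = k" "box_on S (ex_on (V - S) P) e"
    using assms(1) unfolding dim_at_least_def by blast
  have "box_on S (ex_on (V - S) P') e"
    by (rule box_on_mono[OF S(3)]) (rule ex_on_mono, assumption, rule assms(2))
  with S(1,2) show ?thesis by (rule dim_at_leastI)
qed

lemma dim_at_least_0: "finite V \<Longrightarrow> dim_at_least V 0 P = ex_on V P"
  by (auto simp: dim_at_least_def fun_eq_iff box_on_empty dest: finite_subset)

lemma dim_at_least_empty: "dim_at_least {} k P e \<longleftrightarrow> k = 0 \<and> P e"
  by (auto simp: dim_at_least_def box_on_empty ex_on_empty)

lemma dim_at_least_antimono:
  fixes P :: "(nat \<Rightarrow> 'a::dense_linorder) \<Rightarrow> bool"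
  assumes "dim_at_least V k P e" "j \<le> k"
  shows "dim_at_least V j P e"
proof -
  obtain S where S: "S \<subseteq> V" "card S = k" "box_on S (ex_on (V - S) P) e"
    using assms(1) unfolding dim_at_least_def by blast
  obtain T where T: "T \<subseteq> S" "card T = j"
    using obtain_subset_with_card_n[of j S] S(2) assms(2) by blast
  have "box_on T (ex_on (S - T) (ex_on (V - S) P)) e" by (rule box_on_subset[OF S(3) T(1)])
  moreover have "(S - T) \<union> (V - S) = V - T" using S(1) T(1) by blast
  ultimately have "box_on T (ex_on (V - T) P) e" by (simp add: ex_on_Un[symmetric])
  thus ?thesis using S(1) T by (intro dim_at_leastI) auto
qed

lemma ex_on_of_dim_at_least:
  fixes P :: "(nat \<Rightarrow> 'a::dense_linorder) \<Rightarrow> bool"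
  assumes "finite V" "dim_at_least V k P e"
  shows "ex_on V P e"
  using dim_at_least_antimono[OF assms(2) le0] by (simp add: dim_at_least_0[OF assms(1)])

lemma not_dim_at_least_False:
  fixes e :: "nat \<Rightarrow> 'a::dense_linorder"
  shows "finite V \<Longrightarrow> \<not> dim_at_least V k (\<lambda>_. False) e"
  by (auto simp: ex_on_def dest: ex_on_of_dim_at_least)

lemma dim_at_least_pos_not_unique:
  fixes P :: "(nat \<Rightarrow> 'a::dense_linorder) \<Rightarrow> bool"
  assumes "dim_at_least V k P e" "0 < k"
  obtains x y i where "i \<in> V" "x i \<noteq> y i" "P (override_on e x V)" "P (override_on e y V)"
proof -
  obtain S where S: "S \<subseteq> V" "card S = k" "box_on S (ex_on (V - S) P) e"
    using assms(1) unfolding dim_at_least_def by blast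
  obtain a b where ab: "\<forall>i\<in>S. a i < b i"
    "\<forall>z. in_box S a b z \<longrightarrow> (\<exists>x. (\<forall>i\<in>S. x i = z i) \<and> P (override_on e x V))"
    using S(3) unfolding box_on_ex_on_iff[OF S(1)] by blast
  obtain l h where l: "in_box S a b l" and h: "in_box S a b h" and lh: "\<forall>i\<in>S. l i < h i"
    by (rule in_box_nested[OF ab(1)])
  obtain i where i: "i \<in> S" using S(2) assms(2) by fastforce
  obtain x where "\<forall>i\<in>S. x i = l i" "P (override_on e x V)" using ab(2) l by blast
  moreover obtain y where "\<forall>i\<in>S. y i = h i" "P (override_on e y V)"
    using ab(2) h by blast
  moreover have "l i \<noteq> h i" using lh i by force
  ultimately show thesis using that[of i x y] i S(1) by auto
qed

lemma dim_at_least_image_imp: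
  assumes dim: "dim_at_least V k P' e'" and "inj_on \<rho> V"
    and P: "\<And>x. P' (override_on e' (x \<circ> \<rho>) V) \<Longrightarrow> P (override_on e x (\<rho> ` V))"
    and P': "\<And>x y. (\<And>i. i \<in> V \<Longrightarrow> x i = y i) \<Longrightarrow> P' (override_on e' x V) \<Longrightarrow> P' (override_on e' y V)"
  shows "dim_at_least (\<rho> ` V) k P e"
proof -
  obtain S where S: "S \<subseteq> V" "card S = k" "box_on S (ex_on (V - S) P') e'"
    using dim unfolding dim_at_least_def by blast
  obtain a b where ab: "\<forall>i\<in>S. a i < b i" "\<forall>z. in_box S a b z \<longrightarrow>
      (\<exists>x. (\<forall>i\<in>S. x i = z i) \<and> P' (override_on e' x V))"
    using S(3) unfolding box_on_ex_on_iff[OF S(1)] by blast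
  let ?inv = "the_inv_into V \<rho>"
  have inv: "?inv (\<rho> i) = i" if "i \<in> V" for i by (rule the_inv_into_f_f[OF assms(2) that])
  have inv_S: "?inv (\<rho> i) = i" if "i \<in> S" for i using inv S(1) that by blast
  have sub: "\<rho> ` S \<subseteq> \<rho> ` V" using S(1) by (rule image_mono)
  have ex: "\<exists>x. (\<forall>i\<in>\<rho> ` S. x i = z i) \<and> P (override_on e x (\<rho> ` V))"
    if z: "in_box (\<rho> ` S) (a \<circ> ?inv) (b \<circ> ?inv) z" for z
  proof -
    have "in_box S a b (z \<circ> \<rho>)" using z by (simp add: inv_S)
    then obtain x where x: "\<forall>i\<in>S. x i = (z \<circ> \<rho>) i" "P' (override_on e' x V)" using ab(2) by blast
    have "P (override_on e (x \<circ> ?inv) (\<rho> ` V))"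
      by (rule P, rule P'[OF _ x(2)]) (simp add: inv)
    moreover have "\<forall>i\<in>\<rho> ` S. (x \<circ> ?inv) i = z i" using x(1) by (simp add: inv_S)
    ultimately show ?thesis by blast
  qed
  have less: "\<forall>i\<in>\<rho> ` S. (a \<circ> ?inv) i < (b \<circ> ?inv) i" using ab(1) by (simp add: inv_S)
  have "box_on (\<rho> ` S) (ex_on (\<rho> ` V - \<rho> ` S) P) e"
    unfolding box_on_ex_on_iff[OF sub]
    by (rule exI[of _ "a \<circ> ?inv"], rule exI[of _ "b \<circ> ?inv"]) (intro conjI allI impI less ex)
  moreover have "card (\<rho> ` S) = k"
    using S(2) card_image[OF inj_on_subset[OF assms(2) S(1)]] by simp
  ultimately show ?thesis using sub by (intro dim_at_leastI)
qed

lemma dim_at_least_image: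
  assumes inj: "inj_on \<rho> V" and P: "\<And>x. P (override_on e x (\<rho> ` V)) \<longleftrightarrow> P' (override_on e' (x \<circ> \<rho>) V)"
  shows "dim_at_least (\<rho> ` V) k P e \<longleftrightarrow> dim_at_least V k P' e'"
proof
  let ?inv = "the_inv_into V \<rho>"
  have inv: "?inv (\<rho> i) = i" if "i \<in> V" for i by (rule the_inv_into_f_f[OF inj that])
  have override_cong: "override_on e x W = override_on e y W" if "\<And>i. i \<in> W \<Longrightarrow> x i = y i"
    for e x y :: "nat \<Rightarrow> 'a" and W
    using that by (auto simp: override_on_def)
  show "dim_at_least (\<rho> ` V) k P e" if "dim_at_least V k P' e'"
    using that inj P override_cong[of V] by (elim dim_at_least_image_imp) metis+
  assume dim: "dim_at_least (\<rho> ` V) k P e"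
  have "dim_at_least (?inv ` \<rho> ` V) k P' e'"
  proof (rule dim_at_least_image_imp[OF dim inj_on_the_inv_into[OF inj]])
    fix x assume "P (override_on e (x \<circ> ?inv) (\<rho> ` V))"
    hence "P' (override_on e' (x \<circ> ?inv \<circ> \<rho>) V)" unfolding P .
    thus "P' (override_on e' x (?inv ` \<rho> ` V))"
      using override_cong[of V "x \<circ> ?inv \<circ> \<rho>" x e'] inv by (simp add: the_inv_into_onto[OF inj])
  next
    show "P (override_on e y (\<rho> ` V))"
      if "\<And>i. i \<in> \<rho> ` V \<Longrightarrow> x i = y i" "P (override_on e x (\<rho> ` V))" for x y
      using that override_cong[of "\<rho> ` V" x y e] by simp
  qed
  thus "dim_at_least V k P' e'" by (simp add: the_inv_into_onto[OF inj])
qed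

context restrained_expansion
begin

lemma D_Sigma_pred_dim_at_least:
  assumes "D_Sigma_pred P" "finite V"
  shows "D_Sigma_pred (dim_at_least V k P)"
proof -
  have "D_Sigma_pred (\<lambda>e. \<exists>S\<in>{S. S \<subseteq> V \<and> card S = k}. box_on S (ex_on (V - S) P) e)"
    using assms finite_subset[OF _ assms(2)]
    by (intro D_Sigma_pred_bex D_Sigma_pred_box_on D_Sigma_pred_ex_on) auto
  thus ?thesis unfolding dim_at_least_def[abs_def] by (simp add: conj_assoc Bex_def)
qed

lemma dim_at_least_disj:
  assumes P: "D_Sigma_pred P" "D_Sigma_pred P'" and "finite V"
  shows "dim_at_least V k (\<lambda>e. P e \<or> P' e) e \<longleftrightarrow> dim_at_least V k P e \<or> dim_at_least V k P' e"
proof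
  assume "dim_at_least V k (\<lambda>e. P e \<or> P' e) e"
  then obtain S where S: "S \<subseteq> V" "card S = k" "box_on S (ex_on (V - S) (\<lambda>e. P e \<or> P' e)) e"
    unfolding dim_at_least_def by blast
  have "finite S" "finite (V - S)" using S(1) assms(3) finite_subset by auto
  moreover have "box_on S (\<lambda>e. ex_on (V - S) P e \<or> ex_on (V - S) P' e) e"
    using S(3) by (rule box_on_mono) (auto simp: ex_on_def)
  ultimately have "box_on S (ex_on (V - S) P) e \<or> box_on S (ex_on (V - S) P') e"
    by (intro box_on_disj D_Sigma_pred_ex_on P)
  thus "dim_at_least V k P e \<or> dim_at_least V k P' e" using dim_at_leastI[OF S(1,2)] by blast
qed (auto elim: dim_at_least_mono)

lemma box_on_insert_ex_on:
  assumes P: "D_Sigma_pred P" and fin: "finite S" "finite J" and "v \<notin> S" "v \<notin> J" "S \<inter> J = {}"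
    and "box_on (insert v S) (ex_on J P) e"
  shows "box_on S (ex_on J (interval_at v P)) e \<or>
    (\<exists>j\<in>J. box_on (insert j S) (ex_on (J - {j}) (ex_at v P)) e)"
proof -
  let ?swap = "\<lambda>j. interval_at j (ex_on (J - {j}) (ex_at v P))"
  have swap: "D_Sigma_pred (?swap j)" for j
    using fin by (intro D_Sigma_pred_interval_at D_Sigma_pred_ex_on D_Sigma_pred_ex_at P) auto
  have Un_singleton: "box_on (insert i S) R = box_on S (interval_at i R)"
    if "D_Sigma_pred R" "i \<notin> S" for i R
    using box_on_Un[OF that(1), of "{i}" S] fin(1) that(2) by (simp add: box_on_singleton)
  have "box_on S (interval_at v (ex_on J P)) e"
    using assms(7) unfolding Un_singleton[OF D_Sigma_pred_ex_on[OF fin(2) P] assms(4)] .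
  hence "box_on S (\<lambda>e. ex_on J (interval_at v P) e \<or> (\<exists>j\<in>J. ?swap j e)) e"
    by (rule box_on_mono) (rule interval_at_ex_on[OF P fin(2) assms(5)])
  hence "box_on S (ex_on J (interval_at v P)) e \<or> box_on S (\<lambda>e. \<exists>j\<in>J. ?swap j e) e"
    by (rule box_on_disj[OF fin(1) D_Sigma_pred_ex_on[OF fin(2) D_Sigma_pred_interval_at[OF P]]
        D_Sigma_pred_bex[OF fin(2) swap]])
  moreover have "\<exists>j\<in>J. box_on (insert j S) (ex_on (J - {j}) (ex_at v P)) e"
    if swapped: "box_on S (\<lambda>e. \<exists>j\<in>J. ?swap j e) e"
  proof -
    obtain j where j: "j \<in> J" "box_on S (?swap j) e"
      using box_on_bex[OF fin(2) swap fin(1) swapped] by blast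
    have "D_Sigma_pred (ex_on (J - {j}) (ex_at v P))"
      using fin by (intro D_Sigma_pred_ex_on D_Sigma_pred_ex_at P) auto
    moreover have "j \<notin> S" using j(1) assms(6) by blast
    ultimately have "box_on (insert j S) (ex_on (J - {j}) (ex_at v P)) = box_on S (?swap j)"
      by (rule Un_singleton)
    thus ?thesis using j by (metis (no_types))
  qed
  ultimately show ?thesis by blast
qed

lemma dim_at_least_insertD:
  assumes P: "D_Sigma_pred P" and V: "finite V" "v \<notin> V" and dim: "dim_at_least (insert v V) k P e"
  shows "dim_at_least V k (ex_at v P) e \<or> (\<exists>l. k = Suc l \<and> dim_at_least V l (interval_at v P) e)"
proof -
  obtain S where S: "S \<subseteq> insert v V" "card S = k" "box_on S (ex_on (insert v V - S) P) e"
    using dim unfolding dim_at_least_def by blast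
  show ?thesis
  proof (cases "v \<in> S")
    case False
    hence "insert v V - S = insert v (V - S)" by blast
    hence "box_on S (ex_on (V - S) (ex_at v P)) e" using S(3) by (simp add: ex_on_insert_right)
    moreover have "S \<subseteq> V" using S(1) False by blast
    ultimately show ?thesis using S(2) by (intro disjI1 dim_at_leastI)
  next
    case True
    define T where "T = S - {v}"
    have T: "S = insert v T" "v \<notin> T" "T \<subseteq> V" "insert v V - S = V - T"
      using True S(1) V(2) by (auto simp: T_def)
    have fin: "finite T" "finite (V - T)" using T(3) V(1) finite_subset by auto
    have "box_on (insert v T) (ex_on (V - T) P) e" using S(3) unfolding T(4) unfolding T(1) .
    from box_on_insert_ex_on[OF P fin T(2) _ _ this] V(2)
    have "box_on T (ex_on (V - T) (interval_at v P)) e \<or>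
        (\<exists>j\<in>V - T. box_on (insert j T) (ex_on (V - T - {j}) (ex_at v P)) e)" by blast
    thus ?thesis
    proof (elim disjE bexE)
      assume "box_on T (ex_on (V - T) (interval_at v P)) e"
      hence "dim_at_least V (card T) (interval_at v P) e" by (rule dim_at_leastI[OF T(3) refl])
      moreover have "k = Suc (card T)" using S(2) T(1,2) fin(1) by simp
      ultimately show ?thesis by blast
    next
      fix j assume j: "j \<in> V - T" "box_on (insert j T) (ex_on (V - T - {j}) (ex_at v P)) e"
      have "V - T - {j} = V - insert j T" by blast
      moreover have "card (insert j T) = k" using S(2) T(1,2) fin(1) j(1) by simp
      ultimately have "dim_at_least V k (ex_at v P) e"
        using j T(3) by (intro dim_at_leastI[of "insert j T"]) auto
      thus ?thesis ..
    qed
  qed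
qed

lemma dim_at_least_insert_of_ex_at:
  assumes "v \<notin> V" "dim_at_least V k (ex_at v P) e"
  shows "dim_at_least (insert v V) k P e"
proof -
  obtain S where S: "S \<subseteq> V" "card S = k" "box_on S (ex_on (V - S) (ex_at v P)) e"
    using assms(2) unfolding dim_at_least_def by blast
  have "insert v V - S = insert v (V - S)" using S(1) assms(1) by blast
  hence "box_on S (ex_on (insert v V - S) P) e" using S(3) by (simp add: ex_on_insert_right)
  thus ?thesis using S(1,2) by (intro dim_at_leastI) auto
qed

lemma dim_at_least_insert_of_interval_at:
  assumes P: "D_Sigma_pred P" and V: "finite V" "v \<notin> V" and "dim_at_least V k (interval_at v P) e"
  shows "dim_at_least (insert v V) (Suc k) P e"
proof -
  obtain S where S: "S \<subseteq> V" "card S = k" "box_on S (ex_on (V - S) (interval_at v P)) e"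
    using assms(4) unfolding dim_at_least_def by blast
  have fin: "finite S" "finite (V - S)" and "v \<notin> S" using S(1) V finite_subset by auto
  have "box_on S (box_on {v} (ex_on (V - S) P)) e"
    using S(3) by (rule box_on_mono) (rule box_on_ex_on_commute, use V(2) in \<open>simp_all add: box_on_singleton\<close>)
  hence "box_on (S \<union> {v}) (ex_on (V - S) P) e"
    using box_on_Un[OF D_Sigma_pred_ex_on[OF fin(2) P], of "{v}" S] fin(1) \<open>v \<notin> S\<close> by simp
  moreover have "V - S = insert v V - (S \<union> {v})" using V(2) by blast
  ultimately show ?thesis
    using S(1,2) fin(1) \<open>v \<notin> S\<close> by (intro dim_at_leastI[of "S \<union> {v}"]) auto
qed

lemma dim_at_least_insert:
  assumes "D_Sigma_pred P" "finite V" "v \<notin> V"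
  shows "dim_at_least (insert v V) k P e \<longleftrightarrow>
    dim_at_least V k (ex_at v P) e \<or> (\<exists>l. k = Suc l \<and> dim_at_least V l (interval_at v P) e)"
  using dim_at_least_insertD[OF assms] dim_at_least_insert_of_ex_at[OF assms(3)]
    dim_at_least_insert_of_interval_at[OF assms] by blast

theorem dim_at_least_Un:
  assumes "D_Sigma_pred P" "finite N" "finite M" "N \<inter> M = {}"
  shows "dim_at_least (N \<union> M) k P e \<longleftrightarrow>
    (\<exists>i j. i + j = k \<and> dim_at_least N i (dim_at_least M j P) e)"
  using assms(3,1,2,4)
proof (induction M arbitrary: P k rule: finite_induct)
  case empty
  have "dim_at_least {} j P = (if j = 0 then P else (\<lambda>_. False))" for j
    by (auto simp: dim_at_least_empty fun_eq_iff)
  thus ?case using not_dim_at_least_False[OF \<open>finite N\<close>] by auto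
next
  case (insert v M)
  note P = \<open>D_Sigma_pred P\<close>
  have vM: "v \<notin> M" "v \<notin> N \<union> M" "N \<inter> M = {}" using insert by auto
  have P': "D_Sigma_pred (ex_at v P)" "D_Sigma_pred (interval_at v P)"
    by (intro D_Sigma_pred_ex_at D_Sigma_pred_interval_at P)+
  have split: "dim_at_least N i (dim_at_least (insert v M) j P) e \<longleftrightarrow>
      dim_at_least N i (dim_at_least M j (ex_at v P)) e \<or>
      (\<exists>l. j = Suc l \<and> dim_at_least N i (dim_at_least M l (interval_at v P)) e)" for i j
  proof (cases j)
    case 0
    thus ?thesis unfolding dim_at_least_insert[OF P insert.hyps, abs_def] by simp
  next
    case (Suc l)
    thus ?thesis
      unfolding dim_at_least_insert[OF P insert.hyps, abs_def]
      using dim_at_least_disj[OF D_Sigma_pred_dim_at_least[OF P'(1) insert.hyps(1)]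
          D_Sigma_pred_dim_at_least[OF P'(2) insert.hyps(1)] \<open>finite N\<close>]
      by simp
  qed
  have "dim_at_least (N \<union> insert v M) k P e \<longleftrightarrow> dim_at_least (N \<union> M) k (ex_at v P) e \<or>
      (\<exists>l. k = Suc l \<and> dim_at_least (N \<union> M) l (interval_at v P) e)"
    using dim_at_least_insert[OF P _ vM(2)] \<open>finite N\<close> insert.hyps(1) by simp
  also have "\<dots> \<longleftrightarrow> (\<exists>i j. i + j = k \<and> dim_at_least N i (dim_at_least (insert v M) j P) e)"
    unfolding insert.IH[OF P'(1) \<open>finite N\<close> vM(3)] insert.IH[OF P'(2) \<open>finite N\<close> vM(3)] split
    by (metis add_Suc_right)
  finally show ?case .
qed

end

section \<open>The dimension of a set\<close>

abbreviation member_pred :: "nat \<Rightarrow> (nat \<Rightarrow> 'a) set \<Rightarrow> (nat \<Rightarrow> 'a) \<Rightarrow> bool" where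
  "member_pred n A \<equiv> \<lambda>e. restrict e {..<n} \<in> A"

lemma restrict_eq_self: "x \<in> pow_space n \<Longrightarrow> restrict x {..<n} = x"
  by (auto simp: PiE_def extensional_restrict)

lemma ex_on_member_pred_iff:
  assumes "A \<subseteq> pow_space n" "S \<subseteq> {..<n}"
  shows "ex_on ({..<n} - S) (member_pred n A) (override_on e z S) \<longleftrightarrow> (\<exists>x\<in>A. \<forall>i\<in>S. x i = z i)"
proof -
  have "restrict (override_on e x {..<n}) {..<n} = restrict x {..<n}" for x :: "nat \<Rightarrow> 'a"
    by (auto simp: fun_eq_iff)
  moreover have "(\<exists>x. (\<forall>i\<in>S. x i = z i) \<and> restrict x {..<n} \<in> A) \<longleftrightarrow> (\<exists>x\<in>A. \<forall>i\<in>S. x i = z i)"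
  proof
    assume "\<exists>x. (\<forall>i\<in>S. x i = z i) \<and> restrict x {..<n} \<in> A"
    then obtain x where x: "\<forall>i\<in>S. x i = z i" "restrict x {..<n} \<in> A" by blast
    thus "\<exists>x\<in>A. \<forall>i\<in>S. x i = z i" using assms(2) by (intro bexI[OF _ x(2)]) auto
  next
    assume "\<exists>x\<in>A. \<forall>i\<in>S. x i = z i"
    thus "\<exists>x. (\<forall>i\<in>S. x i = z i) \<and> restrict x {..<n} \<in> A"
      using assms(1) restrict_eq_self by (metis subsetD)
  qed
  ultimately show ?thesis unfolding ex_on_override_iff[OF assms(2)] by simp
qed

lemma box_on_member_pred_iff:
  assumes "A \<subseteq> pow_space n" "S \<subseteq> {..<n}"
  shows "box_on S (ex_on ({..<n} - S) (member_pred n A)) e \<longleftrightarrow>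
    (\<exists>a b. (\<forall>i\<in>S. a i < b i) \<and> (\<forall>z. in_box S a b z \<longrightarrow> (\<exists>x\<in>A. \<forall>i\<in>S. x i = z i)))"
  unfolding box_on_def ex_on_member_pred_iff[OF assms] ..

lemma openin_pow_top_contains_box:
  fixes x :: "nat \<Rightarrow> 'a::{linorder_topology, no_bot, no_top}"
  assumes "openin (pow_top n) W" "x \<in> W"
  obtains a b where "\<forall>i<n. a i < x i \<and> x i < b i"
    "\<forall>y\<in>pow_space n. (\<forall>i<n. a i < y i \<and> y i < b i) \<longrightarrow> y \<in> W"
proof -
  obtain V where V: "\<forall>i\<in>{..<n}. open (V i)" "x \<in> Pi\<^sub>E {..<n} V" "Pi\<^sub>E {..<n} V \<subseteq> W"
    using bspec[OF assms(1)[unfolded openin_product_topology_alt] assms(2)]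
    unfolding open_openin[symmetric] by blast
  have "\<exists>a b. a < x i \<and> x i < b \<and> {a<..<b} \<subseteq> V i" if "i < n" for i
  proof -
    have "open (V i)" "x i \<in> V i" using V(1,2) that by (auto simp: PiE_iff)
    thus ?thesis by (rule open_contains_interval) blast
  qed
  then obtain a b where ab: "\<And>i. i < n \<Longrightarrow> a i < x i \<and> x i < b i \<and> {a i<..<b i} \<subseteq> V i" by metis
  have "y \<in> W" if "y \<in> pow_space n" "\<forall>i<n. a i < y i \<and> y i < b i" for y
  proof -
    have "y i \<in> V i" if "i < n" for i using ab[OF that] \<open>\<forall>i<n. a i < y i \<and> y i < b i\<close> that by auto
    hence "y \<in> Pi\<^sub>E {..<n} V" using \<open>y \<in> pow_space n\<close> by (simp add: PiE_iff)
    thus ?thesis using V(3) by blast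
  qed
  thus thesis using ab by (intro that) auto
qed

lemma box_of_interior_coord_proj:
  fixes A :: "(nat \<Rightarrow> 'a::{linordered_field, linorder_topology}) set"
  assumes "S \<subseteq> {..<n}"
    and "subtopology (pow_top n) (coord_subspace n S) interior_of (coord_proj n S ` A) \<noteq> {}"
  shows "\<exists>a b. (\<forall>i\<in>S. a i < b i) \<and> (\<forall>z. in_box S a b z \<longrightarrow> (\<exists>x\<in>A. \<forall>i\<in>S. x i = z i))"
proof -
  obtain U x where "openin (subtopology (pow_top n) (coord_subspace n S)) U"
    "U \<subseteq> coord_proj n S ` A" "x \<in> U"
    using assms(2) unfolding interior_of_eq_empty by blast
  then obtain W where W: "openin (pow_top n) W" "W \<inter> coord_subspace n S \<subseteq> coord_proj n S ` A"
    and x: "x \<in> W" "x \<in> coord_subspace n S"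
    unfolding openin_subtopology by blast
  obtain a b where ab: "\<forall>i<n. a i < x i \<and> x i < b i"
    "\<forall>y\<in>pow_space n. (\<forall>i<n. a i < y i \<and> y i < b i) \<longrightarrow> y \<in> W"
    by (rule openin_pow_top_contains_box[OF W(1) x(1)])
  have "\<exists>p\<in>A. \<forall>i\<in>S. p i = z i" if z: "in_box S a b z" for z
  proof -
    let ?y = "\<lambda>i\<in>{..<n}. if i \<in> S then z i else 0"
    have "a i < ?y i \<and> ?y i < b i" if "i < n" for i
    proof (cases "i \<in> S")
      case False
      hence "x i = 0" using x(2) that by (simp add: coord_subspace_def)
      thus ?thesis using ab(1) False that by force
    qed (use z that in simp)
    hence "?y \<in> W" using ab(2) by simp
    moreover have "?y \<in> coord_subspace n S" by (auto simp: coord_subspace_def)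
    ultimately obtain p where p: "p \<in> A" "?y = coord_proj n S p" using W(2) by blast
    have "p i = z i" if "i \<in> S" for i
      using fun_cong[OF p(2), of i] that assms(1) by (auto simp: coord_proj_def split: if_splits)
    thus ?thesis using p(1) by blast
  qed
  moreover have "a i < b i" if "i \<in> S" for i
    using ab(1) assms(1) that by (auto intro: less_trans)
  ultimately show ?thesis by blast
qed

lemma interior_coord_proj_of_box:
  fixes A :: "(nat \<Rightarrow> 'a::{linordered_field, linorder_topology}) set"
  assumes "S \<subseteq> {..<n}" and ab: "\<forall>i\<in>S. a i < b i" "\<forall>z. in_box S a b z \<longrightarrow> (\<exists>x\<in>A. \<forall>i\<in>S. x i = z i)"
  shows "subtopology (pow_top n) (coord_subspace n S) interior_of (coord_proj n S ` A) \<noteq> {}"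
proof -
  let ?W = "Pi\<^sub>E {..<n} (\<lambda>i. if i \<in> S then {a i<..<b i} else UNIV)"
  have "openin (pow_top n) ?W" by (subst openin_PiE) auto
  hence "openin (subtopology (pow_top n) (coord_subspace n S)) (?W \<inter> coord_subspace n S)"
    unfolding openin_subtopology by blast
  moreover have "?W \<inter> coord_subspace n S \<subseteq> coord_proj n S ` A"
  proof
    fix y assume y: "y \<in> ?W \<inter> coord_subspace n S"
    have "in_box S a b y"
    proof
      fix i assume i: "i \<in> S"
      hence "y i \<in> (if i \<in> S then {a i<..<b i} else UNIV)" using y assms(1) by (blast dest: PiE_mem)
      thus "a i < y i \<and> y i < b i" using i by simp
    qed
    then obtain x where x: "x \<in> A" "\<forall>i\<in>S. x i = y i" using ab(2) by blast
    have "y = coord_proj n S x"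
      by (rule extensionalityI[of _ "{..<n}"])
         (use x y in \<open>auto simp: coord_proj_def coord_subspace_def PiE_iff extensional_def\<close>)
    thus "y \<in> coord_proj n S ` A" using x(1) by blast
  qed
  moreover have "(\<lambda>i\<in>{..<n}. if i \<in> S then (a i + b i) / 2 else 0) \<in> ?W \<inter> coord_subspace n S"
    using ab(1) by (auto simp: coord_subspace_def PiE_iff)
  ultimately show ?thesis unfolding interior_of_eq_empty by blast
qed

lemma Fin_le_dim_set_iff:
  fixes A :: "(nat \<Rightarrow> 'a::{linordered_field, linorder_topology}) set"
  assumes A: "A \<subseteq> pow_space n"
  shows "Fin k \<le> dim_set n A \<longleftrightarrow> dim_at_least {..<n} k (member_pred n A) e"
proof -
  let ?D = "{card S | S. S \<subseteq> {..<n} \<and>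
     subtopology (pow_top n) (coord_subspace n S) interior_of (coord_proj n S ` A) \<noteq> {}}"
  have interior_iff: "subtopology (pow_top n) (coord_subspace n S) interior_of (coord_proj n S ` A) \<noteq> {} \<longleftrightarrow>
      box_on S (ex_on ({..<n} - S) (member_pred n A)) e" if "S \<subseteq> {..<n}" for S
    unfolding box_on_member_pred_iff[OF A that]
    using box_of_interior_coord_proj[OF that] interior_coord_proj_of_box[OF that] by blast
  have D_iff: "d \<in> ?D \<longleftrightarrow> dim_at_least {..<n} d (member_pred n A) e" for d
    unfolding dim_at_least_def using interior_iff by blast
  have fin: "finite ?D" by (rule finite_subset[of _ "card ` Pow {..<n}"]) auto
  show ?thesis
  proof (cases "A = {}")
    case True
    thus ?thesis by (simp add: dim_set_def not_dim_at_least_False)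
  next
    case False
    then obtain x where "x \<in> A" by blast
    hence "restrict (override_on e x {..<n}) {..<n} \<in> A"
      using A restrict_eq_self[of x n]
      by (auto simp: override_on_def restrict_def fun_eq_iff cong: if_cong)
    hence "0 \<in> ?D" unfolding D_iff dim_at_least_0[OF finite_lessThan] ex_on_def by blast
    hence "?D \<noteq> {}" by blast
    hence "k \<le> Max ?D \<longleftrightarrow> (\<exists>d\<in>?D. k \<le> d)" by (rule Max_ge_iff[OF fin])
    also have "\<dots> \<longleftrightarrow> dim_at_least {..<n} k (member_pred n A) e"
      unfolding Bex_def D_iff using dim_at_least_antimono by blast
    finally show ?thesis using False by (simp add: dim_set_def)
  qed
qed

lemma extended_leI:
  assumes le: "\<And>k::nat. Fin k \<le> x \<Longrightarrow> Fin k \<le> y"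
  shows "x \<le> y"
proof (cases x)
  case Pinf
  hence all: "Fin k \<le> y" for k using le by simp
  show ?thesis
  proof (cases y)
    case (Fin m)
    thus ?thesis using all[of "Suc m"] by simp
  qed (use all[of 0] in simp_all)
qed (use le in auto)

lemma extended_eqI:
  assumes "\<And>k::nat. Fin k \<le> x \<longleftrightarrow> Fin k \<le> y"
  shows "x = y"
proof (rule antisym)
  show "x \<le> y" by (rule extended_leI) (simp only: assms)
  show "y \<le> x" by (rule extended_leI) (simp only: assms)
qed

lemma Fin_le_plus_iff:
  fixes p q :: "nat extended"
  assumes "p \<noteq> Pinf" "q \<noteq> Pinf"
  shows "Fin k \<le> p + q \<longleftrightarrow> (\<exists>i j. i + j = k \<and> Fin i \<le> p \<and> Fin j \<le> q)"
proof (cases p; cases q)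
  fix a b assume "p = Fin a" "q = Fin b"
  moreover have "k \<le> a + b \<longleftrightarrow> (\<exists>i j. i + j = k \<and> i \<le> a \<and> j \<le> b)"
    by (metis add_mono nat_le_iff_add nat_add_left_cancel_le le_add1 le_add_diff_inverse le_cases)
  ultimately show ?thesis by simp
qed (use assms in auto)

lemma dim_set_neq_Pinf: "dim_set n A \<noteq> Pinf"
  by (simp add: dim_set_def)

lemma dim_set_mono:
  fixes A B :: "(nat \<Rightarrow> 'a::{linordered_field, linorder_topology}) set"
  assumes "A \<subseteq> B" "B \<subseteq> pow_space n"
  shows "dim_set n A \<le> dim_set n B"
proof (rule extended_leI)
  fix k
  have "A \<subseteq> pow_space n" using assms by blast
  moreover assume "Fin k \<le> dim_set n A"
  ultimately have "dim_at_least {..<n} k (member_pred n A) undefined" using Fin_le_dim_set_iff by blast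
  hence "dim_at_least {..<n} k (member_pred n B) undefined"
    by (rule dim_at_least_mono) (use assms(1) in blast)
  thus "Fin k \<le> dim_set n B" using Fin_le_dim_set_iff[OF assms(2)] by blast
qed

lemma dense_in_box_of_closure_of:
  fixes A :: "(nat \<Rightarrow> 'a::{dense_linorder, linorder_topology}) set"
  assumes A: "A \<subseteq> pow_space n" and S: "S \<subseteq> {..<n}"
    and closure: "\<forall>z. in_box S a b z \<longrightarrow> (\<exists>x\<in>pow_top n closure_of A. \<forall>i\<in>S. x i = z i)"
  shows "dense_in_box S (ex_on ({..<n} - S) (member_pred n A)) e a b"
  unfolding dense_in_box_def ex_on_member_pred_iff[OF A S]
proof (intro allI impI)
  fix a' b' assume a'b': "\<forall>i\<in>S. a i \<le> a' i \<and> a' i < b' i \<and> b' i \<le> b i"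
  have "\<forall>i\<in>S. a' i < b' i" using a'b' by blast
  then obtain z where z: "in_box S a' b' z" by (rule in_box_nonempty)
  hence "in_box S a b z" using a'b' by (auto intro: le_less_trans less_le_trans)
  then obtain x where x: "x \<in> pow_top n closure_of A" "\<forall>i\<in>S. x i = z i" using closure by blast
  let ?W = "Pi\<^sub>E {..<n} (\<lambda>i. if i \<in> S then {a' i<..<b' i} else UNIV)"
  have "openin (pow_top n) ?W" by (subst openin_PiE) auto
  moreover have "x \<in> pow_space n" using x(1) closure_of_subset_topspace[of "pow_top n" A] by auto
  hence "x \<in> ?W" using x(2) z by (auto simp: PiE_iff)
  ultimately obtain y where y: "y \<in> A" "y \<in> ?W" using x(1) unfolding in_closure_of by blast
  have "in_box S a' b' y"
  proof
    fix i assume i: "i \<in> S"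
    hence "y i \<in> (if i \<in> S then {a' i<..<b' i} else UNIV)" using y(2) S by (blast dest: PiE_mem)
    thus "a' i < y i \<and> y i < b' i" using i by simp
  qed
  thus "\<exists>z. in_box S a' b' z \<and> (\<exists>x\<in>A. \<forall>i\<in>S. x i = z i)" using y(1) by blast
qed

lemma continuous_map_restrict:
  "continuous_map (euclidean :: (nat \<Rightarrow> 'a::topological_space) topology) (pow_top n) (\<lambda>e. restrict e {..<n})"
  unfolding continuous_map_componentwise by auto

lemma closed_member_pred:
  fixes Y :: "(nat \<Rightarrow> 'a::topological_space) set"
  assumes "closedin (pow_top n) Y"
  shows "closed {e. member_pred n Y e}"
  using closedin_continuous_map_preimage[OF continuous_map_restrict assms] by simp

lemma Hausdorff_space_pow_top: "Hausdorff_space (pow_top n :: (nat \<Rightarrow> 'a::t2_space) topology)"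
proof -
  have "Hausdorff_space (euclidean :: 'a topology)"
    unfolding Hausdorff_space_def disjnt_def using hausdorff by auto
  thus ?thesis by (simp add: Hausdorff_space_product_topology)
qed

lemma restrict_concat_point:
  "x \<in> pow_space n \<Longrightarrow> restrict (concat_point n m x y) {..<n} = x"
  by (rule extensionalityI[of _ "{..<n}"]) (auto simp: concat_point_def PiE_def)

lemma restrict_add_eq_concat_point:
  "restrict e {..<n + m} = concat_point n m (restrict e {..<n}) (\<lambda>i\<in>{..<m}. e (n + i))"
  by (rule extensionalityI[of _ "{..<n + m}"]) (auto simp: concat_point_def)

lemma concat_point_eq_iff:
  assumes "x \<in> pow_space n" "x' \<in> pow_space n" "y \<in> pow_space m" "y' \<in> pow_space m"
  shows "concat_point n m x y = concat_point n m x' y' \<longleftrightarrow> x = x' \<and> y = y'"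
proof
  assume eq: "concat_point n m x y = concat_point n m x' y'"
  have "y i = y' i" if "i < m" for i
    using fun_cong[OF eq, of "n + i"] that by (simp add: concat_point_def)
  hence "y = y'" using assms(3,4) by (intro extensionalityI[of _ "{..<m}"]) (auto simp: PiE_def)
  thus "x = x' \<and> y = y'" using eq restrict_concat_point assms(1,2) by metis
qed simp

lemma member_pred_graph_iff:
  assumes "A \<subseteq> pow_space n" "f ` A \<subseteq> pow_space m"
  shows "member_pred (n + m) ((\<lambda>x. concat_point n m x (f x)) ` A) e \<longleftrightarrow>
    restrict e {..<n} \<in> A \<and> f (restrict e {..<n}) = (\<lambda>i\<in>{..<m}. e (n + i))"
proof -
  have "concat_point n m (restrict e {..<n}) (\<lambda>i\<in>{..<m}. e (n + i)) = concat_point n m x (f x) \<longleftrightarrow>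
      restrict e {..<n} = x \<and> (\<lambda>i\<in>{..<m}. e (n + i)) = f x" if "x \<in> A" for x
    using that assms by (intro concat_point_eq_iff) auto
  thus ?thesis unfolding restrict_add_eq_concat_point image_iff by force
qed

lemma closed_Collect_graph:
  fixes A :: "(nat \<Rightarrow> 'a::t2_space) set"
  assumes sub: "A \<subseteq> pow_space n" "f ` A \<subseteq> pow_space m"
    and cont: "continuous_map (subtopology (pow_top n) A) (pow_top m) f"
    and "closed {e. P e}" and P: "\<And>e. P e \<Longrightarrow> restrict e {..<n} \<in> A"
  shows "closed {e. P e \<and> member_pred (n + m) ((\<lambda>x. concat_point n m x (f x)) ` A) e}"
proof -
  let ?C = "{e. P e}"
  have "continuous_map (top_of_set ?C) (subtopology (pow_top n) A) (\<lambda>e. restrict e {..<n})"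
    using P by (auto simp: continuous_map_in_subtopology continuous_map_from_subtopology continuous_map_restrict)
  from continuous_map_compose[OF this cont]
  have "continuous_map (top_of_set ?C) (pow_top m) (\<lambda>e. f (restrict e {..<n}))" by (simp add: comp_def)
  moreover have "continuous_map (top_of_set ?C) (pow_top m) (\<lambda>e. \<lambda>i\<in>{..<m}. e (n + i))"
    by (intro continuous_map_from_subtopology) (auto simp: continuous_map_componentwise)
  ultimately have "closedin (top_of_set ?C) {e \<in> ?C. f (restrict e {..<n}) = (\<lambda>i\<in>{..<m}. e (n + i))}"
    using closedin_continuous_maps_eq[OF Hausdorff_space_pow_top] by fastforce
  hence "closed {e \<in> ?C. f (restrict e {..<n}) = (\<lambda>i\<in>{..<m}. e (n + i))}"
    by (rule closedin_closed_trans[OF _ assms(4)])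
  moreover have "{e \<in> ?C. f (restrict e {..<n}) = (\<lambda>i\<in>{..<m}. e (n + i))} =
      {e. P e \<and> member_pred (n + m) ((\<lambda>x. concat_point n m x (f x)) ` A) e}"
    using P unfolding member_pred_graph_iff[OF sub] by blast
  ultimately show ?thesis by simp
qed

lemma ex_on_graph_iff:
  assumes sub: "A \<subseteq> pow_space n" "f ` A \<subseteq> pow_space m"
  shows "ex_on {..<n} (member_pred (n + m) ((\<lambda>x. concat_point n m x (f x)) ` A)) e \<longleftrightarrow>
    (\<lambda>i\<in>{..<m}. e (n + i)) \<in> f ` A"
proof
  assume "ex_on {..<n} (member_pred (n + m) ((\<lambda>x. concat_point n m x (f x)) ` A)) e"
  then obtain x where x: "restrict (override_on e x {..<n}) {..<n} \<in> A"
    "f (restrict (override_on e x {..<n}) {..<n}) = (\<lambda>i\<in>{..<m}. override_on e x {..<n} (n + i))"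
    unfolding ex_on_def member_pred_graph_iff[OF sub] by blast
  have "(\<lambda>i\<in>{..<m}. override_on e x {..<n} (n + i)) = (\<lambda>i\<in>{..<m}. e (n + i))" by auto
  thus "(\<lambda>i\<in>{..<m}. e (n + i)) \<in> f ` A" using x by (metis imageI)
next
  assume "(\<lambda>i\<in>{..<m}. e (n + i)) \<in> f ` A"
  then obtain x where x: "x \<in> A" "f x = (\<lambda>i\<in>{..<m}. e (n + i))" by (metis imageE)
  have "restrict (override_on e x {..<n}) {..<n} = restrict x {..<n}" by (auto simp: fun_eq_iff)
  also have "\<dots> = x" using x(1) sub(1) by (intro restrict_eq_self) blast
  finally have "restrict (override_on e x {..<n}) {..<n} = x" .
  moreover have "(\<lambda>i\<in>{..<m}. override_on e x {..<n} (n + i)) = (\<lambda>i\<in>{..<m}. e (n + i))" by auto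
  ultimately show "ex_on {..<n} (member_pred (n + m) ((\<lambda>x. concat_point n m x (f x)) ` A)) e"
    unfolding ex_on_def member_pred_graph_iff[OF sub] using x by metis
qed

lemma add_image_lessThan: "(+) n ` {..<m} = {n..<n + m}" for n m :: nat
  by (simp add: lessThan_atLeast0 add.commute)

lemma dim_at_least_image_graph:
  assumes sub: "A \<subseteq> pow_space n" "f ` A \<subseteq> pow_space m"
  shows "dim_at_least {n..<n + m} k
      (ex_on {..<n} (member_pred (n + m) ((\<lambda>x. concat_point n m x (f x)) ` A))) e \<longleftrightarrow>
    dim_at_least {..<m} k (member_pred m (f ` A)) e'"
  unfolding add_image_lessThan[symmetric]
proof (rule dim_at_least_image)
  fix x
  have "(\<lambda>i\<in>{..<m}. override_on e x ((+) n ` {..<m}) (n + i)) =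
      restrict (override_on e' (x \<circ> (+) n) {..<m}) {..<m}"
    by (auto simp: fun_eq_iff)
  thus "ex_on {..<n} (member_pred (n + m) ((\<lambda>x. concat_point n m x (f x)) ` A))
      (override_on e x ((+) n ` {..<m})) \<longleftrightarrow>
    member_pred m (f ` A) (override_on e' (x \<circ> (+) n) {..<m})"
    unfolding ex_on_graph_iff[OF sub] by (simp only:)
qed (rule inj_on_add)

lemma dim_at_least_graph_fiber:
  fixes A :: "(nat \<Rightarrow> 'a::dense_linorder) set"
  assumes sub: "A \<subseteq> pow_space n" "f ` A \<subseteq> pow_space m"
    and dim: "dim_at_least {n..<n + m} k (member_pred (n + m) ((\<lambda>x. concat_point n m x (f x)) ` A)) e"
  shows "k = 0"
proof (rule ccontr)
  assume "k \<noteq> 0"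
  hence "0 < k" by simp
  obtain x y i where i: "i \<in> {n..<n + m}" "x i \<noteq> y i"
    and xy: "member_pred (n + m) ((\<lambda>x. concat_point n m x (f x)) ` A) (override_on e x {n..<n + m})"
      "member_pred (n + m) ((\<lambda>x. concat_point n m x (f x)) ` A) (override_on e y {n..<n + m})"
    by (rule dim_at_least_pos_not_unique[OF dim \<open>0 < k\<close>])
  have "restrict (override_on e x {n..<n + m}) {..<n} = restrict (override_on e y {n..<n + m}) {..<n}"
    by (auto simp: fun_eq_iff)
  hence "(\<lambda>k\<in>{..<m}. override_on e x {n..<n + m} (n + k)) = (\<lambda>k\<in>{..<m}. override_on e y {n..<n + m} (n + k))"
    using xy unfolding member_pred_graph_iff[OF sub] by metis
  moreover obtain l where l: "i = n + l" "l < m" using i(1) by (auto simp: le_iff_add)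
  ultimately have "x i = y i" by (auto dest: fun_cong[of _ _ l])
  thus False using i(2) by simp
qed

lemma member_pred_proj_first:
  assumes "B \<subseteq> pow_space (n + m)"
  shows "member_pred n (proj_first n ` B) = ex_on {n..<n + m} (member_pred (n + m) B)"
proof (intro ext iffI)
  fix e assume "member_pred n (proj_first n ` B) e"
  then obtain y where y: "y \<in> B" "restrict e {..<n} = restrict y {..<n}"
    unfolding proj_first_def by blast
  have "e i = y i" if "i < n" for i using fun_cong[OF y(2), of i] that by simp
  hence "restrict (override_on e y {n..<n + m}) {..<n + m} = restrict y {..<n + m}"
    by (auto simp: fun_eq_iff override_on_def)
  also have "\<dots> = y" using y(1) assms by (intro restrict_eq_self) blast
  finally show "ex_on {n..<n + m} (member_pred (n + m) B) e" using y(1) unfolding ex_on_def by metis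
next
  fix e assume "ex_on {n..<n + m} (member_pred (n + m) B) e"
  then obtain w where w: "restrict (override_on e w {n..<n + m}) {..<n + m} \<in> B"
    unfolding ex_on_def by blast
  have "restrict e {..<n} = proj_first n (restrict (override_on e w {n..<n + m}) {..<n + m})"
    by (auto simp: proj_first_def fun_eq_iff override_on_def)
  thus "member_pred n (proj_first n ` B) e" using w by blast
qed

context restrained_expansion
begin

lemma D_Sigma_subset: "D_Sigma K n A \<Longrightarrow> A \<subseteq> pow_space n"
  unfolding D_Sigma_def definable_def by blast

lemma D_Sigma_pred_member:
  assumes "D_Sigma K n A"
  shows "D_Sigma_pred (member_pred n A)"
proof -
  obtain Y where Y: "definable K (n + 1) Y" "closedin (pow_top (n + 1)) Y" "A = proj_first n ` Y"
    using assms unfolding D_Sigma_def by blast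
  have "Y \<subseteq> pow_space (n + 1)" using closedin_subset[OF Y(2)] by simp
  hence "member_pred n A = ex_on {n..<n + 1} (member_pred (n + 1) Y)"
    unfolding Y(3) by (rule member_pred_proj_first)
  moreover have "D_Sigma_pred (member_pred (n + 1) Y)"
    by (intro D_Sigma_pred_of_closed definable_pred_of_definable closed_member_pred Y)
  ultimately show ?thesis by (simp add: D_Sigma_pred_ex_on)
qed

lemma dim_closure_of:
  assumes A: "D_Sigma K n A"
  shows "dim_set n (pow_top n closure_of A) = dim_set n A"
proof (rule antisym)
  let ?C = "pow_top n closure_of A"
  have C: "?C \<subseteq> pow_space n" using closure_of_subset_topspace[of "pow_top n" A] by simp
  note A_sub = D_Sigma_subset[OF A]
  show "dim_set n A \<le> dim_set n ?C"
    by (rule dim_set_mono[OF closure_of_subset C]) (use A_sub in simp)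
  show "dim_set n ?C \<le> dim_set n A"
  proof (rule extended_leI)
    fix k assume "Fin k \<le> dim_set n ?C"
    hence "dim_at_least {..<n} k (member_pred n ?C) undefined" using Fin_le_dim_set_iff[OF C] by blast
    then obtain S where S: "S \<subseteq> {..<n}" "card S = k"
      "box_on S (ex_on ({..<n} - S) (member_pred n ?C)) undefined" unfolding dim_at_least_def by blast
    then obtain a b where ab: "\<forall>i\<in>S. a i < b i" "\<forall>z. in_box S a b z \<longrightarrow> (\<exists>x\<in>?C. \<forall>i\<in>S. x i = z i)"
      unfolding box_on_member_pred_iff[OF C S(1)] by blast
    have "dense_in_box S (ex_on ({..<n} - S) (member_pred n A)) undefined a b"
      by (rule dense_in_box_of_closure_of[OF A_sub S(1) ab(2)])
    moreover have "finite S" "finite ({..<n} - S)" using S(1) finite_subset by auto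
    ultimately have "box_on S (ex_on ({..<n} - S) (member_pred n A)) undefined"
      using ab(1) by (intro box_on_of_dense_in_box D_Sigma_pred_ex_on D_Sigma_pred_member A)
    hence "dim_at_least {..<n} k (member_pred n A) undefined" by (rule dim_at_leastI[OF S(1,2)])
    thus "Fin k \<le> dim_set n A" using Fin_le_dim_set_iff[OF A_sub] by blast
  qed
qed

lemma dim_union:
  assumes A: "D_Sigma K n A" and A': "D_Sigma K n A'"
  shows "dim_set n (A \<union> A') = max (dim_set n A) (dim_set n A')"
proof (rule extended_eqI)
  fix k
  have "A \<union> A' \<subseteq> pow_space n" using D_Sigma_subset A A' by blast
  thus "Fin k \<le> dim_set n (A \<union> A') \<longleftrightarrow> Fin k \<le> max (dim_set n A) (dim_set n A')"
    using dim_at_least_disj[OF D_Sigma_pred_member[OF A] D_Sigma_pred_member[OF A'], of "{..<n}" k undefined]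
    by (simp add: le_max_iff_disj
          Fin_le_dim_set_iff[where e = undefined] D_Sigma_subset[OF A] D_Sigma_subset[OF A'])
qed

lemma D_Sigma_pred_graph:
  assumes A: "D_Sigma K n A" and f: "definable_map K n m A f"
    and cont: "continuous_map (subtopology (pow_top n) A) (pow_top m) f"
  shows "D_Sigma_pred (member_pred (n + m) ((\<lambda>x. concat_point n m x (f x)) ` A))"
proof -
  let ?G = "(\<lambda>x. concat_point n m x (f x)) ` A"
  have sub: "A \<subseteq> pow_space n" "f ` A \<subseteq> pow_space m" and G: "definable K (n + m) ?G"
    using f unfolding definable_map_def by auto
  obtain Q where Q: "D_Sigma_family Q" "member_pred n A = (\<lambda>e. \<exists>t. Q t e)"
    using D_Sigma_pred_member[OF A] unfolding D_Sigma_pred_def by blast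
  have "closed {e. Q t e \<and> member_pred (n + m) ?G e}" for t
  proof -
    have "restrict e {..<n} \<in> A" if "Q t e" for e using that fun_cong[OF Q(2), of e] by blast
    thus ?thesis by (intro closed_Collect_graph[OF sub cont D_Sigma_familyD(1)[OF Q(1)]])
  qed
  moreover have "definable_pred (\<lambda>e. Q (e 0) (\<lambda>i. e (Suc i)) \<and> member_pred (n + m) ?G (\<lambda>i. e (Suc i)))"
    by (intro definable_pred_conj definable_pred_family[OF Q(1)]
        definable_pred_rename[OF definable_pred_of_definable[OF G]] definable_term_var)
  moreover have "mono (\<lambda>t e. Q t e \<and> member_pred (n + m) ?G e)"
    using mono_predD[OF D_Sigma_familyD(2)[OF Q(1)]] by (intro monoI predicate1I) blast
  ultimately have "D_Sigma_family (\<lambda>t e. Q t e \<and> member_pred (n + m) ?G e)"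
    unfolding D_Sigma_family_def using D_Sigma_familyD(3)[OF Q(1)] by blast
  moreover have "member_pred (n + m) ?G = (\<lambda>e. \<exists>t. Q t e \<and> member_pred (n + m) ?G e)"
    using fun_cong[OF Q(2)] member_pred_graph_iff[OF sub] by (intro ext) blast
  ultimately show ?thesis unfolding D_Sigma_pred_def by blast
qed

lemma dim_image_le:
  assumes A: "D_Sigma K n A" and f: "definable_map K n m A f"
    and cont: "continuous_map (subtopology (pow_top n) A) (pow_top m) f"
  shows "dim_set m (f ` A) \<le> dim_set n A"
proof (rule extended_leI)
  have sub: "A \<subseteq> pow_space n" "f ` A \<subseteq> pow_space m" using f unfolding definable_map_def by auto
  let ?N = "{..<n}" and ?M = "{n..<n + m}"
  let ?G = "member_pred (n + m) ((\<lambda>x. concat_point n m x (f x)) ` A)"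
  have dim_Un: "dim_at_least (V \<union> W) k ?G undefined \<longleftrightarrow>
      (\<exists>i j. i + j = k \<and> dim_at_least V i (dim_at_least W j ?G) undefined)"
    if "finite V" "finite W" "V \<inter> W = {}" for V W k
    by (rule dim_at_least_Un[OF D_Sigma_pred_graph[OF A f cont] that])
  fix k assume "Fin k \<le> dim_set m (f ` A)"
  hence "dim_at_least {..<m} k (member_pred m (f ` A)) undefined"
    using Fin_le_dim_set_iff[OF sub(2)] by blast
  hence "dim_at_least ?M k (ex_on ?N ?G) undefined"
    unfolding dim_at_least_image_graph[OF sub, where e' = undefined] .
  hence over_image: "dim_at_least ?M k (dim_at_least ?N 0 ?G) undefined"
    by (simp only: dim_at_least_0 finite_lessThan)
  have MN: "finite ?M" "finite ?N" "?M \<inter> ?N = {}" "?N \<inter> ?M = {}" by auto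
  have "dim_at_least (?M \<union> ?N) k ?G undefined"
    unfolding dim_Un[OF MN(1,2,3)] by (intro exI[of _ k] exI[of _ 0] conjI over_image) simp
  hence "dim_at_least (?N \<union> ?M) k ?G undefined" by (simp only: Un_commute)
  then obtain i j where ij: "i + j = k" "dim_at_least ?N i (dim_at_least ?M j ?G) undefined"
    unfolding dim_Un[OF MN(2,1,4)] by blast
  have "j = 0"
    using ex_on_of_dim_at_least[OF finite_lessThan ij(2)] dim_at_least_graph_fiber[OF sub]
    unfolding ex_on_def by blast
  hence "dim_at_least ?N k (ex_on ?M ?G) undefined"
    using ij by (simp only: dim_at_least_0 finite_atLeastLessThan) simp
  hence "dim_at_least ?N k (member_pred n A) undefined"
  proof (rule dim_at_least_mono)
    fix e assume "ex_on ?M ?G e"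
    then obtain x where "restrict (override_on e x ?M) ?N \<in> A"
      unfolding ex_on_def member_pred_graph_iff[OF sub] by blast
    moreover have "restrict (override_on e x ?M) ?N = restrict e ?N" by (auto simp: fun_eq_iff)
    ultimately show "member_pred n A e" by simp
  qed
  thus "Fin k \<le> dim_set n A" using Fin_le_dim_set_iff[OF sub(1)] by blast
qed

lemma dim_at_least_fiber_iff:
  fixes B :: "(nat \<Rightarrow> 'a) set"
  shows "dim_at_least {n..<n + m} j (member_pred (n + m) B) e \<longleftrightarrow>
    Fin j \<le> dim_set m (fiber n m B (restrict e {..<n}))"
proof -
  let ?F = "fiber n m B (restrict e {..<n})" and ?M = "{n..<n + m}"
  have "restrict (override_on e x ?M) {..<n} = restrict e {..<n}" for x
    by (auto simp: override_on_def cong: restrict_cong)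
  moreover have "(\<lambda>i\<in>{..<m}. override_on e x ?M (n + i)) = (\<lambda>i\<in>{..<m}. x (n + i))" for x
    by (auto simp: override_on_def cong: restrict_cong)
  ultimately have member: "member_pred (n + m) B (override_on e x ?M) \<longleftrightarrow>
      member_pred m ?F (override_on e (x \<circ> (+) n) {..<m})" for x
    unfolding restrict_add_eq_concat_point
    by (auto simp: fiber_def override_on_def cong: restrict_cong)
  have M: "?M = (+) n ` {..<m}" by (rule add_image_lessThan[symmetric])
  have "dim_at_least ?M j (member_pred (n + m) B) e \<longleftrightarrow> dim_at_least {..<m} j (member_pred m ?F) e"
    unfolding M by (rule dim_at_least_image) (rule inj_on_add, rule member[unfolded M])
  moreover have "?F \<subseteq> pow_space m" unfolding fiber_def by blast
  ultimately show ?thesis using Fin_le_dim_set_iff by blast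
qed

lemma dim_fibers:
  assumes B: "D_Sigma K (n + m) B"
    and q: "\<forall>a\<in>proj_first n ` B. dim_set m (fiber n m B a) = q" "q \<noteq> Pinf"
  shows "dim_set (n + m) B = dim_set n (proj_first n ` B) + q"
proof (rule extended_eqI)
  let ?N = "{..<n}" and ?M = "{n..<n + m}" and ?P = "member_pred (n + m) B" and ?C = "proj_first n ` B"
  have B_sub: "B \<subseteq> pow_space (n + m)" by (rule D_Sigma_subset[OF B])
  have C_sub: "?C \<subseteq> pow_space n" by (simp add: proj_first_def image_subset_iff)
  have "dim_at_least ?M j ?P e \<longleftrightarrow> member_pred n ?C e \<and> Fin j \<le> q" for j e
    using ex_on_of_dim_at_least[of ?M j ?P e] fun_cong[OF member_pred_proj_first[OF B_sub], of e]
      dim_at_least_fiber_iff[of n m j B e] q(1) by auto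
  hence "dim_at_least ?M j ?P = (if Fin j \<le> q then member_pred n ?C else (\<lambda>_. False))" for j
    by (auto simp: fun_eq_iff)
  hence base: "dim_at_least ?N i (dim_at_least ?M j ?P) e \<longleftrightarrow> Fin i \<le> dim_set n ?C \<and> Fin j \<le> q" for i j e
    using Fin_le_dim_set_iff[OF C_sub, of i e] not_dim_at_least_False[OF finite_lessThan, of n i e]
    by simp
  have split: "{..<n + m} = ?N \<union> ?M" "?N \<inter> ?M = {}" by auto
  fix k
  have "Fin k \<le> dim_set (n + m) B \<longleftrightarrow> dim_at_least (?N \<union> ?M) k ?P undefined"
    unfolding Fin_le_dim_set_iff[OF B_sub, where e = undefined] split(1) ..
  also have "\<dots> \<longleftrightarrow> (\<exists>i j. i + j = k \<and> Fin i \<le> dim_set n ?C \<and> Fin j \<le> q)"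
    unfolding dim_at_least_Un[OF D_Sigma_pred_member[OF B] finite_lessThan finite_atLeastLessThan split(2)]
      base ..
  also have "\<dots> \<longleftrightarrow> Fin k \<le> dim_set n ?C + q"
    by (rule Fin_le_plus_iff[OF dim_set_neq_Pinf q(2), symmetric])
  finally show "Fin k \<le> dim_set (n + m) B \<longleftrightarrow> Fin k \<le> dim_set n ?C + q" .
qed

end

theorem theorem1p13:
  fixes K :: "('f, 'r, 'a::{linordered_field, linorder_topology}) expansion"
    and n :: nat
    and A A' :: "(nat \<Rightarrow> 'a) set"
  assumes "restrained K"
    and "D_Sigma K n A"
    and "D_Sigma K n A'"
  shows "dim_set n (pow_top n closure_of A) = dim_set n A \<and>
    (\<forall>f. definable_map K n n A f \<and> continuous_map (subtopology (pow_top n) A) (pow_top n) f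
       \<longrightarrow> dim_set n (f ` A) \<le> dim_set n A) \<and>
    dim_set n (A \<union> A') = max (dim_set n A) (dim_set n A') \<and>
    (\<forall>m B C p q. D_Sigma K (n + m) B \<and> C = proj_first n ` B \<and>
       dim_set n C = p \<and> (\<forall>a\<in>C. dim_set m (fiber n m B a) = q) \<and> q \<noteq> Pinf
       \<longrightarrow> dim_set (n + m) B = p + q)"
proof -
  interpret restrained_expansion K by unfold_locales fact
  show ?thesis
  proof (intro conjI allI impI; (elim conjE)?)
    show "dim_set n (pow_top n closure_of A) = dim_set n A" by (rule dim_closure_of[OF assms(2)])
    show "dim_set n (f ` A) \<le> dim_set n A"
      if "definable_map K n n A f" "continuous_map (subtopology (pow_top n) A) (pow_top n) f" for f
      by (rule dim_image_le[OF assms(2) that])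
    show "dim_set n (A \<union> A') = max (dim_set n A) (dim_set n A')" by (rule dim_union[OF assms(2,3)])
    show "dim_set (n + m) B = p + q"
      if "D_Sigma K (n + m) B" "C = proj_first n ` B" "dim_set n C = p"
        "\<forall>a\<in>C. dim_set m (fiber n m B a) = q" "q \<noteq> Pinf" for m B C p q
      using dim_fibers[of n m B q] that by simp
  qed
qed

end
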